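(* Let $0<p\leq u<\infty$, $0<q\leq\infty$, $s\in\mathbb{R}$ and $K\in\mathbb{N}_0$. Then the expressions $\|\cdot\mid\mathcal{E}^s_{u,p,q}(\mathbb{R}^d)\|$, $\|\cdot\mid\mathcal{E}^s_{u,p,q}(\mathbb{R}^d)\|_K^{\clubsuit}$ and $\|\cdot\mid\mathcal{E}^s_{u,p,q}(\mathbb{R}^d)\|_K$ are mutually equivalent on $\mathcal{S}'(\mathbb{R}^d)$. If $s>\sigma_p$, then also $\|\cdot\mid\mathcal{E}^s_{u,p,q}(\mathbb{R}^d)\|_\infty^{\clubsuit}\sim\|\cdot\mid\mathcal{E}^s_{u,p,q}(\mathbb{R}^d)\|$ on $\mathcal{S}'(\mathbb{R}^d)$.
   Context: Equivalence ($\sim$) on $\mathcal{S}'(\mathbb{R}^d)$ of two expressions with values in $[0,\infty]$ means that each is bounded by a constant times the other for all $f\in\mathcal{S}'(\mathbb{R}^d)$, with constants independent of $f$ (they may depend on the fixed parameters $d,s,u,p,q,K,\varphi_0$); in particular one is finite iff the other is. $\sigma_p:=d\max\{0,\frac1p-1\}$. Morrey space: for $0<p\leq u<\infty$, $\mathcal{M}^u_p(\mathbb{R}^d)$ is the set of all (complex-valued) $f\in L_p^{\mathrm{loc}}(\mathbb{R}^d)$ with $$\|f\mid\mathcal{M}^u_p(\mathbb{R}^d)\|:=\sup_{y\in\mathbb{R}^d,R>0}|B(y,R)|^{\frac1u-\frac1p}\Big(\int_{B(y,R)}|f(x)|^p\,dx\Big)^{1/p}<\infty$$ (the expression is $\infty$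 for other measurable functions). Fix $1\leq a<b\leq2$ and a non-negative $\varphi_0\in C_0^\infty(\mathbb{R}^d)$ with $\varphi_0(x)=1$ for $|x|\leq a$ and $\varphi_0(x)=0$ for $|x|\geq b$. Put $\psi(x):=\varphi_0(x)-\varphi_0(2x)$, $\psi_k(x):=\psi(2^{-k}x)$ for $k\in\mathbb{Z}$, and $\varphi_k:=\psi_k$ for $k\in\mathbb{N}$. For $\lambda>0$, $(D_\lambda g)(x):=g(\lambda x)$. $\mathcal{F}$ is the Fourier transform on $\mathcal{S}'(\mathbb{R}^d)$; for $\eta\in C_0^\infty(\mathbb{R}^d)$ and $f\in\mathcal{S}'(\mathbb{R}^d)$ the distribution $\mathcal{F}^{-1}[\eta\mathcal{F}f]$ is identified with a smooth function. Triebel-Lizorkin-Morrey quasi-norm: for $f\in\mathcal{S}'(\mathbb{R}^d)$, $$\|f\mid\mathcal{E}^s_{u,p,q}(\mathbb{R}^d)\|:=\Big\|\Big(\sum_{k=0}^\infty2^{ksq}|\mathcal{F}^{-1}[\varphi_k\mathcal{F}f](\cdot)|^q\Big)^{1/q}\ \Big|\ \mathcal{M}^u_p(\mathbb{R}^d)\Big\|$$ (supremum over $k$ if $q=\infty$); $\mathcal{E}^s_{u,p,q}(\mathbb{R}^d)$ consists of those $f$ for which it is finite. For $K\in\mathbb{Z}\cup\{\infty\}$ let (with supremum over $k$ if $q=\infty$) $$|f|_K:=\Big\|\Big(\sum_{k=-K}^\infty2^{ksq}|\mathcal{F}^{-1}[\psi_k\mathcal{F}f](\cdot)|^q\Big)^{1/q}\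 \Big|\ \mathcal{M}^u_p(\mathbb{R}^d)\Big\|.$$ For $K\in\mathbb{N}_0\cup\{\infty\}$ let $$\|f\mid\mathcal{E}^s_{u,p,q}(\mathbb{R}^d)\|_K^{\clubsuit}:=\|\mathcal{F}^{-1}[\varphi_0\mathcal{F}f]\mid\mathcal{M}^u_p(\mathbb{R}^d)\|+|f|_K,$$ and for $K\in\mathbb{N}_0$ let $$\|f\mid\mathcal{E}^s_{u,p,q}(\mathbb{R}^d)\|_K:=2^{-Ks}\|\mathcal{F}^{-1}[(D_{2^{K+1}}\varphi_0)\mathcal{F}f]\mid\mathcal{M}^u_p(\mathbb{R}^d)\|+|f|_K.$$ *)

theory Defs
  imports "HOL-Analysis.Analysis"
begin

text \<open>The space \<open>\<real>\<^sup>d\<close> is rendered by an arbitrary type of class \<open>euclidean_space\<close>, \<open>d\<close> being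
  \<open>DIM('a)\<close>. Quasi-norms take values in \<open>ennreal\<close>, i.e. in \<open>[0,\<infinity>]\<close>.\<close>


section \<open>Smooth functions, Schwartz functions, tempered distributions\<close>

primrec iter_deriv :: "'a list \<Rightarrow> ('a::euclidean_space \<Rightarrow> 'b::real_normed_vector) \<Rightarrow> 'a \<Rightarrow> 'b" where
  "iter_deriv [] f = f"
| "iter_deriv (v # vs) f = (\<lambda>x. frechet_derivative (iter_deriv vs f) (at x) v)"

text \<open>A list of basis vectors plays the role of a multi-index: \<open>iter_deriv vs\<close> is the iterated
  partial derivative of order \<open>length vs\<close>.\<close>

definition smooth :: "('a::euclidean_space \<Rightarrow> 'b::real_normed_vector) \<Rightarrow> bool" where
  "smooth f \<longleftrightarrow> (\<forall>vs. set vs \<subseteq> Basis \<longrightarrow> (\<forall>x. iter_deriv vs f differentiable at x))"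

definition test_functions :: "('a::euclidean_space \<Rightarrow> 'b::real_normed_vector) set" where
  "test_functions = {f. smooth f \<and> compact (closure {x. f x \<noteq> 0})}"

definition schwartz_norm :: "nat \<Rightarrow> ('a::euclidean_space \<Rightarrow> complex) \<Rightarrow> ennreal" where
  "schwartz_norm N f =
     (SUP (vs, x) \<in> {vs. set vs \<subseteq> Basis \<and> length vs \<le> N} \<times> UNIV.
        ennreal ((1 + norm x) ^ N * norm (iter_deriv vs f x)))"

definition schwartz :: "('a::euclidean_space \<Rightarrow> complex) set" where
  "schwartz = {f. smooth f \<and> (\<forall>N. schwartz_norm N f < \<infinity>)}"

text \<open>Tempered distributions are functionals that are linear and continuous on Schwartz functions;
  since \<open>schwartz_norm N\<close> increases with \<open>N\<close>, continuity of a linear functional for the topology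
  generated by these norms is boundedness by one of them. The value of such a functional at a
  function that is not a Schwartz function is irrelevant and left unconstrained.\<close>

definition tempered_distributions :: "(('a::euclidean_space \<Rightarrow> complex) \<Rightarrow> complex) set" where
  "tempered_distributions = {T.
     (\<forall>f\<in>schwartz. \<forall>g\<in>schwartz. T (\<lambda>x. f x + g x) = T f + T g) \<and>
     (\<forall>c. \<forall>f\<in>schwartz. T (\<lambda>x. c * f x) = c * T f) \<and>
     (\<exists>C::real. \<exists>N. \<forall>f\<in>schwartz. ennreal (norm (T f)) \<le> ennreal C * schwartz_norm N f)}"


section \<open>Fourier transform\<close>

definition fourier :: "('a::euclidean_space \<Rightarrow> complex) \<Rightarrow> 'a \<Rightarrow> complex" where
  "fourier f \<xi> = complex_of_real ((2 * pi) powr (- real DIM('a) / 2)) *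
     (LINT x|lborel. exp (- \<i> * complex_of_real (x \<bullet> \<xi>)) * f x)"

definition inv_fourier :: "('a::euclidean_space \<Rightarrow> complex) \<Rightarrow> 'a \<Rightarrow> complex" where
  "inv_fourier f x = complex_of_real ((2 * pi) powr (- real DIM('a) / 2)) *
     (LINT \<xi>|lborel. exp (\<i> * complex_of_real (x \<bullet> \<xi>)) * f \<xi>)"

definition dist_fourier ::
    "(('a::euclidean_space \<Rightarrow> complex) \<Rightarrow> complex) \<Rightarrow> ('a \<Rightarrow> complex) \<Rightarrow> complex" where
  "dist_fourier T = (\<lambda>f. T (fourier f))"

definition dist_inv_fourier ::
    "(('a::euclidean_space \<Rightarrow> complex) \<Rightarrow> complex) \<Rightarrow> ('a \<Rightarrow> complex) \<Rightarrow> complex" where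
  "dist_inv_fourier T = (\<lambda>f. T (inv_fourier f))"

definition dist_mult ::
    "('a::euclidean_space \<Rightarrow> complex) \<Rightarrow> (('a \<Rightarrow> complex) \<Rightarrow> complex) \<Rightarrow> ('a \<Rightarrow> complex) \<Rightarrow> complex" where
  "dist_mult \<eta> T = (\<lambda>f. T (\<lambda>x. \<eta> x * f x))"

text \<open>The smooth function with which a regular distribution is identified. It is unique whenever it
  exists, and by the Paley-Wiener-Schwartz theorem it exists for \<open>\<F>\<^sup>-\<^sup>1[\<eta>\<F>f]\<close> with \<open>\<eta>\<close> a test
  function.\<close>

definition dist_function :: "(('a::euclidean_space \<Rightarrow> complex) \<Rightarrow> complex) \<Rightarrow> 'a \<Rightarrow> complex" where
  "dist_function T = (THE g. smooth g \<and>
     (\<forall>f\<in>schwartz. integrable lborel (\<lambda>x. g x * f x) \<and> T f = (LINT x|lborel. g x * f x)))"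

definition fourier_multiplier ::
    "('a::euclidean_space \<Rightarrow> real) \<Rightarrow> (('a \<Rightarrow> complex) \<Rightarrow> complex) \<Rightarrow> 'a \<Rightarrow> complex" where
  "fourier_multiplier \<eta> f =
     dist_function (dist_inv_fourier (dist_mult (\<lambda>x. complex_of_real (\<eta> x)) (dist_fourier f)))"


section \<open>Morrey quasi-norm\<close>

text \<open>Powers of extended non-negative numbers, used only for exponents \<open>r > 0\<close>.\<close>

definition epowr :: "ennreal \<Rightarrow> real \<Rightarrow> ennreal" where
  "epowr x r = (if x = \<infinity> then \<infinity> else ennreal (enn2real x powr r))"

text \<open>The argument is the modulus \<open>|f|\<close>, which may take the value \<open>\<infinity>\<close> when it comes from an infinite
  series. Finiteness of the supremum entails local \<open>p\<close>-integrability, so the value is \<open>\<infinity>\<close> for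
  measurable functions that are not locally \<open>p\<close>-integrable.\<close>

definition morrey_norm :: "real \<Rightarrow> real \<Rightarrow> ('a::euclidean_space \<Rightarrow> ennreal) \<Rightarrow> ennreal" where
  "morrey_norm u p g =
     (SUP (y, R) \<in> UNIV \<times> {0<..}.
        ennreal (measure lborel (ball y R) powr (1 / u - 1 / p)) *
        epowr (\<integral>\<^sup>+x\<in>ball y R. epowr (g x) p \<partial>lborel) (1 / p))"


section \<open>Triebel-Lizorkin-Morrey quasi-norms\<close>

definition lq_norm :: "ennreal \<Rightarrow> 'i set \<Rightarrow> ('i \<Rightarrow> real) \<Rightarrow> ennreal" where
  "lq_norm q I c =
     (if q = \<infinity> then (SUP k\<in>I. ennreal \<bar>c k\<bar>)
      else epowr (\<Sum>\<^sub>\<infinity>k\<in>I. ennreal (\<bar>c k\<bar> powr enn2real q)) (1 / enn2real q))"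

definition psi :: "('a::euclidean_space \<Rightarrow> real) \<Rightarrow> int \<Rightarrow> 'a \<Rightarrow> real" where
  "psi \<phi>\<^sub>0 k x = (let \<psi> = (\<lambda>y. \<phi>\<^sub>0 y - \<phi>\<^sub>0 (2 *\<^sub>R y)) in \<psi> ((2 powi (- k)) *\<^sub>R x))"

definition phi :: "('a::euclidean_space \<Rightarrow> real) \<Rightarrow> nat \<Rightarrow> 'a \<Rightarrow> real" where
  "phi \<phi>\<^sub>0 k = (if k = 0 then \<phi>\<^sub>0 else psi \<phi>\<^sub>0 (int k))"

definition dilate :: "real \<Rightarrow> ('a::euclidean_space \<Rightarrow> 'b) \<Rightarrow> 'a \<Rightarrow> 'b" where
  "dilate r g = (\<lambda>x. g (r *\<^sub>R x))"

definition TLM_norm ::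
    "('a::euclidean_space \<Rightarrow> real) \<Rightarrow> real \<Rightarrow> real \<Rightarrow> real \<Rightarrow> ennreal \<Rightarrow> (('a \<Rightarrow> complex) \<Rightarrow> complex) \<Rightarrow> ennreal"
  where
  "TLM_norm \<phi>\<^sub>0 s u p q f = morrey_norm u p (\<lambda>x.
     lq_norm q UNIV (\<lambda>k::nat. 2 powr (real k * s) * norm (fourier_multiplier (phi \<phi>\<^sub>0 k) f x)))"

text \<open>The expression \<open>|f|\<^sub>K\<close> for \<open>K \<in> \<int> \<union> {\<infinity>}\<close>; for \<open>K = \<infinity>\<close> the index \<open>k\<close> runs through all
  integers.\<close>

definition TLM_seminorm ::
    "('a::euclidean_space \<Rightarrow> real) \<Rightarrow> real \<Rightarrow> real \<Rightarrow> real \<Rightarrow> ennreal \<Rightarrow> ereal \<Rightarrow> (('a \<Rightarrow> complex) \<Rightarrow> complex) \<Rightarrow> ennreal"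
  where
  "TLM_seminorm \<phi>\<^sub>0 s u p q K f = morrey_norm u p (\<lambda>x.
     lq_norm q {k::int. - K \<le> ereal (real_of_int k)}
       (\<lambda>k. 2 powr (real_of_int k * s) * norm (fourier_multiplier (psi \<phi>\<^sub>0 k) f x)))"

definition TLM_norm_club ::
    "('a::euclidean_space \<Rightarrow> real) \<Rightarrow> real \<Rightarrow> real \<Rightarrow> real \<Rightarrow> ennreal \<Rightarrow> enat \<Rightarrow> (('a \<Rightarrow> complex) \<Rightarrow> complex) \<Rightarrow> ennreal"
  where
  "TLM_norm_club \<phi>\<^sub>0 s u p q K f =
     morrey_norm u p (\<lambda>x. ennreal (norm (fourier_multiplier \<phi>\<^sub>0 f x))) +
     TLM_seminorm \<phi>\<^sub>0 s u p q (ereal_of_enat K) f"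

definition TLM_norm_K ::
    "('a::euclidean_space \<Rightarrow> real) \<Rightarrow> real \<Rightarrow> real \<Rightarrow> real \<Rightarrow> ennreal \<Rightarrow> nat \<Rightarrow> (('a \<Rightarrow> complex) \<Rightarrow> complex) \<Rightarrow> ennreal"
  where
  "TLM_norm_K \<phi>\<^sub>0 s u p q K f =
     ennreal (2 powr (- real K * s)) *
       morrey_norm u p (\<lambda>x. ennreal (norm (fourier_multiplier (dilate (2 ^ (K + 1)) \<phi>\<^sub>0) f x))) +
     TLM_seminorm \<phi>\<^sub>0 s u p q (ereal (real K)) f"

definition sigma_p :: "nat \<Rightarrow> real \<Rightarrow> real" where
  "sigma_p d p = real d * max 0 (1 / p - 1)"

definition equivalent_on :: "'f set \<Rightarrow> ('f \<Rightarrow> ennreal) \<Rightarrow> ('f \<Rightarrow> ennreal) \<Rightarrow> bool" where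
  "equivalent_on S A B \<longleftrightarrow>
     (\<exists>C::real. C > 0 \<and> (\<forall>f\<in>S. A f \<le> ennreal C * B f \<and> B f \<le> ennreal C * A f))"

end

theory Submission
  imports Defs "HOL-Probability.Characteristic_Functions"
begin

text \<open>Up to a constant, \<open>\<F>\<^sup>-\<^sup>1[\<eta>\<F>f]\<close> is the function \<open>x \<mapsto> f(\<kappa>(x - \<cdot>))\<close> with \<open>\<kappa> = \<F>\<^sup>-\<^sup>1\<eta>\<close>. Let \<open>S\<^sub>j f\<close> belong to
  the multiplier \<open>\<phi>\<^sub>0(2\<^sup>-\<^sup>j\<cdot>)\<close>; then \<open>\<psi>\<^sub>k\<close> yields \<open>S\<^sub>k f - S\<^sub>k\<^sub>-\<^sub>1 f\<close>, and for \<open>j < 0\<close> the function \<open>S\<^sub>j f\<close> is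
  the convolution of \<open>S\<^sub>0 f\<close> with a dilated Schwartz kernel. For \<open>p \<le> 1\<close> a band-limited \<open>g\<close> of polynomial
  growth satisfies \<open>|g(x)|\<^sup>p \<le> C \<integral> |g(z)|\<^sup>p (1 + |x - z|)\<^sup>-\<^sup>p\<^sup>m dz\<close>. As Morrey quasi-norms are translation
  invariant, this gives \<open>\<parallel>S\<^sub>j f\<parallel> \<le> C 2\<^sup>-\<^sup>j\<^sup>\<sigma> \<parallel>S\<^sub>0 f\<parallel>\<close> for \<open>j \<le> 0\<close> and \<open>\<sigma> = \<sigma>\<^sub>p\<close>, without any maximal
  inequality. Hence the low-frequency terms of every expression are controlled by \<open>\<parallel>S\<^sub>0 f\<parallel>\<close>: trivially if
  there are finitely many of them, and by a geometric series if \<open>s > \<sigma>\<^sub>p\<close>.\<close>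

section \<open>Smooth functions\<close>

text \<open>The kernel of S_j is a dilate with constant \<open>L\<^sub>1\<close> norm, which costs
  nothing if p \<ge> 1. If p < 1, the integral of the p-th power of its modulus is of order 2^(-j d
  (1 - p)), and the p-th root of this is 2^(-j \<sigma>). The condition s > \<sigma> lets the
  weights 2^(k s) beat this loss as k tends to minus infinity. If p < 1, a p-th power mean controls
  S_0 f pointwise only because S_0 f is band-limited. The estimates hold for every tempered
  distribution with infinite values allowed, so nothing may be assumed finite. Polynomial growth
  supplies the finiteness needed, but its degree depends on f while the constants must not;
  \<open>subharmonic\<close> removes this dependence. Distributions are bare functionals,
  unconstrained off the Schwartz space, and \<open>fourier_multiplier\<close> rests on a definite
  description. This is why the proof needs that T commutes with integrals of translates, that
  Fourier inversion holds for test functions, and that Schwartz functions separate continuous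
  functions.\<close>

abbreviation pd :: "'a::euclidean_space \<Rightarrow> ('a \<Rightarrow> 'b::real_normed_vector) \<Rightarrow> 'a \<Rightarrow> 'b" where
  "pd v f \<equiv> (\<lambda>x. frechet_derivative f (at x) v)"

lemma iter_deriv_append: "iter_deriv (vs @ ws) f = iter_deriv vs (iter_deriv ws f)"
  by (induction vs) auto

lemma iter_deriv_snoc: "iter_deriv (vs @ [v]) f = iter_deriv vs (pd v f)"
  by (simp add: iter_deriv_append)

lemma iter_deriv_closed:
  assumes "f \<in> S" and "\<And>f v. f \<in> S \<Longrightarrow> v \<in> Basis \<Longrightarrow> pd v f \<in> S"
  shows "set vs \<subseteq> Basis \<Longrightarrow> iter_deriv vs f \<in> S"
  using assms by (induction vs) auto

text \<open>An invariant replaces the computation of higher derivatives: it is enough to name a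
  class of differentiable functions that the partial derivatives map into itself.\<close>

lemma smooth_coinduct:
  assumes "f \<in> S" and "\<And>f x. f \<in> S \<Longrightarrow> f differentiable at x"
    and "\<And>f v. f \<in> S \<Longrightarrow> v \<in> Basis \<Longrightarrow> pd v f \<in> S"
  shows "smooth f"
  unfolding smooth_def using iter_deriv_closed[OF assms(1,3)] assms(2) by blast

lemma smooth_differentiable: "smooth f \<Longrightarrow> f differentiable at x"
  unfolding smooth_def by (metis empty_subsetI iter_deriv.simps(1) list.set(1))

lemma smooth_has_derivative: "smooth f \<Longrightarrow> (f has_derivative frechet_derivative f (at x)) (at x)"
  using smooth_differentiable frechet_derivative_works by blast

lemma smooth_iter_deriv: "smooth f \<Longrightarrow> set ws \<subseteq> Basis \<Longrightarrow> smooth (iter_deriv ws f)"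
  unfolding smooth_def by (metis iter_deriv_append le_sup_iff set_append)

lemma smooth_pd: "smooth f \<Longrightarrow> v \<in> Basis \<Longrightarrow> smooth (pd v f)"
  using smooth_iter_deriv[of f "[v]"] by simp

lemma smooth_continuous_on: "smooth f \<Longrightarrow> continuous_on A f"
  by (simp add: continuous_at_imp_continuous_on differentiable_imp_continuous_within smooth_differentiable)

lemma smooth_borel_measurable: 
  fixes f :: "'a::euclidean_space \<Rightarrow> 'b::{real_normed_vector, second_countable_topology}"
  shows "smooth f \<Longrightarrow> f \<in> borel_measurable borel"
  by (simp add: borel_measurable_continuous_onI smooth_continuous_on)

lemma pd_eqI:
  assumes "\<And>x. (f has_derivative f' x) (at x)"
  shows "pd v f = (\<lambda>x. f' x v)"
  using frechet_derivative_at[OF assms] by (intro ext) metis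

lemma pd_sum_basis:
  assumes "f differentiable at x"
  shows "frechet_derivative f (at x) h = (\<Sum>b\<in>Basis. (h \<bullet> b) *\<^sub>R frechet_derivative f (at x) b)"
proof -
  have l: "linear (frechet_derivative f (at x))"
    using assms linear_frechet_derivative by blast
  have "frechet_derivative f (at x) (\<Sum>b\<in>Basis. (h \<bullet> b) *\<^sub>R b) = (\<Sum>b\<in>Basis. (h \<bullet> b) *\<^sub>R frechet_derivative f (at x) b)"
    using l by (simp add: linear_sum linear_scale)
  then show ?thesis by (simp add: euclidean_representation)
qed

section \<open>Linear combinations and products with coordinates\<close>

lemma has_derivative_add_scaled:
  fixes f g :: "'a::euclidean_space \<Rightarrow> complex"
  assumes "(f has_derivative f') (at x)" "(g has_derivative g') (at x)"
  shows "((\<lambda>x. f x + c * g x) has_derivative (\<lambda>h. f' h + c * g' h)) (at x)"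
  using assms by (auto intro!: derivative_eq_intros)

lemma pd_add_scaled:
  fixes f g :: "'a::euclidean_space \<Rightarrow> complex"
  assumes "smooth f" "smooth g"
  shows "pd v (\<lambda>x. f x + c * g x) = (\<lambda>x. pd v f x + c * pd v g x)"
  by (rule pd_eqI, rule has_derivative_add_scaled) (simp_all add: assms smooth_has_derivative)

lemma smooth_add_scaled:
  fixes f g :: "'a::euclidean_space \<Rightarrow> complex"
  assumes "smooth f" "smooth g"
  shows "smooth (\<lambda>x. f x + c * g x)"
proof (rule smooth_coinduct[where S = "{\<lambda>x. f x + c * g x | f g. smooth f \<and> smooth g}"])
  show "(\<lambda>x. f x + c * g x) \<in> {\<lambda>x. f x + c * g x |f g. smooth f \<and> smooth g}"
    using assms by blast
next
  fix h :: "'a \<Rightarrow> complex" and x assume "h \<in> {\<lambda>x. f x + c * g x |f g. smooth f \<and> smooth g}"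
  then show "h differentiable at x"
    using has_derivative_add_scaled smooth_has_derivative unfolding differentiable_def by blast
next
  fix h :: "'a \<Rightarrow> complex" and v :: 'a assume "h \<in> {\<lambda>x. f x + c * g x |f g. smooth f \<and> smooth g}" and v: "v \<in> Basis"
  then obtain f g where fg: "smooth f" "smooth g" and h: "h = (\<lambda>x. f x + c * g x)" by auto
  show "pd v h \<in> {\<lambda>x. f x + c * g x |f g. smooth f \<and> smooth g}"
    unfolding h pd_add_scaled[OF fg] 
    by (rule CollectI, rule exI[of _ "pd v f"], rule exI[of _ "pd v g"]) (simp add: smooth_pd fg v)
qed

lemma iter_deriv_add_scaled:
  fixes f g :: "'a::euclidean_space \<Rightarrow> complex"
  assumes "smooth f" "smooth g" "set vs \<subseteq> Basis"
  shows "iter_deriv vs (\<lambda>x. f x + c * g x) = (\<lambda>x. iter_deriv vs f x + c * iter_deriv vs g x)"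
  using assms(3)
proof (induction vs)
  case (Cons v vs)
  have "smooth (iter_deriv vs f)" "smooth (iter_deriv vs g)"
    using Cons assms smooth_iter_deriv by auto
  then show ?case using Cons by (simp add: pd_add_scaled)
qed auto

lemma smooth_zero: "smooth (\<lambda>x::'a::euclidean_space. 0 :: 'b::real_normed_vector)"
  by (rule smooth_coinduct[where S = "{\<lambda>x. 0}"]) auto

lemma smooth_cmult:
  fixes g :: "'a::euclidean_space \<Rightarrow> complex"
  shows "smooth g \<Longrightarrow> smooth (\<lambda>x. c * g x)"
  using smooth_add_scaled[OF smooth_zero, of g c] by simp

lemma iter_deriv_zero: "iter_deriv vs (\<lambda>x::'a::euclidean_space. 0 :: 'b::real_normed_vector) = (\<lambda>x. 0)"
  by (induction vs) auto

lemma has_derivative_coord_mult: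
  fixes f g :: "'a::euclidean_space \<Rightarrow> complex"
  assumes "(f has_derivative f') (at x)" "(g has_derivative g') (at x)"
  shows "((\<lambda>x. f x + of_real (x \<bullet> w) * g x) has_derivative
           (\<lambda>h. (f' h + of_real (h \<bullet> w) * g x) + of_real (x \<bullet> w) * g' h)) (at x)"
  using assms by (auto intro!: derivative_eq_intros simp: algebra_simps)

lemma smooth_coord_mult:
  fixes g :: "'a::euclidean_space \<Rightarrow> complex"
  assumes "smooth g"
  shows "smooth (\<lambda>x. of_real (x \<bullet> w) * g x)"
\<comment> \<open>The extra summand \<open>f\<close> absorbs the term
  \<open>of_real (v \<bullet> w) * g x\<close> of the product rule; without it the class would not
  be closed under \<open>pd\<close>.\<close>
proof (rule smooth_coinduct[where S = "{\<lambda>x. f x + of_real (x \<bullet> w) * g x | f g. smooth f \<and> smooth g}"])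
  show "(\<lambda>x. of_real (x \<bullet> w) * g x) \<in> {\<lambda>x. f x + of_real (x \<bullet> w) * g x | f g. smooth f \<and> smooth g}"
    using assms smooth_zero by force
next
  fix h :: "'a \<Rightarrow> complex" and x assume "h \<in> {\<lambda>x. f x + of_real (x \<bullet> w) * g x | f g. smooth f \<and> smooth g}"
  then show "h differentiable at x"
    using has_derivative_coord_mult smooth_has_derivative unfolding differentiable_def by blast
next
  fix h :: "'a \<Rightarrow> complex" and v :: 'a
  assume "h \<in> {\<lambda>x. f x + of_real (x \<bullet> w) * g x | f g. smooth f \<and> smooth g}" and v: "v \<in> Basis"
  then obtain f g where fg: "smooth f" "smooth g" and h: "h = (\<lambda>x. f x + of_real (x \<bullet> w) * g x)" by auto
  have "pd v h = (\<lambda>x. (pd v f x + of_real (v \<bullet> w) * g x) + of_real (x \<bullet> w) * pd v g x)"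
    unfolding h by (rule pd_eqI, rule has_derivative_coord_mult) (simp_all add: fg smooth_has_derivative)
  moreover have "smooth (\<lambda>x. pd v f x + of_real (v \<bullet> w) * g x)"
    by (rule smooth_add_scaled[OF smooth_pd[OF fg(1) v] fg(2)])
  ultimately show "pd v h \<in> {\<lambda>x. f x + of_real (x \<bullet> w) * g x | f g. smooth f \<and> smooth g}"
    using smooth_pd[OF fg(2) v]
    by (intro CollectI exI[of _ "\<lambda>x. pd v f x + of_real (v \<bullet> w) * g x"] exI[of _ "pd v g"] conjI)
qed

section \<open>Affine substitutions and real-valued functions\<close>

lemma iter_deriv_affine:
  fixes f :: "'a::euclidean_space \<Rightarrow> 'b::real_normed_vector"
  assumes "smooth f" "set vs \<subseteq> Basis"
  shows "iter_deriv vs (\<lambda>x. f (r *\<^sub>R x + t)) = (\<lambda>x. r ^ length vs *\<^sub>R iter_deriv vs f (r *\<^sub>R x + t))"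
  using assms(2)
proof (induction vs)
  case (Cons v vs)
  have s: "smooth (iter_deriv vs f)" using Cons assms smooth_iter_deriv by auto
  have d: "((\<lambda>x. r ^ length vs *\<^sub>R iter_deriv vs f (r *\<^sub>R x + t)) has_derivative
      (\<lambda>h. r ^ length vs *\<^sub>R frechet_derivative (iter_deriv vs f) (at (r *\<^sub>R x + t)) (r *\<^sub>R h))) (at x)" for x
  proof (rule has_derivative_scaleR_right, rule has_derivative_compose[where f = "\<lambda>x. r *\<^sub>R x + t"])
    show "((\<lambda>x. r *\<^sub>R x + t) has_derivative (*\<^sub>R) r) (at x)" by (auto intro!: derivative_eq_intros)
    show "(iter_deriv vs f has_derivative frechet_derivative (iter_deriv vs f) (at (r *\<^sub>R x + t))) (at (r *\<^sub>R x + t))"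
      using s smooth_has_derivative by blast
  qed
  have "iter_deriv (v # vs) (\<lambda>x. f (r *\<^sub>R x + t)) = pd v (\<lambda>x. r ^ length vs *\<^sub>R iter_deriv vs f (r *\<^sub>R x + t))"
    using Cons by simp
  also have "\<dots> = (\<lambda>x. r ^ length vs *\<^sub>R frechet_derivative (iter_deriv vs f) (at (r *\<^sub>R x + t)) (r *\<^sub>R v))"
    by (rule pd_eqI) (rule d)
  also have "\<dots> = (\<lambda>x. r ^ length (v # vs) *\<^sub>R iter_deriv (v # vs) f (r *\<^sub>R x + t))"
    using linear_frechet_derivative[OF smooth_differentiable[OF s]]
    by (simp add: linear_scale mult.commute)
  finally show ?case .
qed auto

lemma differentiable_affine:
  fixes f :: "'a::euclidean_space \<Rightarrow> 'b::real_normed_vector"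
  assumes "\<And>x. f differentiable at x"
  shows "(\<lambda>x. c *\<^sub>R f (r *\<^sub>R x + t)) differentiable at x"
proof -
  have "((\<lambda>x. c *\<^sub>R f (r *\<^sub>R x + t)) has_derivative
      (\<lambda>h. c *\<^sub>R frechet_derivative f (at (r *\<^sub>R x + t)) (r *\<^sub>R h))) (at x)"
  proof (rule has_derivative_scaleR_right, rule has_derivative_compose[where f = "\<lambda>x. r *\<^sub>R x + t"])
    show "((\<lambda>x. r *\<^sub>R x + t) has_derivative (*\<^sub>R) r) (at x)" by (auto intro!: derivative_eq_intros)
    show "(f has_derivative frechet_derivative f (at (r *\<^sub>R x + t))) (at (r *\<^sub>R x + t))"
      using assms frechet_derivative_works by blast
  qed
  then show ?thesis unfolding differentiable_def by blast
qed

lemma smooth_affine: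
  fixes f :: "'a::euclidean_space \<Rightarrow> 'b::real_normed_vector"
  assumes "smooth f"
  shows "smooth (\<lambda>x. f (r *\<^sub>R x + t))"
proof -
  have "(\<lambda>x. r ^ length vs *\<^sub>R iter_deriv vs f (r *\<^sub>R x + t)) differentiable at x" if "set vs \<subseteq> Basis" for vs x
    using smooth_differentiable[OF smooth_iter_deriv[OF assms that]] by (rule differentiable_affine)
  then show ?thesis unfolding smooth_def using assms by (simp add: iter_deriv_affine)
qed

lemma iter_deriv_of_real:
  fixes f :: "'a::euclidean_space \<Rightarrow> real"
  assumes "smooth f" "set vs \<subseteq> Basis"
  shows "iter_deriv vs (\<lambda>x. complex_of_real (f x)) = (\<lambda>x. complex_of_real (iter_deriv vs f x))"
  using assms(2)
proof (induction vs)
  case (Cons v vs)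
  have "smooth (iter_deriv vs f)" using Cons assms smooth_iter_deriv by auto
  then have "pd v (\<lambda>x. complex_of_real (iter_deriv vs f x)) = (\<lambda>x. complex_of_real (frechet_derivative (iter_deriv vs f) (at x) v))"
    by (intro pd_eqI has_derivative_of_real smooth_has_derivative)
  then show ?case using Cons by simp
qed auto

lemma smooth_of_real:
  fixes f :: "'a::euclidean_space \<Rightarrow> real"
  assumes "smooth f" shows "smooth (\<lambda>x. complex_of_real (f x))"
proof -
  have "(\<lambda>x. complex_of_real (iter_deriv vs f x)) differentiable at x" if "set vs \<subseteq> Basis" for vs x
    using smooth_has_derivative[OF smooth_iter_deriv[OF assms that]] has_derivative_of_real
    unfolding differentiable_def by blast
  then show ?thesis unfolding smooth_def by (simp add: iter_deriv_of_real[OF assms])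
qed

section \<open>Schwartz functions\<close>

text \<open>\<open>schwartz_norm\<close> takes its supremum over lists and points together. For
  given \<open>N\<close> only finitely many lists occur, so bounds that depend on the list
  suffice.\<close>

lemma schwartzI:
  assumes "smooth f"
    and "\<And>vs N. set vs \<subseteq> Basis \<Longrightarrow> \<exists>B. \<forall>x. (1 + norm x) ^ N * norm (iter_deriv vs f x) \<le> B"
  shows "f \<in> schwartz"
proof -
  have "schwartz_norm N f < \<infinity>" for N
  proof -
    let ?V = "{vs::'a list. set vs \<subseteq> Basis \<and> length vs \<le> N}"
    have fin: "finite ?V" by (simp add: finite_lists_length_le)
    have "\<forall>vs\<in>?V. \<exists>B. \<forall>x. (1 + norm x) ^ N * norm (iter_deriv vs f x) \<le> B"
      using assms by auto
    then obtain B where B: "\<And>vs x. vs \<in> ?V \<Longrightarrow> (1 + norm x) ^ N * norm (iter_deriv vs f x) \<le> B vs"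
      by metis
    have "schwartz_norm N f \<le> ennreal (\<Sum>vs\<in>?V. \<bar>B vs\<bar>)"
      unfolding schwartz_norm_def
    proof (rule SUP_least, clarify, rule ennreal_leI)
      fix vs :: "'a list" and x :: 'a assume vs: "set vs \<subseteq> Basis" "length vs \<le> N"
      have "(1 + norm x) ^ N * norm (iter_deriv vs f x) \<le> \<bar>B vs\<bar>" using B[of vs x] vs by force
      also have "\<dots> \<le> (\<Sum>vs\<in>?V. \<bar>B vs\<bar>)" using fin vs by (intro member_le_sum) auto
      finally show "(1 + norm x) ^ N * norm (iter_deriv vs f x) \<le> (\<Sum>vs\<in>?V. \<bar>B vs\<bar>)" .
    qed
    also have "\<dots> < \<infinity>" by simp
    finally show ?thesis .
  qed
  then show ?thesis using assms by (simp add: schwartz_def)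
qed

lemma schwartz_smooth: "f \<in> schwartz \<Longrightarrow> smooth f"
  by (simp add: schwartz_def)

lemma schwartz_boundE:
  fixes f :: "'a::euclidean_space \<Rightarrow> complex"
  assumes "f \<in> schwartz"
  obtains B where "B \<ge> 0" and "\<And>vs x. set vs \<subseteq> Basis \<Longrightarrow> length vs \<le> N \<Longrightarrow> (1 + norm x) ^ N * norm (iter_deriv vs f x) \<le> B"
proof
  have fin: "schwartz_norm N f < \<infinity>" using assms by (simp add: schwartz_def)
  show "(1 + norm x) ^ N * norm (iter_deriv vs f x) \<le> enn2real (schwartz_norm N f)"
    if "set vs \<subseteq> Basis" "length vs \<le> N" for vs x
  proof -
    have "ennreal ((1 + norm x) ^ N * norm (iter_deriv vs f x)) \<le> schwartz_norm N f"
      unfolding schwartz_norm_def by (rule SUP_upper2[where i = "(vs, x)"]) (use that in auto)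
    from enn2real_mono[OF this] fin show ?thesis by simp
  qed
qed simp

lemma schwartz_bound:
  fixes f :: "'a::euclidean_space \<Rightarrow> complex"
  assumes "f \<in> schwartz" "set vs \<subseteq> Basis"
  shows "\<exists>B\<ge>0. \<forall>x. (1 + norm x) ^ N * norm (iter_deriv vs f x) \<le> B"
proof -
  \<comment> \<open>\<open>schwartz_norm\<close> uses one number both for the weight and for the
    order of differentiation; the maximum decouples the two.\<close>
  obtain B where "B \<ge> 0" and B: "\<And>ws x. set ws \<subseteq> Basis \<Longrightarrow> length ws \<le> max N (length vs) \<Longrightarrow>
      (1 + norm x) ^ max N (length vs) * norm (iter_deriv ws f x) \<le> B"
    using schwartz_boundE[OF assms(1), of "max N (length vs)"] by metis
  have "(1 + norm x) ^ N * norm (iter_deriv vs f x) \<le> B" for x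
  proof -
    have "(1 + norm x) ^ N * norm (iter_deriv vs f x) \<le> (1 + norm x) ^ max N (length vs) * norm (iter_deriv vs f x)"
      by (intro mult_right_mono power_increasing) auto
    then show ?thesis using B[of vs x] assms(2) by linarith
  qed
  then show ?thesis using \<open>B \<ge> 0\<close> by blast
qed

lemma schwartz_add_scaled:
  assumes "f \<in> schwartz" "g \<in> schwartz"
  shows "(\<lambda>x. f x + c * g x) \<in> schwartz"
proof (rule schwartzI)
  show "smooth (\<lambda>x. f x + c * g x)" by (simp add: assms schwartz_smooth smooth_add_scaled)
next
  fix vs N assume vs: "set vs \<subseteq> (Basis::'a set)"
  obtain B where B: "\<And>x. (1 + norm x) ^ N * norm (iter_deriv vs f x) \<le> B"
    using schwartz_bound[OF assms(1) vs] by meson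
  obtain B' where B': "\<And>x. (1 + norm x) ^ N * norm (iter_deriv vs g x) \<le> B'"
    using schwartz_bound[OF assms(2) vs] by meson
  have "(1 + norm x) ^ N * norm (iter_deriv vs (\<lambda>x. f x + c * g x) x) \<le> B + norm c * B'" for x
  proof -
    have "norm (iter_deriv vs f x + c * iter_deriv vs g x) \<le> norm (iter_deriv vs f x) + norm c * norm (iter_deriv vs g x)"
      by (metis norm_mult norm_triangle_ineq)
    then have "(1 + norm x) ^ N * norm (iter_deriv vs f x + c * iter_deriv vs g x) \<le>
       (1 + norm x) ^ N * (norm (iter_deriv vs f x) + norm c * norm (iter_deriv vs g x))"
      by (intro mult_left_mono) auto
    also have "\<dots> = (1 + norm x) ^ N * norm (iter_deriv vs f x) + norm c * ((1 + norm x) ^ N * norm (iter_deriv vs g x))"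
      by (simp add: algebra_simps)
    also have "\<dots> \<le> B + norm c * B'"
      using B B' by (intro add_mono mult_left_mono) auto
    finally show ?thesis using assms vs by (simp add: iter_deriv_add_scaled schwartz_smooth)
  qed
  then show "\<exists>B. \<forall>x. (1 + norm x) ^ N * norm (iter_deriv vs (\<lambda>x. f x + c * g x) x) \<le> B" by blast
qed

lemma schwartz_zero: "(\<lambda>x. 0) \<in> schwartz"
  by (rule schwartzI) (auto simp: smooth_zero iter_deriv_zero)

lemma schwartz_cmult: "f \<in> schwartz \<Longrightarrow> (\<lambda>x. c * f x) \<in> schwartz"
  using schwartz_add_scaled[OF schwartz_zero, of f c] by simp

lemma schwartz_pd:
  assumes "f \<in> schwartz" "v \<in> Basis" shows "pd v f \<in> schwartz"
proof (rule schwartzI)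
  show "smooth (pd v f)" by (simp add: assms smooth_pd schwartz_smooth)
next
  fix vs :: "'a list" and N assume "set vs \<subseteq> Basis"
  then show "\<exists>B. \<forall>x. (1 + norm x) ^ N * norm (iter_deriv vs (pd v f) x) \<le> B"
    using schwartz_bound[OF assms(1), of "vs @ [v]" N] assms(2) by (auto simp: iter_deriv_snoc)
qed

text \<open>Peetre's inequality: the weight is submultiplicative. It moves weights from one variable
  of a convolution to the other.\<close>

lemma one_plus_norm_diff_le: "1 + norm (x - y) \<le> (1 + norm x) * (1 + norm y)" for x :: "'a::real_normed_vector"
proof -
  have "0 \<le> norm x * norm y" by simp
  then show ?thesis using norm_triangle_ineq4[of x y] unfolding distrib_left distrib_right by linarith
qed

lemma one_plus_norm_le: "1 + norm x \<le> (1 + norm (x - y)) * (1 + norm y)" for x :: "'a::real_normed_vector"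
  using one_plus_norm_diff_le[of "x - y" "- y"] by simp

lemma schwartz_affine:
  assumes "f \<in> schwartz" "r \<noteq> 0" shows "(\<lambda>x. f (r *\<^sub>R x + t)) \<in> schwartz"
proof (rule schwartzI)
  show "smooth (\<lambda>x. f (r *\<^sub>R x + t))" by (simp add: assms schwartz_smooth smooth_affine)
next
  fix vs N assume vs: "set vs \<subseteq> (Basis::'a set)"
  obtain B where "B \<ge> 0" and B: "\<And>x. (1 + norm x) ^ N * norm (iter_deriv vs f x) \<le> B"
    using schwartz_bound[OF assms(1) vs] by meson
  \<comment> \<open>The first factor of \<open>D\<close> undoes the dilation, the second the
    translation.\<close>
  define D where "D = (1 + 1 / \<bar>r\<bar>) * (1 + norm t)"
  have D: "1 + norm x \<le> D * (1 + norm (r *\<^sub>R x + t))" for x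
  proof -
    have "norm (r *\<^sub>R x) + 1 \<le> (1 + norm (r *\<^sub>R x + t)) * (1 + norm t)"
      using one_plus_norm_diff_le[of "r *\<^sub>R x + t" t] by simp
    then have "(1 + 1 / \<bar>r\<bar>) * (norm (r *\<^sub>R x) + 1) \<le> (1 + 1 / \<bar>r\<bar>) * ((1 + norm (r *\<^sub>R x + t)) * (1 + norm t))"
      by (intro mult_left_mono) auto
    moreover have "1 + norm x \<le> (1 + 1 / \<bar>r\<bar>) * (norm (r *\<^sub>R x) + 1)"
      using assms(2) by (simp add: field_simps)
    ultimately show ?thesis by (simp add: D_def mult_ac)
  qed
  have D0: "D \<ge> 0" by (simp add: D_def)
  have "(1 + norm x) ^ N * norm (iter_deriv vs (\<lambda>x. f (r *\<^sub>R x + t)) x) \<le> D ^ N * (\<bar>r\<bar> ^ length vs * B)" for x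
  proof -
    have "(1 + norm x) ^ N * norm (iter_deriv vs f (r *\<^sub>R x + t)) \<le> (D * (1 + norm (r *\<^sub>R x + t))) ^ N * norm (iter_deriv vs f (r *\<^sub>R x + t))"
      using D by (intro mult_right_mono power_mono) auto
    also have "\<dots> \<le> D ^ N * B"
      using mult_left_mono[OF B[of "r *\<^sub>R x + t"], of "D ^ N"] D0 by (simp add: power_mult_distrib mult.assoc)
    finally have "\<bar>r\<bar> ^ length vs * ((1 + norm x) ^ N * norm (iter_deriv vs f (r *\<^sub>R x + t))) \<le> \<bar>r\<bar> ^ length vs * (D ^ N * B)"
      by (intro mult_left_mono) auto
    then show ?thesis using assms vs
      by (simp add: iter_deriv_affine schwartz_smooth power_abs mult_ac)
  qed
  then show "\<exists>B. \<forall>x. (1 + norm x) ^ N * norm (iter_deriv vs (\<lambda>x. f (r *\<^sub>R x + t)) x) \<le> B" by blast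
qed

lemma schwartz_reflect: "f \<in> schwartz \<Longrightarrow> (\<lambda>y. f (x - y)) \<in> schwartz"
  using schwartz_affine[of f "-1" x] by simp

lemma iter_deriv_reflect:
  fixes f :: "'a::euclidean_space \<Rightarrow> 'b::real_normed_vector"
  shows "smooth f \<Longrightarrow> set vs \<subseteq> Basis \<Longrightarrow> iter_deriv vs (\<lambda>y. f (x - y)) = (\<lambda>y. (-1) ^ length vs *\<^sub>R iter_deriv vs f (x - y))"
  using iter_deriv_affine[of f vs "-1" x] by simp

section \<open>Tempered distributions\<close>

lemma tempered_add_scaled:
  assumes "T \<in> tempered_distributions" "f \<in> schwartz" "g \<in> schwartz"
  shows "T (\<lambda>x. f x + c * g x) = T f + c * T g"
  using assms schwartz_cmult[of g c] unfolding tempered_distributions_def by auto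

lemma tempered_cmult:
  assumes "T \<in> tempered_distributions" "f \<in> schwartz"
  shows "T (\<lambda>x. c * f x) = c * T f"
  using assms unfolding tempered_distributions_def by auto

lemma tempered_boundE:
  fixes T :: "('a::euclidean_space \<Rightarrow> complex) \<Rightarrow> complex"
  assumes "T \<in> tempered_distributions"
  obtains C N where "C \<ge> 0" and "\<And>f B. f \<in> schwartz \<Longrightarrow>
      (\<And>vs x. set vs \<subseteq> Basis \<Longrightarrow> length vs \<le> N \<Longrightarrow> (1 + norm x) ^ N * norm (iter_deriv vs f x) \<le> B) \<Longrightarrow>
      norm (T f) \<le> C * B"
proof -
  obtain C N where CN: "\<And>f. f \<in> schwartz \<Longrightarrow> ennreal (norm (T f)) \<le> ennreal C * schwartz_norm N f"
    using assms unfolding tempered_distributions_def by blast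
  \<comment> \<open>\<open>ennreal\<close> sends a negative \<open>C\<close> to 0, hence
    \<open>max 0 C\<close>; the empty list at the origin shows that \<open>B\<close> is
    non-negative.\<close>
  have "norm (T f) \<le> max 0 C * B" if f: "f \<in> schwartz" and
    B: "\<And>vs x. set vs \<subseteq> Basis \<Longrightarrow> length vs \<le> N \<Longrightarrow> (1 + norm x) ^ N * norm (iter_deriv vs f x) \<le> B" for f B
  proof -
    have "0 \<le> (1 + norm (0::'a)) ^ N * norm (iter_deriv [] f 0)" by simp
    also have "\<dots> \<le> B" using B[of "[]" 0] by simp
    finally have B0: "B \<ge> 0" .
    have "schwartz_norm N f \<le> ennreal B"
      unfolding schwartz_norm_def by (rule SUP_least) (auto intro!: ennreal_leI B)
    then have "ennreal (norm (T f)) \<le> ennreal C * ennreal B"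
      using CN[OF f] by (meson dual_order.trans mult_left_mono zero_le)
    also have "\<dots> \<le> ennreal (max 0 C * B)"
      using B0 by (simp add: ennreal_mult' ennreal_leI mult_right_mono max_def)
    finally show ?thesis using B0 by (simp add: ennreal_le_iff)
  qed
  then show ?thesis using that[of "max 0 C" N] by simp
qed

section \<open>Integrals depending on a parameter\<close>

text \<open>Where the norm lies between n and n + 1 the integrand is at most (n + 1)^(-d-2), and the
  ball of radius n + 1 has volume of order (n + 1)^d. The n-th term is thus of order (n +
  1)^(-2).\<close>

lemma integrable_inverse_power:
  "integrable lborel (\<lambda>x::'a::euclidean_space. 1 / (1 + norm x) ^ (DIM('a) + 2))"
proof (rule integrableI_bounded)
  let ?N = "DIM('a) + 2"
  let ?c = "unit_ball_vol (real DIM('a))"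
  let ?f = "\<lambda>n::nat. \<lambda>x::'a. ennreal (1 / (real n + 1) ^ ?N) * indicator (ball 0 (real n + 1)) x"
  have le: "ennreal (norm (1 / (1 + norm x) ^ ?N)) \<le> (\<Sum>n. ?f n x)" for x :: 'a
  proof -
    define n where "n = nat \<lfloor>norm x\<rfloor>"
    have n: "real n \<le> norm x" "norm x < real n + 1" by (simp_all add: n_def)
    have "ennreal (norm (1 / (1 + norm x) ^ ?N)) \<le> ?f n x"
      using n power_mono[of "real n + 1" "1 + norm x" ?N]
      by (auto simp del: power_Suc power_add intro!: ennreal_leI divide_left_mono)
    also have "\<dots> \<le> (\<Sum>n. ?f n x)" by (metis (no_types, lifting) ennreal_suminf_lessD linorder_not_le order_less_irrefl)
    finally show ?thesis .
  qed
  have "(\<integral>\<^sup>+ x. ennreal (norm (1 / (1 + norm (x::'a)) ^ ?N)) \<partial>lborel) \<le> (\<integral>\<^sup>+ x. (\<Sum>n. ?f n x) \<partial>lborel)"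
    by (rule nn_integral_mono) (rule le)
  also have "\<dots> = (\<Sum>n. \<integral>\<^sup>+ x. ?f n x \<partial>lborel)"
    by (rule nn_integral_suminf, intro borel_measurable_times_ennreal borel_measurable_const borel_measurable_indicator) simp
  also have "\<dots> = (\<Sum>n. ennreal (?c * (1 / (real n + 1) ^ 2)))"
  proof (rule suminf_cong)
    fix n :: nat
    have "(\<integral>\<^sup>+ x. ?f n x \<partial>lborel) = ennreal (1 / (real n + 1) ^ ?N) * emeasure lborel (ball (0::'a) (real n + 1))"
      by (rule nn_integral_cmult_indicator) simp
    also have "\<dots> = ennreal (1 / (real n + 1) ^ ?N) * ennreal (?c * (real n + 1) ^ DIM('a))"
      by (subst emeasure_ball) auto
    also have "\<dots> = ennreal (?c * (1 / (real n + 1) ^ 2))"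
    proof -
      have "1 / (real n + 1) ^ ?N * (?c * (real n + 1) ^ DIM('a)) = ?c * (1 / (real n + 1) ^ 2)"
        by (simp add: power_add power2_eq_square)
      then show ?thesis by (subst ennreal_mult[symmetric]) auto
    qed
    finally show "(\<integral>\<^sup>+ x. ?f n x \<partial>lborel) = ennreal (?c * (1 / (real n + 1) ^ 2))" .
  qed
  also have "\<dots> = ennreal (\<Sum>n. ?c * (1 / (real n + 1) ^ 2))"
  proof (rule suminf_ennreal2)
    have "summable (\<lambda>n. 1 / (real (Suc n)) ^ 2)"
      using inverse_power_summable[of 2, where 'a = real] by (subst summable_Suc_iff) (auto simp: field_simps)
    then show "summable (\<lambda>n. ?c * (1 / (real n + 1) ^ 2))"
      by (intro summable_mult) (simp add: add.commute)
  qed auto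
  also have "\<dots> < \<infinity>" by simp
  finally show "(\<integral>\<^sup>+ x. ennreal (norm (1 / (1 + norm (x::'a)) ^ ?N)) \<partial>lborel) < \<infinity>" .
qed measurable

lemma integrable_decay:
  fixes f :: "'a::euclidean_space \<Rightarrow> 'b::{banach, second_countable_topology}"
  assumes "f \<in> borel_measurable borel" and "\<And>x. (1 + norm x) ^ (DIM('a) + 2) * norm (f x) \<le> B"
  shows "integrable lborel f"
proof (rule Bochner_Integration.integrable_bound)
  show "integrable lborel (\<lambda>x::'a. B * (1 / (1 + norm x) ^ (DIM('a) + 2)))"
    using integrable_inverse_power by (rule integrable_mult_right)
  show "AE x in lborel. norm (f x) \<le> norm (B * (1 / (1 + norm x) ^ (DIM('a) + 2)))"
  proof (rule AE_I2)
    fix x :: 'a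
    have p: "0 < 1 + norm x" by (simp add: add_pos_nonneg)
    then have "norm (f x) \<le> B * (1 / (1 + norm x) ^ (DIM('a) + 2))"
      using assms(2)[of x] by (simp add: pos_le_divide_eq mult.commute)
    then show "norm (f x) \<le> norm (B * (1 / (1 + norm x) ^ (DIM('a) + 2)))"
      by (metis abs_ge_self order_trans real_norm_def)
  qed
qed (use assms in simp)

text \<open>Along sequences this is dominated convergence. As the bound holds only within distance
  \<open>e\<close> of the limit point, the sequence is shifted by \<open>N\<close> first.\<close>

lemma tendsto_integral_dominated:
  fixes s :: "'c::metric_space \<Rightarrow> 'a \<Rightarrow> 'b::{banach, second_countable_topology}"
  assumes "f \<in> borel_measurable M" "\<And>t. s t \<in> borel_measurable M" "integrable M w" "0 < e"
    and lim: "\<And>x. x \<in> space M \<Longrightarrow> ((\<lambda>t. s t x) \<longlongrightarrow> f x) (at a within S)"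
    and bound: "\<And>t x. x \<in> space M \<Longrightarrow> t \<in> S \<Longrightarrow> t \<noteq> a \<Longrightarrow> dist t a < e \<Longrightarrow> norm (s t x) \<le> w x"
  shows "((\<lambda>t. integral\<^sup>L M (s t)) \<longlongrightarrow> integral\<^sup>L M f) (at a within S)"
  unfolding tendsto_at_iff_sequentially
proof (intro allI impI)
  fix X assume X: "\<forall>i. X i \<in> S - {a}" "X \<longlonglongrightarrow> a"
  then obtain N where N: "\<And>n. N \<le> n \<Longrightarrow> dist (X n) a < e"
    using \<open>0 < e\<close> unfolding LIMSEQ_def by meson
  have "(\<lambda>n. integral\<^sup>L M (s (X (n + N)))) \<longlonglongrightarrow> integral\<^sup>L M f"
  proof (rule integral_dominated_convergence)
    show "AE x in M. (\<lambda>n. s (X (n + N)) x) \<longlonglongrightarrow> f x"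
    proof (rule AE_I2)
      fix x assume "x \<in> space M"
      then have "((\<lambda>t. s t x) \<circ> X) \<longlonglongrightarrow> f x"
        using lim X unfolding tendsto_at_iff_sequentially by blast
      then show "(\<lambda>n. s (X (n + N)) x) \<longlonglongrightarrow> f x"
        by (intro LIMSEQ_ignore_initial_segment[of "\<lambda>n. s (X n) x"]) (simp add: comp_def)
    qed
    show "AE x in M. norm (s (X (n + N)) x) \<le> w x" for n
      using N X(1) by (intro AE_I2 bound) auto
  qed (use assms in auto)
  then show "((\<lambda>t. integral\<^sup>L M (s t)) \<circ> X) \<longlonglongrightarrow> integral\<^sup>L M f"
    unfolding comp_def by (rule LIMSEQ_offset)
qed

text \<open>The bound on \<open>D\<close> over the whole ball makes \<open>F\<close> Lipschitz by
  the mean value theorem. The remainder quotient \<open>Q\<close> is therefore at most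
  \<open>2 * B t\<close>, and dominated convergence applies to it.\<close>

lemma has_derivative_integral:
  fixes F :: "'a::euclidean_space \<Rightarrow> 'b \<Rightarrow> complex"
  assumes der: "\<And>x t. x \<in> ball x0 1 \<Longrightarrow> ((\<lambda>x. F x t) has_derivative D x t) (at x)"
    and meas: "\<And>x. F x \<in> borel_measurable M" "\<And>h. (\<lambda>t. D x0 t h) \<in> borel_measurable M"
    and bound: "\<And>x t h. x \<in> ball x0 1 \<Longrightarrow> norm (D x t h) \<le> B t * norm h"
    and int: "integrable M B" "integrable M (F x0)"
  shows "((\<lambda>x. LINT t|M. F x t) has_derivative (\<lambda>h. LINT t|M. D x0 t h)) (at x0)"
proof -
  have x0: "x0 \<in> ball x0 1" by simp
  have B0: "0 \<le> B t" for t
    by (metis bound[OF x0] SOME_Basis norm_Basis mult.right_neutral norm_ge_zero order_trans)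
  have lip: "norm (F x t - F x0 t) \<le> B t * norm (x - x0)" if "x \<in> ball x0 1" for x t
  proof (rule differentiable_bound[where S = "ball x0 1" and f' = "\<lambda>x. D x t"])
    show "((\<lambda>x. F x t) has_derivative D x t) (at x within ball x0 1)" if "x \<in> ball x0 1" for x
      using der[OF that] has_derivative_at_withinI by blast
    show "onorm (D x t) \<le> B t" if "x \<in> ball x0 1" for x
      by (rule onorm_bound) (use bound[OF that] B0 in auto)
  qed (use that in auto)
  have intD: "integrable M (\<lambda>t. D x0 t h)" for h
  proof (rule Bochner_Integration.integrable_bound)
    show "integrable M (\<lambda>t. B t * norm h)" using int by simp
    show "AE t in M. norm (D x0 t h) \<le> norm (B t * norm h)"
      using bound[OF x0] B0 by (simp add: abs_mult)
  qed (rule meas)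
  have intF: "integrable M (F x)" if "x \<in> ball x0 1" for x
  proof -
    have "integrable M (\<lambda>t. F x t - F x0 t)"
    proof (rule Bochner_Integration.integrable_bound)
      show "integrable M (\<lambda>t. B t * norm (x - x0))" using int by simp
      show "AE t in M. norm (F x t - F x0 t) \<le> norm (B t * norm (x - x0))"
        using lip[OF that] B0 by (simp add: abs_mult)
    qed (use meas in auto)
    from Bochner_Integration.integrable_add[OF this int(2)] show ?thesis by simp
  qed
  have linD: "bounded_linear (D x0 t)" for t
    using der[OF x0] has_derivative_bounded_linear by blast
  have blin: "bounded_linear (\<lambda>h. LINT t|M. D x0 t h)"
  proof (rule bounded_linear_intro[where K = "LINT t|M. B t"])
    fix x y :: 'a and r :: real
    show "(LINT t|M. D x0 t (x + y)) = (LINT t|M. D x0 t x) + (LINT t|M. D x0 t y)"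
      using intD by (simp add: linear_add[OF bounded_linear.linear[OF linD]])
    show "(LINT t|M. D x0 t (r *\<^sub>R x)) = r *\<^sub>R (LINT t|M. D x0 t x)"
      by (simp add: linear_scale[OF bounded_linear.linear[OF linD]] scaleR_conv_of_real)
    have "norm (LINT t|M. D x0 t x) \<le> (LINT t|M. norm (D x0 t x))" by (rule integral_norm_bound)
    also have "\<dots> \<le> (LINT t|M. B t * norm x)"
      using bound[OF x0] int intD by (intro integral_mono) auto
    finally show "norm (LINT t|M. D x0 t x) \<le> norm x * (LINT t|M. B t)" by (simp add: mult.commute)
  qed
  define Q where "Q = (\<lambda>h t. (1 / norm h) *\<^sub>R (F (x0 + h) t - F x0 t - D x0 t h))"
  have "((\<lambda>h. LINT t|M. Q h t) \<longlongrightarrow> (LINT t|M. 0)) (at 0)"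
  proof (rule tendsto_integral_dominated[where w = "\<lambda>t. 2 * B t" and e = 1])
    show "Q h \<in> borel_measurable M" for h unfolding Q_def using meas by measurable
    show "integrable M (\<lambda>t. 2 * B t)" using int by simp
    show "((\<lambda>h. Q h t) \<longlongrightarrow> 0) (at 0)" for t
    proof -
      have "((\<lambda>h. norm (F (x0 + h) t - F x0 t - D x0 t h) / norm h) \<longlongrightarrow> 0) (at 0)"
        using der[OF x0, of t] unfolding has_derivative_at by auto
      then have "((\<lambda>h. norm (Q h t)) \<longlongrightarrow> 0) (at 0)" by (simp add: Q_def)
      then show ?thesis by (simp add: tendsto_norm_zero_iff)
    qed
    fix t and h :: 'a assume h: "h \<noteq> 0" "dist h 0 < 1"
    have "norm (F (x0 + h) t - F x0 t - D x0 t h) \<le> norm (F (x0 + h) t - F x0 t) + norm (D x0 t h)"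
      by (rule norm_triangle_ineq4)
    also have "\<dots> \<le> B t * norm h + B t * norm h"
      using lip[of "x0 + h" t] bound[OF x0, of t h] h by (intro add_mono) (auto simp: dist_norm)
    finally show "norm (Q h t) \<le> 2 * B t" using h unfolding Q_def norm_scaleR by (simp add: field_simps)
  qed auto
  then have "((\<lambda>h. norm (LINT t|M. Q h t)) \<longlongrightarrow> 0) (at 0)"
    by (simp add: tendsto_norm_zero)
  moreover have "\<forall>\<^sub>F h in at 0. norm (LINT t|M. Q h t) =
      norm ((LINT t|M. F (x0 + h) t) - (LINT t|M. F x0 t) - (LINT t|M. D x0 t h)) / norm h"
    unfolding eventually_at
  proof (intro exI[of _ 1] conjI ballI impI)
    fix h :: 'a assume "h \<noteq> 0 \<and> dist h 0 < 1"
    then have "integrable M (F (x0 + h))" by (intro intF) (auto simp: dist_norm)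
    then have "(LINT t|M. Q h t) = (1 / norm h) *\<^sub>R ((LINT t|M. F (x0 + h) t) - (LINT t|M. F x0 t) - (LINT t|M. D x0 t h))"
      unfolding Q_def using int intD by simp
    then show "norm (LINT t|M. Q h t) =
      norm ((LINT t|M. F (x0 + h) t) - (LINT t|M. F x0 t) - (LINT t|M. D x0 t h)) / norm h" by simp
  qed simp
  ultimately have "((\<lambda>h. norm ((LINT t|M. F (x0 + h) t) - (LINT t|M. F x0 t) - (LINT t|M. D x0 t h)) / norm h) \<longlongrightarrow> 0) (at 0)"
    using tendsto_cong by fast
  then show ?thesis unfolding has_derivative_at using blin by blast
qed

section \<open>Fourier transforms of test functions\<close>

text \<open>With the radius made explicit, the class for one \<open>R\<close> is closed under
  differentiation and multiplication by coordinates, and so can serve as an invariant in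
  inductions.\<close>

definition bump :: "real \<Rightarrow> ('a::euclidean_space \<Rightarrow> complex) set" where
  "bump R = {\<theta>. smooth \<theta> \<and> (\<forall>x. R < norm x \<longrightarrow> \<theta> x = 0)}"

lemma bump_smooth: "\<theta> \<in> bump R \<Longrightarrow> smooth \<theta>"
  by (simp add: bump_def)

lemma bump_pd:
  assumes "\<theta> \<in> bump R" "v \<in> Basis" shows "pd v \<theta> \<in> bump R"
proof -
  have "frechet_derivative \<theta> (at x) v = 0" if "R < norm x" for x
  proof -
    have "(\<theta> has_derivative (\<lambda>h. 0)) (at x)"
    proof (rule has_derivative_transform_within_open[where f = "\<lambda>x. 0"])
      show "open {x::'a. R < norm x}" by (intro open_Collect_less continuous_intros)
      show "x \<in> {x. R < norm x}" using that by simp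
    qed (use assms that in \<open>auto simp: bump_def\<close>)
    then show ?thesis by (metis frechet_derivative_at)
  qed
  then show ?thesis using assms smooth_pd by (auto simp: bump_def)
qed

lemma bump_coord_mult: "\<theta> \<in> bump R \<Longrightarrow> (\<lambda>x. of_real (x \<bullet> v) * \<theta> x) \<in> bump R"
  by (auto simp: bump_def smooth_coord_mult)

lemma bump_cmult: "\<theta> \<in> bump R \<Longrightarrow> (\<lambda>x. c * \<theta> x) \<in> bump R"
  by (auto simp: bump_def smooth_cmult)

lemma bump_add_scaled: "\<theta> \<in> bump R \<Longrightarrow> \<eta> \<in> bump R \<Longrightarrow> (\<lambda>x. \<theta> x + c * \<eta> x) \<in> bump R"
  by (auto simp: bump_def smooth_add_scaled)

lemma bump_mono: "\<theta> \<in> bump R \<Longrightarrow> R \<le> R' \<Longrightarrow> \<theta> \<in> bump R'"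
  by (auto simp: bump_def)

lemma bump_bounded:
  assumes "\<theta> \<in> bump R"
  shows "\<exists>B. \<forall>x. norm (\<theta> x) \<le> B"
proof -
  have "compact (\<theta> ` cball 0 R)"
    using assms by (intro compact_continuous_image smooth_continuous_on bump_smooth) auto
  then obtain B where B: "\<And>x. x \<in> cball 0 R \<Longrightarrow> norm (\<theta> x) \<le> B"
    using compact_imp_bounded bounded_iff by (metis imageI)
  have "norm (\<theta> x) \<le> max B 0" for x
    using B[of x] assms by (cases "norm x \<le> R") (auto simp: bump_def)
  then show ?thesis by blast
qed

lemma bump_rapid:
  assumes "\<theta> \<in> bump R"
  shows "\<exists>B. \<forall>x. (1 + norm x) ^ N * norm (\<theta> x) \<le> B"
proof -
  obtain B where B: "\<And>x. norm (\<theta> x) \<le> B" using bump_bounded[OF assms] by blast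
  have "(1 + norm x) ^ N * norm (\<theta> x) \<le> (1 + \<bar>R\<bar>) ^ N * B" for x
  proof (cases "norm x \<le> R")
    case True
    then show ?thesis using B by (intro mult_mono power_mono) auto
  next
    case False
    have "0 \<le> B" using B[of 0] norm_ge_zero order_trans by blast
    then show ?thesis using False assms by (auto simp: bump_def)
  qed
  then show ?thesis by blast
qed

lemma bump_schwartz: 
  assumes "\<theta> \<in> bump R" shows "\<theta> \<in> schwartz"
proof (rule schwartzI)
  show "smooth \<theta>" using assms bump_smooth by blast
  fix vs N assume "set vs \<subseteq> (Basis::'a set)"
  then have "iter_deriv vs \<theta> \<in> bump R" by (intro iter_deriv_closed bump_pd assms)
  then show "\<exists>B. \<forall>x. (1 + norm x) ^ N * norm (iter_deriv vs \<theta> x) \<le> B" by (rule bump_rapid)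
qed

lemma bump_measurable: "\<theta> \<in> bump R \<Longrightarrow> \<theta> \<in> borel_measurable borel"
  by (simp add: bump_smooth smooth_borel_measurable)

lemma schwartz_measurable: "\<theta> \<in> schwartz \<Longrightarrow> \<theta> \<in> borel_measurable borel"
  by (simp add: schwartz_smooth smooth_borel_measurable)

lemma schwartz_pd_measurable:
  fixes k :: "'a::euclidean_space \<Rightarrow> complex"
  assumes "k \<in> schwartz"
  shows "pd h k \<in> borel_measurable borel"
proof -
  have "pd h k = (\<lambda>x. \<Sum>b\<in>Basis. (h \<bullet> b) *\<^sub>R pd b k x)"
    using pd_sum_basis[OF smooth_differentiable[OF schwartz_smooth[OF assms]]] by fast
  moreover have "(\<lambda>x. \<Sum>b\<in>Basis. (h \<bullet> b) *\<^sub>R pd b k x) \<in> borel_measurable borel"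
    using schwartz_measurable[OF schwartz_pd[OF assms]] by (intro borel_measurable_sum borel_measurable_scaleR) auto
  ultimately show ?thesis by simp
qed

lemma schwartz_integrable:
  fixes \<theta> :: "'a::euclidean_space \<Rightarrow> complex"
  assumes "\<theta> \<in> schwartz" shows "integrable lborel \<theta>"
proof -
  obtain B where "\<And>x. (1 + norm x) ^ (DIM('a) + 2) * norm (iter_deriv [] \<theta> x) \<le> B"
    using schwartz_bound[OF assms, of "[]"] by (metis empty_subsetI list.set(1))
  then show ?thesis using integrable_decay[OF schwartz_measurable[OF assms], of B] by (simp del: power_Suc add_2_eq_Suc')
qed

lemma bump_integrable: "\<theta> \<in> bump R \<Longrightarrow> integrable lborel \<theta>"
  using schwartz_integrable bump_schwartz by blast

section \<open>Differentiation of the inverse Fourier transform\<close>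

abbreviation fconst :: "'a::euclidean_space itself \<Rightarrow> complex" where
  "fconst _ \<equiv> complex_of_real ((2 * pi) powr (- real DIM('a) / 2))"

lemma iexp_has_derivative:
  assumes "(f has_derivative f') (at x)"
  shows "((\<lambda>x. iexp (f x)) has_derivative (\<lambda>h. iexp (f x) * (\<i> * of_real (f' h)))) (at x)"
proof -
  have "((\<lambda>x. \<i> * complex_of_real (f x)) has_derivative (\<lambda>h. \<i> * of_real (f' h))) (at x)"
    using assms by (intro has_derivative_mult_right has_derivative_of_real)
  moreover have "(exp has_derivative (*) (iexp (f x))) (at (\<i> * complex_of_real (f x)))"
    using DERIV_exp has_field_derivative_def by metis
  ultimately show ?thesis by (rule has_derivative_compose)
qed

lemma iexp_integrable:
  assumes "integrable lborel \<theta>"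
  shows "integrable lborel (\<lambda>\<xi>::'a::euclidean_space. iexp (x \<bullet> \<xi>) * \<theta> \<xi>)"
proof (rule Bochner_Integration.integrable_bound[OF assms])
  have "(\<lambda>\<xi>::'a. iexp (x \<bullet> \<xi>)) \<in> borel_measurable borel"
    by (intro borel_measurable_continuous_onI continuous_intros)
  then show "(\<lambda>\<xi>::'a. iexp (x \<bullet> \<xi>) * \<theta> \<xi>) \<in> borel_measurable lborel"
    using assms by measurable
qed (simp add: norm_mult)

lemma inv_fourier_cmult: "inv_fourier (\<lambda>\<xi>. c * \<theta> \<xi>) x = c * inv_fourier \<theta> x"
  unfolding inv_fourier_def by (simp add: mult.left_commute[of _ c])

lemma inv_fourier_add_scaled:
  assumes "integrable lborel \<theta>" "integrable lborel \<eta>"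
  shows "inv_fourier (\<lambda>\<xi>. \<theta> \<xi> + c * \<eta> \<xi>) x = inv_fourier \<theta> x + c * inv_fourier \<eta> x"
proof -
  have "inv_fourier (\<lambda>\<xi>. \<theta> \<xi> + c * \<eta> \<xi>) x = inv_fourier \<theta> x + inv_fourier (\<lambda>\<xi>. c * \<eta> \<xi>) x"
    unfolding inv_fourier_def using assms
    by (subst distrib_left[symmetric], subst Bochner_Integration.integral_add[symmetric])
       (auto simp: iexp_integrable distrib_left)
  then show ?thesis by (simp add: inv_fourier_cmult)
qed

lemma inv_fourier_has_derivative:
  fixes \<theta> :: "'a::euclidean_space \<Rightarrow> complex"
  assumes "\<theta> \<in> bump R"
  shows "(inv_fourier \<theta> has_derivative (\<lambda>h. inv_fourier (\<lambda>\<xi>. \<i> * (of_real (\<xi> \<bullet> h) * \<theta> \<xi>)) x)) (at x)"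
proof -
  note [measurable] = bump_measurable[OF assms]
  have m: "(\<lambda>\<xi>::'a. iexp (y \<bullet> \<xi>)) \<in> borel_measurable borel" for y
    by (intro borel_measurable_continuous_onI continuous_intros)
  have "((\<lambda>x. LINT \<xi>|lborel. iexp (x \<bullet> \<xi>) * \<theta> \<xi>) has_derivative
     (\<lambda>h. LINT \<xi>|lborel. iexp (x \<bullet> \<xi>) * (\<i> * (of_real (\<xi> \<bullet> h) * \<theta> \<xi>)))) (at x)"
  proof (rule has_derivative_integral[where B = "\<lambda>\<xi>. norm \<xi> * norm (\<theta> \<xi>)" and D = "\<lambda>x \<xi> h. iexp (x \<bullet> \<xi>) * (\<i> * (of_real (\<xi> \<bullet> h) * \<theta> \<xi>))"])
    fix y \<xi> h :: 'a
    show "((\<lambda>x. iexp (x \<bullet> \<xi>) * \<theta> \<xi>) has_derivative (\<lambda>h. iexp (y \<bullet> \<xi>) * (\<i> * (of_real (\<xi> \<bullet> h) * \<theta> \<xi>)))) (at y)"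
      by (rule has_derivative_eq_rhs, rule has_derivative_mult_left, rule iexp_has_derivative)
         (auto intro!: derivative_eq_intros simp: inner_commute mult_ac)
    have "\<bar>\<xi> \<bullet> h\<bar> * norm (\<theta> \<xi>) \<le> norm \<xi> * norm h * norm (\<theta> \<xi>)"
      by (intro mult_right_mono Cauchy_Schwarz_ineq2) auto
    then show "norm (iexp (y \<bullet> \<xi>) * (\<i> * (of_real (\<xi> \<bullet> h) * \<theta> \<xi>))) \<le> norm \<xi> * norm (\<theta> \<xi>) * norm h"
      by (simp add: norm_mult mult_ac)
  next
    show "(\<lambda>\<xi>. iexp (y \<bullet> \<xi>) * \<theta> \<xi>) \<in> borel_measurable lborel" for y using m by measurable
    show "(\<lambda>\<xi>. iexp (x \<bullet> \<xi>) * (\<i> * (of_real (\<xi> \<bullet> h) * \<theta> \<xi>))) \<in> borel_measurable lborel" for h using m by measurable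
    show "integrable lborel (\<lambda>\<xi>. iexp (x \<bullet> \<xi>) * \<theta> \<xi>)"
      by (rule iexp_integrable[OF bump_integrable[OF assms]])
    \<comment> \<open>Integrability takes the power d + 2; one more absorbs the factor
      \<open>norm \<xi>\<close> produced by differentiation.\<close>
    obtain B where B: "\<And>x. (1 + norm x) ^ (DIM('a) + 3) * norm (\<theta> x) \<le> B" using bump_rapid[OF assms] by blast
    show "integrable lborel (\<lambda>\<xi>. norm \<xi> * norm (\<theta> \<xi>))"
    proof (rule integrable_decay)
      fix x :: 'a
      have "(1 + norm x) ^ (DIM('a) + 2) * norm (norm x * norm (\<theta> x)) \<le> (1 + norm x) ^ (DIM('a) + 2) * ((1 + norm x) * norm (\<theta> x))"
        by (intro mult_left_mono) (auto simp: mult_right_mono)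
      also have "\<dots> = (1 + norm x) ^ (DIM('a) + 3) * norm (\<theta> x)"
        by (simp add: power_add numeral_3_eq_3 power2_eq_square)
      finally show "(1 + norm x) ^ (DIM('a) + 2) * norm (norm x * norm (\<theta> x)) \<le> B" using B[of x] by linarith
    qed measurable
  qed
  then show ?thesis unfolding inv_fourier_def by (rule has_derivative_mult_right)
qed

lemma pd_inv_fourier:
  assumes "\<theta> \<in> bump R"
  shows "pd v (inv_fourier \<theta>) = inv_fourier (\<lambda>\<xi>. \<i> * (of_real (\<xi> \<bullet> v) * \<theta> \<xi>))"
  using pd_eqI[OF inv_fourier_has_derivative[OF assms]] by fast

lemma iexp_add: "iexp (s + t) = iexp s * iexp t"
  by (simp add: exp_add distrib_left)

section \<open>Affine substitutions in integrals\<close>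

lemma nn_integral_lborel_affine:
  fixes f :: "'a::euclidean_space \<Rightarrow> ennreal"
  assumes [measurable]: "f \<in> borel_measurable borel" and c: "c \<noteq> 0"
  shows "(\<integral>\<^sup>+x. f x \<partial>lborel) = ennreal (\<bar>c\<bar> ^ DIM('a)) * (\<integral>\<^sup>+x. f (t + c *\<^sub>R x) \<partial>lborel)"
  by (subst lborel_affine[OF c, of t])
     (simp add: nn_integral_density nn_integral_distr nn_integral_cmult)

lemma integrable_lborel_affine:
  fixes f :: "'a::euclidean_space \<Rightarrow> 'b::{banach, second_countable_topology}"
  assumes "integrable lborel f" and c: "c \<noteq> 0"
  shows "integrable lborel (\<lambda>x. f (t + c *\<^sub>R x))"
proof -
  have m[measurable]: "f \<in> borel_measurable borel" using assms by auto
  have "(\<integral>\<^sup>+x. ennreal (norm (f x)) \<partial>lborel) < \<infinity>" using assms by (simp add: integrable_iff_bounded)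
  then have "ennreal (\<bar>c\<bar> ^ DIM('a)) * (\<integral>\<^sup>+x. ennreal (norm (f (t + c *\<^sub>R x))) \<partial>lborel) < \<infinity>"
    using nn_integral_lborel_affine[of "\<lambda>x. ennreal (norm (f x))" c t] c by simp
  then have "(\<integral>\<^sup>+x. ennreal (norm (f (t + c *\<^sub>R x))) \<partial>lborel) < \<infinity>"
    using c by (auto simp: ennreal_mult_less_top)
  then show ?thesis by (intro integrableI_bounded) auto
qed

lemma integral_lborel_affine:
  fixes f :: "'a::euclidean_space \<Rightarrow> 'b::{banach, second_countable_topology}"
  assumes [measurable]: "f \<in> borel_measurable borel" and c: "c \<noteq> 0"
  shows "(LINT x|lborel. f x) = \<bar>c\<bar> ^ DIM('a) *\<^sub>R (LINT x|lborel. f (t + c *\<^sub>R x))"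
  by (subst lborel_affine[OF c, of t]) (simp add: integral_density integral_distr)

text \<open>Schwartz bounds concern partial derivatives, whereas
  \<open>has_derivative_integral\<close> asks for the full derivative in an arbitrary
  direction.\<close>

lemma schwartz_deriv_bound:
  fixes k :: "'a::euclidean_space \<Rightarrow> complex"
  assumes "k \<in> schwartz"
  shows "\<exists>B\<ge>0. \<forall>z h. (1 + norm z) ^ N * norm (frechet_derivative k (at z) h) \<le> B * norm h"
proof -
  have "\<forall>b\<in>Basis. \<exists>B\<ge>0. \<forall>z. (1 + norm z) ^ N * norm (frechet_derivative k (at z) b) \<le> B"
    using schwartz_bound[OF assms, of "[b]" N for b] by auto
  then obtain B where B0: "\<And>b::'a. b \<in> Basis \<Longrightarrow> 0 \<le> B b" and B: "\<And>b z. b \<in> Basis \<Longrightarrow> (1 + norm z) ^ N * norm (frechet_derivative k (at z) b) \<le> B b"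
    by metis
  have "(1 + norm z) ^ N * norm (frechet_derivative k (at z) h) \<le> (\<Sum>b\<in>Basis. B b) * norm h" for z h
  proof -
    have "norm (frechet_derivative k (at z) h) = norm (\<Sum>b\<in>Basis. (h \<bullet> b) *\<^sub>R frechet_derivative k (at z) b)"
      using pd_sum_basis[OF smooth_differentiable[OF schwartz_smooth[OF assms]]] by metis
    also have "\<dots> \<le> (\<Sum>b\<in>Basis. norm h * norm (frechet_derivative k (at z) b))"
      by (rule order_trans[OF norm_sum], rule sum_mono) (simp add: mult_right_mono Basis_le_norm)
    finally have "(1 + norm z) ^ N * norm (frechet_derivative k (at z) h) \<le>
        (1 + norm z) ^ N * (\<Sum>b\<in>Basis. norm h * norm (frechet_derivative k (at z) b))"
      by (intro mult_left_mono) auto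
    also have "\<dots> = (\<Sum>b\<in>Basis. ((1 + norm z) ^ N * norm (frechet_derivative k (at z) b)) * norm h)"
      by (simp add: sum_distrib_left mult_ac)
    also have "\<dots> \<le> (\<Sum>b\<in>Basis. B b * norm h)"
      by (intro sum_mono mult_right_mono B) auto
    finally show ?thesis by (simp add: sum_distrib_right)
  qed
  then show ?thesis using B0 by (intro exI[of _ "\<Sum>b\<in>Basis. B b"] conjI sum_nonneg) auto
qed

text \<open>The weight passes from \<open>z\<close> to \<open>y\<close> when \<open>z\<close> is
  near \<open>y\<close> or near \<open>- y\<close>. The first case serves translates
  \<open>\<theta> (s + \<xi>)\<close>, the second reflected kernels
  \<open>k (x - y)\<close>.\<close>

lemma schwartz_deriv_bound_shift:
  fixes k :: "'a::euclidean_space \<Rightarrow> complex"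
  assumes B: "\<And>z h. (1 + norm z) ^ N * norm (frechet_derivative k (at z) h) \<le> B * norm h" "0 \<le> B"
    and "norm (z - y) \<le> r \<or> norm (z + y) \<le> r"
  shows "norm (frechet_derivative k (at z) h) \<le> B * (1 + r) ^ N / (1 + norm y) ^ N * norm h"
proof -
  have "1 + norm y \<le> (1 + norm (z - y)) * (1 + norm z)" "1 + norm y \<le> (1 + norm (z + y)) * (1 + norm z)"
    using one_plus_norm_diff_le[of z "z - y"] one_plus_norm_diff_le[of "z + y" z] by (auto simp: mult.commute)
  moreover have "(1 + norm (z - y)) * (1 + norm z) \<le> (1 + r) * (1 + norm z)" if "norm (z - y) \<le> r"
    by (rule mult_right_mono) (use that in auto)
  moreover have "(1 + norm (z + y)) * (1 + norm z) \<le> (1 + r) * (1 + norm z)" if "norm (z + y) \<le> r"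
    by (rule mult_right_mono) (use that in auto)
  ultimately have le: "1 + norm y \<le> (1 + r) * (1 + norm z)" using assms(3) by linarith
  have r: "0 \<le> r" using assms(3) norm_ge_zero order_trans by blast
  have "(1 + norm y) ^ N * norm (frechet_derivative k (at z) h) \<le> ((1 + r) * (1 + norm z)) ^ N * norm (frechet_derivative k (at z) h)"
    by (intro mult_right_mono power_mono le) auto
  also have "\<dots> = (1 + r) ^ N * ((1 + norm z) ^ N * norm (frechet_derivative k (at z) h))"
    by (simp add: power_mult_distrib)
  also have "\<dots> \<le> (1 + r) ^ N * (B * norm h)"
    using r by (intro mult_left_mono B) auto
  moreover have "0 < (1 + norm y) ^ N" by (simp add: add_pos_nonneg)
  ultimately show ?thesis by (simp add: field_simps)
qed

text \<open>In place of integration by parts: translating \<theta> by \<open>s\<close> multiplies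
  the integral by \<open>iexp (x \<bullet> (- s))\<close>, and both descriptions are differentiated
  at \<open>s = 0\<close>. Uniqueness of the derivative gives the identity.\<close>

lemma inv_fourier_coord_mult:
  fixes \<theta> :: "'a::euclidean_space \<Rightarrow> complex"
  assumes "\<theta> \<in> schwartz"
  shows "of_real (x \<bullet> v) * inv_fourier \<theta> x = inv_fourier (\<lambda>\<xi>. \<i> * pd v \<theta> \<xi>) x"
proof -
  note [measurable] = schwartz_measurable[OF assms]
  have m: "(\<lambda>\<xi>::'a. iexp (x \<bullet> \<xi>)) \<in> borel_measurable borel"
    by (intro borel_measurable_continuous_onI continuous_intros)
  have D: "(\<theta> has_derivative frechet_derivative \<theta> (at x)) (at x)" for x
    by (rule smooth_has_derivative[OF schwartz_smooth[OF assms]])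
  obtain B where B0: "0 \<le> B" and B: "\<And>z h. (1 + norm z) ^ (DIM('a) + 2) * norm (frechet_derivative \<theta> (at z) h) \<le> B * norm h"
    using schwartz_deriv_bound[OF assms] by blast
  define J where "J = (LINT \<xi>|lborel. iexp (x \<bullet> \<xi>) * \<theta> \<xi>)"
  let ?N = "DIM('a) + 2"
  have "((\<lambda>s. LINT \<xi>|lborel. iexp (x \<bullet> \<xi>) * \<theta> (s + \<xi>)) has_derivative (\<lambda>h. LINT \<xi>|lborel. iexp (x \<bullet> \<xi>) * frechet_derivative \<theta> (at (0 + \<xi>)) h)) (at 0)"
  proof (rule has_derivative_integral[where B = "\<lambda>\<xi>. B * (1 + 1) ^ ?N / (1 + norm \<xi>) ^ ?N" and D = "\<lambda>s \<xi> h. iexp (x \<bullet> \<xi>) * frechet_derivative \<theta> (at (s + \<xi>)) h"])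
    fix s \<xi> h :: 'a assume s: "s \<in> ball 0 1"
    have "((\<lambda>s. \<theta> (s + \<xi>)) has_derivative frechet_derivative \<theta> (at (s + \<xi>))) (at s)"
      by (rule has_derivative_compose[OF _ D, of "\<lambda>s. s + \<xi>" "\<lambda>h. h", simplified])
         (auto intro!: derivative_eq_intros)
    then show "((\<lambda>s. iexp (x \<bullet> \<xi>) * \<theta> (s + \<xi>)) has_derivative (\<lambda>h. iexp (x \<bullet> \<xi>) * frechet_derivative \<theta> (at (s + \<xi>)) h)) (at s)"
      by (rule has_derivative_mult_right)
    show "norm (iexp (x \<bullet> \<xi>) * frechet_derivative \<theta> (at (s + \<xi>)) h) \<le> B * (1 + 1) ^ ?N / (1 + norm \<xi>) ^ ?N * norm h"
      using schwartz_deriv_bound_shift[OF B B0, of "s + \<xi>" \<xi> 1 h] s by (simp add: norm_mult)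
  next
    show "(\<lambda>\<xi>. iexp (x \<bullet> \<xi>) * \<theta> (s + \<xi>)) \<in> borel_measurable lborel" for s using m by measurable
    show "(\<lambda>\<xi>. iexp (x \<bullet> \<xi>) * frechet_derivative \<theta> (at (0 + \<xi>)) h) \<in> borel_measurable lborel" for h
      using m schwartz_pd_measurable[OF assms, of h] by measurable
    show "integrable lborel (\<lambda>\<xi>::'a. B * (1 + 1) ^ ?N / (1 + norm \<xi>) ^ ?N)"
      using integrable_mult_right[OF integrable_inverse_power, of "B * 2 ^ ?N"] by simp
    show "integrable lborel (\<lambda>\<xi>. iexp (x \<bullet> \<xi>) * \<theta> (0 + \<xi>))"
      using iexp_integrable[OF schwartz_integrable[OF assms]] by simp
  qed
  moreover have "(LINT \<xi>|lborel. iexp (x \<bullet> \<xi>) * \<theta> (s + \<xi>)) = iexp (x \<bullet> (- s)) * J" for s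
  proof -
    have "J = (LINT \<xi>|lborel. iexp (x \<bullet> (s + \<xi>)) * \<theta> (s + \<xi>))"
      unfolding J_def using m by (subst integral_lborel_affine[of _ 1 s]) auto
    also have "\<dots> = (LINT \<xi>|lborel. iexp (x \<bullet> s) * (iexp (x \<bullet> \<xi>) * \<theta> (s + \<xi>)))"
      by (rule Bochner_Integration.integral_cong) (auto simp: inner_add_right iexp_add mult.assoc simp del: of_real_add)
    also have "\<dots> = iexp (x \<bullet> s) * (LINT \<xi>|lborel. iexp (x \<bullet> \<xi>) * \<theta> (s + \<xi>))"
      by simp
    finally have J: "J = iexp (x \<bullet> s) * (LINT \<xi>|lborel. iexp (x \<bullet> \<xi>) * \<theta> (s + \<xi>))" .
    have "iexp (x \<bullet> (- s)) * iexp (x \<bullet> s) = 1"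
      by (simp flip: exp_add)
    then show ?thesis unfolding J by (simp flip: mult.assoc)
  qed
  ultimately have "((\<lambda>s. iexp (x \<bullet> (- s)) * J) has_derivative (\<lambda>h. LINT \<xi>|lborel. iexp (x \<bullet> \<xi>) * frechet_derivative \<theta> (at \<xi>) h)) (at 0)"
    by simp
  moreover have "((\<lambda>s. iexp (x \<bullet> (- s)) * J) has_derivative (\<lambda>h. - \<i> * of_real (x \<bullet> h) * J)) (at 0)"
    by (rule has_derivative_eq_rhs, rule has_derivative_mult_left, rule iexp_has_derivative)
       (auto intro!: derivative_eq_intros)
  ultimately have "(\<lambda>h. LINT \<xi>|lborel. iexp (x \<bullet> \<xi>) * frechet_derivative \<theta> (at \<xi>) h) = (\<lambda>h. - \<i> * of_real (x \<bullet> h) * J)"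
    by (rule has_derivative_unique)
  then have "(LINT \<xi>|lborel. iexp (x \<bullet> \<xi>) * pd v \<theta> \<xi>) = - \<i> * of_real (x \<bullet> v) * J"
    by meson
  then show ?thesis
    unfolding inv_fourier_cmult unfolding inv_fourier_def J_def[symmetric] by (simp add: algebra_simps)
qed

text \<open>Each power of the weight costs at most 1 plus the sum of the moduli of the coordinates.
  A coordinate turns into a derivative of \<theta>, which stays in \<open>bump R\<close>; hence
  \<theta> is arbitrary in the induction.\<close>

lemma inv_fourier_rapid:
  fixes \<theta> :: "'a::euclidean_space \<Rightarrow> complex"
  assumes "\<theta> \<in> bump R"
  shows "\<exists>B. \<forall>x. (1 + norm x) ^ N * norm (inv_fourier \<theta> x) \<le> B"
  using assms
proof (induction N arbitrary: \<theta>)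
  case 0
  have "norm (inv_fourier \<theta> x) \<le> norm (fconst TYPE('a)) * (LINT \<xi>|lborel. norm (\<theta> \<xi>))" for x
  proof -
    have "norm (LINT \<xi>|lborel. iexp (x \<bullet> \<xi>) * \<theta> \<xi>) \<le> (LINT \<xi>|lborel. norm (iexp (x \<bullet> \<xi>) * \<theta> \<xi>))"
      by (rule integral_norm_bound)
    then show ?thesis unfolding inv_fourier_def norm_mult by (intro mult_left_mono) (auto simp: norm_mult)
  qed
  then show ?case by auto
next
  case (Suc N)
  obtain B0 where B0: "\<And>x. (1 + norm x) ^ N * norm (inv_fourier \<theta> x) \<le> B0"
    using Suc by blast
  have "\<forall>v\<in>Basis. \<exists>B. \<forall>x. (1 + norm x) ^ N * norm (inv_fourier (\<lambda>\<xi>. \<i> * pd v \<theta> \<xi>) x) \<le> B"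
    using Suc.IH bump_cmult[OF bump_pd[OF Suc.prems]] by blast
  then obtain B where B: "\<And>v x. v \<in> Basis \<Longrightarrow> (1 + norm x) ^ N * norm (inv_fourier (\<lambda>\<xi>. \<i> * pd v \<theta> \<xi>) x) \<le> B v"
    by metis
  have "(1 + norm x) ^ Suc N * norm (inv_fourier \<theta> x) \<le> B0 + (\<Sum>v\<in>Basis. B v)" for x
  proof -
    have "(1 + norm x) * norm (inv_fourier \<theta> x) \<le> (1 + (\<Sum>v\<in>Basis. \<bar>x \<bullet> v\<bar>)) * norm (inv_fourier \<theta> x)"
      by (intro mult_right_mono add_left_mono norm_le_l1) auto
    also have "\<dots> = norm (inv_fourier \<theta> x) + (\<Sum>v\<in>Basis. norm (of_real (x \<bullet> v) * inv_fourier \<theta> x))"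
      by (simp add: distrib_right sum_distrib_right norm_mult)
    also have "\<dots> = norm (inv_fourier \<theta> x) + (\<Sum>v\<in>Basis. norm (inv_fourier (\<lambda>\<xi>. \<i> * pd v \<theta> \<xi>) x))"
      by (simp only: inv_fourier_coord_mult[OF bump_schwartz[OF Suc.prems]])
    finally have "(1 + norm x) ^ N * ((1 + norm x) * norm (inv_fourier \<theta> x)) \<le> (1 + norm x) ^ N * (norm (inv_fourier \<theta> x) + (\<Sum>v\<in>Basis. norm (inv_fourier (\<lambda>\<xi>. \<i> * pd v \<theta> \<xi>) x)))"
      by (intro mult_left_mono) auto
    also have "\<dots> = (1 + norm x) ^ N * norm (inv_fourier \<theta> x) + (\<Sum>v\<in>Basis. (1 + norm x) ^ N * norm (inv_fourier (\<lambda>\<xi>. \<i> * pd v \<theta> \<xi>) x))"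
      by (simp add: distrib_left sum_distrib_left)
    also have "\<dots> \<le> B0 + (\<Sum>v\<in>Basis. B v)"
      by (intro add_mono B0 sum_mono B)
    finally show ?thesis by (simp add: mult_ac)
  qed
  then show ?case by blast
qed

lemma inv_fourier_schwartz:
  assumes "\<theta> \<in> bump R"
  shows "inv_fourier \<theta> \<in> schwartz"
proof (rule schwartzI)
  \<comment> \<open>Differentiation multiplies \<theta> by a coordinate, so the image of
    \<open>bump R\<close> is invariant under \<open>pd\<close>.\<close>
  let ?S = "inv_fourier ` bump R"
  have mem: "inv_fourier \<theta> \<in> ?S" using assms by blast
  have cl: "pd v f \<in> ?S" if f: "f \<in> ?S" for f and v :: 'a
  proof -
    obtain \<theta> where \<theta>: "\<theta> \<in> bump R" "f = inv_fourier \<theta>" using f by blast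
    then show ?thesis by (simp only: pd_inv_fourier) (intro imageI bump_cmult bump_coord_mult)
  qed
  show "smooth (inv_fourier \<theta>)"
    by (rule smooth_coinduct[OF mem _ cl])
       (use inv_fourier_has_derivative in \<open>auto simp: differentiable_def\<close>)
  fix vs :: "'a list" and N assume "set vs \<subseteq> Basis"
  then have "iter_deriv vs (inv_fourier \<theta>) \<in> ?S" by (intro iter_deriv_closed[OF mem cl])
  then show "\<exists>B. \<forall>x. (1 + norm x) ^ N * norm (iter_deriv vs (inv_fourier \<theta>) x) \<le> B"
    using inv_fourier_rapid by auto
qed

section \<open>Convolution\<close>

text \<open>The roles are unequal: the first factor may be merely measurable and of polynomial
  growth, while the second is a Schwartz function and takes all derivatives.\<close>

definition conv :: "('a::euclidean_space \<Rightarrow> complex) \<Rightarrow> ('a \<Rightarrow> complex) \<Rightarrow> 'a \<Rightarrow> complex" where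
  "conv w k x = (LINT y|lborel. w y * k (x - y))"

definition poly_growth :: "('a::euclidean_space \<Rightarrow> complex) \<Rightarrow> bool" where
  "poly_growth w \<longleftrightarrow> w \<in> borel_measurable borel \<and> (\<exists>A M. \<forall>y. norm (w y) \<le> A * (1 + norm y) ^ M)"

lemma poly_growth_bound:
  assumes "norm (w y) \<le> A * (1 + norm y) ^ M" and "(1 + norm y) ^ (M + N) * t \<le> C" "0 \<le> t"
  shows "norm (w y) * t \<le> \<bar>A\<bar> * C / (1 + norm y) ^ N"
proof -
  have p: "0 < 1 + norm y" by (simp add: add_pos_nonneg)
  have "norm (w y) * t * (1 + norm y) ^ N \<le> (\<bar>A\<bar> * (1 + norm y) ^ M) * t * (1 + norm y) ^ N"
    using assms(1,3) p by (intro mult_right_mono) (auto intro: order_trans[OF assms(1)] mult_right_mono)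
  also have "\<dots> = \<bar>A\<bar> * ((1 + norm y) ^ (M + N) * t)" by (simp add: power_add mult_ac)
  also have "\<dots> \<le> \<bar>A\<bar> * C" using assms(2) by (intro mult_left_mono) auto
  finally show ?thesis using p by (simp add: field_simps)
qed

lemma conv_integrable:
  fixes k :: "'a::euclidean_space \<Rightarrow> complex"
  assumes "poly_growth w" "k \<in> schwartz"
  shows "integrable lborel (\<lambda>y. w y * k (x - y))"
proof -
  obtain A M where A: "\<And>y. norm (w y) \<le> A * (1 + norm y) ^ M" using assms(1) by (auto simp: poly_growth_def)
  let ?N = "DIM('a) + 2"
  obtain B where B: "\<And>y. (1 + norm y) ^ (M + ?N) * norm (k (x - y)) \<le> B"
    using schwartz_bound[OF schwartz_reflect[OF assms(2)], of "[]" "M + ?N" x] by auto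
  have i: "integrable lborel (\<lambda>y::'a. \<bar>A\<bar> * B * (1 / (1 + norm y) ^ ?N))"
    using integrable_inverse_power by (rule integrable_mult_right)
  have ae: "AE y in lborel. norm (w y * k (x - y)) \<le> norm (\<bar>A\<bar> * B * (1 / (1 + norm y) ^ ?N))"
  proof (rule AE_I2)
    fix y
    have "norm (w y * k (x - y)) \<le> \<bar>A\<bar> * B / (1 + norm y) ^ ?N"
      using poly_growth_bound[where w = w and t = "norm (k (x - y))", OF A B] by (simp add: norm_mult)
    then show "norm (w y * k (x - y)) \<le> norm (\<bar>A\<bar> * B * (1 / (1 + norm y) ^ ?N))"
      unfolding real_norm_def by (intro order_trans[OF _ abs_ge_self]) simp
  qed
  have m: "(\<lambda>y. w y * k (x - y)) \<in> borel_measurable lborel"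
    using assms(1) schwartz_measurable[OF schwartz_reflect[OF assms(2)], of x] by (auto simp: poly_growth_def)
  show ?thesis by (rule Bochner_Integration.integrable_bound[OF i m ae])
qed

lemma conv_has_derivative:
  fixes k :: "'a::euclidean_space \<Rightarrow> complex"
  assumes "poly_growth w" "k \<in> schwartz"
  shows "(conv w k has_derivative (\<lambda>h. LINT y|lborel. w y * frechet_derivative k (at (x - y)) h)) (at x)"
proof -
  obtain A M where A: "\<And>y. norm (w y) \<le> A * (1 + norm y) ^ M" using assms(1) by (auto simp: poly_growth_def)
  have [measurable]: "w \<in> borel_measurable borel" using assms(1) by (auto simp: poly_growth_def)
  note [measurable] = schwartz_measurable[OF assms(2)]
  let ?N = "DIM('a) + 2"
  obtain B where B0: "0 \<le> B" and B: "\<And>z h. (1 + norm z) ^ (M + ?N) * norm (frechet_derivative k (at z) h) \<le> B * norm h"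
    using schwartz_deriv_bound[OF assms(2)] by blast
  have D: "(k has_derivative frechet_derivative k (at x)) (at x)" for x
    by (rule smooth_has_derivative[OF schwartz_smooth[OF assms(2)]])
  \<comment> \<open>For \<open>s\<close> in the unit ball about \<open>x\<close>, the point
    \<open>s - y\<close> is within \<open>1 + norm x\<close> of \<open>- y\<close>; moving the
    weight to \<open>y\<close> costs the power in \<open>C\<close>.\<close>
  define C where "C = \<bar>A\<bar> * (B * (1 + (1 + norm x)) ^ (M + ?N))"
  show ?thesis unfolding conv_def
  proof (rule has_derivative_integral[where B = "\<lambda>y. C * (1 / (1 + norm y) ^ ?N)" and D = "\<lambda>x y h. w y * frechet_derivative k (at (x - y)) h"])
    fix s y h :: 'a assume s: "s \<in> ball x 1"
    have "((\<lambda>s. k (s - y)) has_derivative frechet_derivative k (at (s - y))) (at s)"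
      by (rule has_derivative_compose[OF _ D, of "\<lambda>s. s - y" "\<lambda>h. h", simplified])
         (auto intro!: derivative_eq_intros)
    then show "((\<lambda>s. w y * k (s - y)) has_derivative (\<lambda>h. w y * frechet_derivative k (at (s - y)) h)) (at s)"
      by (rule has_derivative_mult_right)
    have "norm (s - y + y) \<le> 1 + norm x" using s norm_triangle_ineq4[of x "x - s"] by (simp add: dist_norm)
    then have "norm (frechet_derivative k (at (s - y)) h) \<le> B * (1 + (1 + norm x)) ^ (M + ?N) / (1 + norm y) ^ (M + ?N) * norm h"
      using schwartz_deriv_bound_shift[OF B B0, of "s - y" y "1 + norm x" h] by blast
    then have "(1 + norm y) ^ (M + ?N) * norm (frechet_derivative k (at (s - y)) h) \<le> B * (1 + (1 + norm x)) ^ (M + ?N) * norm h"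
      using zero_less_power[of "1 + norm y" "M + ?N"] by (simp add: field_simps add_pos_nonneg)
    from poly_growth_bound[where t = "norm (frechet_derivative k (at (s - y)) h)" and w = w, OF A this] show "norm (w y * frechet_derivative k (at (s - y)) h) \<le> C * (1 / (1 + norm y) ^ ?N) * norm h"
      by (simp add: norm_mult C_def mult_ac)
  next
    show "(\<lambda>y. w y * k (s - y)) \<in> borel_measurable lborel" for s by measurable
    show "(\<lambda>y. w y * frechet_derivative k (at (x - y)) h) \<in> borel_measurable lborel" for h
      using schwartz_pd_measurable[OF assms(2), of h] by measurable
    show "integrable lborel (\<lambda>y::'a. C * (1 / (1 + norm y) ^ ?N))"
      using integrable_inverse_power by (rule integrable_mult_right)
    show "integrable lborel (\<lambda>y. w y * k (x - y))" by (rule conv_integrable[OF assms])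
  qed
qed

lemma pd_conv:
  assumes "poly_growth w" "k \<in> schwartz"
  shows "pd v (conv w k) = conv w (pd v k)"
  using pd_eqI[OF conv_has_derivative[OF assms]] by (simp add: conv_def fun_eq_iff)

lemma conv_smooth:
  assumes "poly_growth w" "k \<in> schwartz"
  shows "smooth (conv w k)"
proof (rule smooth_coinduct[where S = "conv w ` schwartz"])
  show "conv w k \<in> conv w ` schwartz" using assms by blast
  show "f differentiable at x" if "f \<in> conv w ` schwartz" for f x
    using that conv_has_derivative[OF assms(1)] by (auto simp: differentiable_def)
  show "pd v f \<in> conv w ` schwartz" if f: "f \<in> conv w ` schwartz" "v \<in> Basis" for f v
  proof -
    obtain k where k: "k \<in> schwartz" "f = conv w k" using f by blast
    show ?thesis unfolding k(2) pd_conv[OF assms(1) k(1)] using k that schwartz_pd by blast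
  qed
qed

lemma iter_deriv_schwartz: "k \<in> schwartz \<Longrightarrow> set vs \<subseteq> Basis \<Longrightarrow> iter_deriv vs k \<in> schwartz"
  by (rule iter_deriv_closed) (auto simp: schwartz_pd)

lemma iter_deriv_conv:
  assumes "poly_growth w" "k \<in> schwartz"
  shows "set vs \<subseteq> Basis \<Longrightarrow> iter_deriv vs (conv w k) = conv w (iter_deriv vs k)"
proof (induction vs)
  case (Cons v vs)
  then show ?case using pd_conv[OF assms(1) iter_deriv_schwartz[OF assms(2)], of vs v] by simp
qed simp

text \<open>Smoothness is left out on purpose: unlike \<open>schwartz\<close>, this class survives
  restriction to Borel sets, as \<open>tempered_integral\<close> requires.\<close>

definition rapid :: "('a::euclidean_space \<Rightarrow> complex) \<Rightarrow> bool" where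
  "rapid w \<longleftrightarrow> w \<in> borel_measurable borel \<and> (\<forall>N. \<exists>A. \<forall>y. (1 + norm y) ^ N * norm (w y) \<le> A)"

lemma schwartz_rapid: "k \<in> schwartz \<Longrightarrow> rapid k"
  unfolding rapid_def using schwartz_bound[of k "[]"] schwartz_measurable by fastforce

lemma rapid_poly_growth: 
  assumes "rapid w" shows "poly_growth w"
proof -
  obtain A where "\<And>y. (1 + norm y) ^ 0 * norm (w y) \<le> A" using assms unfolding rapid_def by meson
  then have "\<forall>y. norm (w y) \<le> A * (1 + norm y) ^ 0" by simp
  then show ?thesis using assms unfolding rapid_def poly_growth_def by blast
qed

lemma rapid_weight_integrable:
  fixes w :: "'a::euclidean_space \<Rightarrow> complex"
  assumes "rapid w" shows "integrable lborel (\<lambda>y. (1 + norm y) ^ N * norm (w y))"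
proof -
  obtain A where "\<And>y. (1 + norm y) ^ (DIM('a) + 2 + N) * norm (w y) \<le> A" using assms unfolding rapid_def by meson
  then show ?thesis using assms
    by (intro integrable_decay[where B = A]) (auto simp: rapid_def power_add mult.assoc abs_mult)
qed

lemma conv_weighted_bound:
  fixes k :: "'a::euclidean_space \<Rightarrow> complex"
  assumes "rapid w" "k \<in> schwartz" and B: "\<And>z. (1 + norm z) ^ N * norm (k z) \<le> B"
  shows "(1 + norm x) ^ N * norm (conv w k x) \<le> B * (LINT y|lborel. (1 + norm y) ^ N * norm (w y))"
proof -
  have "(1 + norm x) ^ N * norm (conv w k x) = norm (LINT y|lborel. of_real ((1 + norm x) ^ N) * (w y * k (x - y)))"
    by (simp add: conv_def norm_mult norm_power del: of_real_power)
  also have "\<dots> \<le> (LINT y|lborel. B * ((1 + norm y) ^ N * norm (w y)))"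
  proof (rule Bochner_Integration.integral_norm_bound_integral)
    show "integrable lborel (\<lambda>y. of_real ((1 + norm x) ^ N) * (w y * k (x - y)))"
      using conv_integrable[OF rapid_poly_growth[OF assms(1)] assms(2)] by (rule integrable_mult_right)
    show "integrable lborel (\<lambda>y. B * ((1 + norm y) ^ N * norm (w y)))"
      by (rule integrable_mult_right[OF rapid_weight_integrable[OF assms(1)]])
    fix y
    have "(1 + norm x) ^ N \<le> ((1 + norm (x - y)) * (1 + norm y)) ^ N"
      by (intro power_mono one_plus_norm_le) auto
    then have "(1 + norm x) ^ N * (norm (w y) * norm (k (x - y))) \<le> ((1 + norm (x - y)) * (1 + norm y)) ^ N * (norm (w y) * norm (k (x - y)))"
      by (intro mult_right_mono) auto
    also have "\<dots> = (1 + norm y) ^ N * norm (w y) * ((1 + norm (x - y)) ^ N * norm (k (x - y)))"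
      by (simp add: power_mult_distrib mult_ac)
    also have "\<dots> \<le> (1 + norm y) ^ N * norm (w y) * B"
      by (intro mult_left_mono B) auto
    finally show "norm (of_real ((1 + norm x) ^ N) * (w y * k (x - y))) \<le> B * ((1 + norm y) ^ N * norm (w y))"
      by (simp add: norm_mult norm_power mult_ac del: of_real_power)
  qed
  finally show ?thesis by simp
qed

lemma conv_schwartz:
  assumes "rapid w" "k \<in> schwartz"
  shows "conv w k \<in> schwartz"
proof (rule schwartzI)
  show "smooth (conv w k)" using assms rapid_poly_growth conv_smooth by blast
  fix vs :: "'a list" and N assume vs: "set vs \<subseteq> Basis"
  obtain B where "\<And>z. (1 + norm z) ^ N * norm (iter_deriv vs k z) \<le> B"
    using schwartz_bound[OF assms(2) vs] by meson
  from conv_weighted_bound[OF assms(1) iter_deriv_schwartz[OF assms(2) vs] this]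
  show "\<exists>B. \<forall>x. (1 + norm x) ^ N * norm (iter_deriv vs (conv w k) x) \<le> B"
    using iter_deriv_conv[OF rapid_poly_growth[OF assms(1)] assms(2) vs] by auto
qed

section \<open>Tempered distributions and integrals\<close>

lemma schwartz_deriv_bound_finite:
  fixes k :: "'a::euclidean_space \<Rightarrow> complex"
  assumes "k \<in> schwartz"
  shows "\<exists>B\<ge>0. \<forall>vs z h. set vs \<subseteq> Basis \<longrightarrow> length vs \<le> N \<longrightarrow>
    (1 + norm z) ^ N * norm (frechet_derivative (iter_deriv vs k) (at z) h) \<le> B * norm h"
proof -
  let ?V = "{vs::'a list. set vs \<subseteq> Basis \<and> length vs \<le> N}"
  have fin: "finite ?V" by (simp add: finite_lists_length_le)
  have "\<forall>vs\<in>?V. \<exists>B\<ge>0. \<forall>z h. (1 + norm z) ^ N * norm (frechet_derivative (iter_deriv vs k) (at z) h) \<le> B * norm h"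
    using schwartz_deriv_bound iter_deriv_schwartz[OF assms] by blast
  from bchoice[OF this] obtain B where "\<forall>vs\<in>?V. 0 \<le> B vs \<and>
      (\<forall>z h. (1 + norm z) ^ N * norm (frechet_derivative (iter_deriv vs k) (at z) h) \<le> B vs * norm h)" ..
  then have B0: "\<And>vs. vs \<in> ?V \<Longrightarrow> 0 \<le> B vs" and
    B: "\<And>vs z h. vs \<in> ?V \<Longrightarrow> (1 + norm z) ^ N * norm (frechet_derivative (iter_deriv vs k) (at z) h) \<le> B vs * norm h"
    by (simp_all only:)
  have "(1 + norm z) ^ N * norm (frechet_derivative (iter_deriv vs k) (at z) h) \<le> (\<Sum>vs\<in>?V. B vs) * norm h"
    if "set vs \<subseteq> Basis" "length vs \<le> N" for vs z h
  proof -
    have V: "vs \<in> ?V" using that by simp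
    have "B vs \<le> (\<Sum>vs\<in>?V. B vs)" using V B0 fin by (intro member_le_sum) auto
    then have "B vs * norm h \<le> (\<Sum>vs\<in>?V. B vs) * norm h" by (intro mult_right_mono) auto
    then show ?thesis using B[OF V, of z h] by linarith
  qed
  moreover have "0 \<le> (\<Sum>vs\<in>?V. B vs)" using B0 by (intro sum_nonneg)
  ultimately show ?thesis by blast
qed

text \<open>The mean value theorem, with the weight moved to \<open>y\<close>. It gives continuity
  of the translates under T and the gain \<delta> on small sets in \<open>tempered_integral\<close>.
  The base \<open>2 + norm x\<close> is one plus the shift \<open>1 + norm x\<close>.\<close>

lemma iter_deriv_translate_lipschitz:
  fixes k :: "'a::euclidean_space \<Rightarrow> complex"
  assumes k: "k \<in> schwartz" and B0: "0 \<le> B"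
    and B: "\<And>vs z h. set vs \<subseteq> Basis \<Longrightarrow> length vs \<le> N \<Longrightarrow>
      (1 + norm z) ^ N * norm (frechet_derivative (iter_deriv vs k) (at z) h) \<le> B * norm h"
    and vs: "set vs \<subseteq> Basis" "length vs \<le> N" and x': "norm (x' - x) \<le> 1"
  shows "(1 + norm y) ^ N * norm (iter_deriv vs k (x' - y) - iter_deriv vs k (x - y)) \<le>
    B * (2 + norm x) ^ N * norm (x' - x)"
proof -
  let ?f = "iter_deriv vs k"
  have p: "0 < (1 + norm y) ^ N" by (simp add: add_pos_nonneg)
  let ?L = "B * (1 + (1 + norm x)) ^ N / (1 + norm y) ^ N"
  have "norm (?f (x' - y) - ?f (x - y)) \<le> ?L * norm ((x' - y) - (x - y))"
  proof (rule differentiable_bound[where S = "cball (x - y) 1" and f' = "\<lambda>z. frechet_derivative ?f (at z)"])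
    fix z assume z: "z \<in> cball (x - y) 1"
    show "(?f has_derivative frechet_derivative ?f (at z)) (at z within cball (x - y) 1)"
      using smooth_has_derivative[OF schwartz_smooth[OF iter_deriv_schwartz[OF k vs(1)]]] has_derivative_at_withinI by blast
    have nz: "norm (z + y) \<le> 1 + norm x"
      using z norm_triangle_ineq4[of x "x - y - z"] by (simp add: dist_norm algebra_simps)
    show "onorm (frechet_derivative ?f (at z)) \<le> ?L"
    proof (rule onorm_bound)
      show "0 \<le> ?L" using B0 by simp
      show "norm (frechet_derivative ?f (at z) h) \<le> ?L * norm h" for h
        using schwartz_deriv_bound_shift[where k = ?f and z = z, OF B[OF vs] B0, of y "1 + norm x" h] nz by blast
    qed
  qed (use x' in \<open>auto simp: dist_norm norm_minus_commute\<close>)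
  then show ?thesis using p by (simp add: field_simps)
qed

lemma iter_deriv_translate_bound:
  fixes k :: "'a::euclidean_space \<Rightarrow> complex"
  assumes "(1 + norm (x - y)) ^ N * norm (k (x - y)) \<le> B"
  shows "(1 + norm y) ^ N * norm (k (x - y)) \<le> B * (1 + norm x) ^ N"
proof -
  have "(1 + norm y) ^ N * norm (k (x - y)) \<le> ((1 + norm x) * (1 + norm (x - y))) ^ N * norm (k (x - y))"
    using one_plus_norm_diff_le[of x "x - y"] by (intro mult_right_mono power_mono) auto
  also have "\<dots> = (1 + norm x) ^ N * ((1 + norm (x - y)) ^ N * norm (k (x - y)))"
    by (simp add: power_mult_distrib)
  also have "\<dots> \<le> (1 + norm x) ^ N * B"
    by (intro mult_left_mono assms) auto
  finally show ?thesis by (simp add: mult.commute)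
qed

text \<open>T is bounded by a single Schwartz norm, and its order \<open>N\<close> becomes the
  degree of growth of the function \<open>x \<mapsto> T (\<lambda>y. k (x - y))\<close>.\<close>

lemma tempered_translate_bound:
  fixes k :: "'a::euclidean_space \<Rightarrow> complex"
  assumes T: "T \<in> tempered_distributions" and k: "k \<in> schwartz"
  shows "\<exists>A N. A \<ge> 0 \<and> (\<forall>x. norm (T (\<lambda>y. k (x - y))) \<le> A * (1 + norm x) ^ N) \<and>
     (\<forall>x x'. norm (x' - x) \<le> 1 \<longrightarrow>
        norm (T (\<lambda>y. k (x' - y)) - T (\<lambda>y. k (x - y))) \<le> A * (2 + norm x) ^ N * norm (x' - x))"
proof -
  obtain C N where C0: "C \<ge> 0" and C: "\<And>f B. f \<in> schwartz \<Longrightarrow>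
      (\<And>vs x. set vs \<subseteq> Basis \<Longrightarrow> length vs \<le> N \<Longrightarrow> (1 + norm x) ^ N * norm (iter_deriv vs f x) \<le> B) \<Longrightarrow>
      norm (T f) \<le> C * B" using tempered_boundE[OF T] by metis
  obtain K where K0: "K \<ge> 0" and K: "\<And>vs x. set vs \<subseteq> Basis \<Longrightarrow> length vs \<le> N \<Longrightarrow> (1 + norm x) ^ N * norm (iter_deriv vs k x) \<le> K"
    using schwartz_boundE[OF k] by metis
  obtain B where B0: "0 \<le> B" and B: "\<And>vs z h. set vs \<subseteq> Basis \<Longrightarrow> length vs \<le> N \<Longrightarrow>
      (1 + norm z) ^ N * norm (frechet_derivative (iter_deriv vs k) (at z) h) \<le> B * norm h"
    using schwartz_deriv_bound_finite[OF k, of N] by blast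
  have 1: "norm (T (\<lambda>y. k (x - y))) \<le> C * K * (1 + norm x) ^ N" for x
  proof -
    have "norm (T (\<lambda>y. k (x - y))) \<le> C * (K * (1 + norm x) ^ N)"
    proof (rule C[OF schwartz_reflect[OF k]])
      fix vs :: "'a list" and y assume vs: "set vs \<subseteq> Basis" "length vs \<le> N"
      have "(1 + norm y) ^ N * norm (iter_deriv vs k (x - y)) \<le> K * (1 + norm x) ^ N"
        by (rule iter_deriv_translate_bound, rule K[OF vs])
      then show "(1 + norm y) ^ N * norm (iter_deriv vs (\<lambda>y. k (x - y)) y) \<le> K * (1 + norm x) ^ N"
        by (simp add: iter_deriv_reflect[OF schwartz_smooth[OF k] vs(1)])
    qed
    then show ?thesis by (simp add: mult.assoc)
  qed
  have 2: "norm (T (\<lambda>y. k (x' - y)) - T (\<lambda>y. k (x - y))) \<le> C * B * (2 + norm x) ^ N * norm (x' - x)"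
    if x': "norm (x' - x) \<le> 1" for x x'
  proof -
    have "norm (T (\<lambda>y. k (x' - y) + (-1) * k (x - y))) \<le> C * (B * (2 + norm x) ^ N * norm (x' - x))"
    proof (rule C[OF schwartz_add_scaled[OF schwartz_reflect[OF k] schwartz_reflect[OF k]]])
      fix vs :: "'a list" and y assume vs: "set vs \<subseteq> Basis" "length vs \<le> N"
      have "iter_deriv vs (\<lambda>y. k (x' - y) + (-1) * k (x - y)) y = (-1) ^ length vs * (iter_deriv vs k (x' - y) - iter_deriv vs k (x - y))"
        by (subst iter_deriv_add_scaled[OF _ _ vs(1)])
           (simp_all add: iter_deriv_reflect[OF schwartz_smooth[OF k] vs(1)] schwartz_smooth schwartz_reflect k scaleR_conv_of_real algebra_simps)
      then show "(1 + norm y) ^ N * norm (iter_deriv vs (\<lambda>y. k (x' - y) + (-1) * k (x - y)) y) \<le> B * (2 + norm x) ^ N * norm (x' - x)"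
        using iter_deriv_translate_lipschitz[OF k B0 B vs x', of y] by (simp add: norm_mult norm_power)
    qed
    moreover have "T (\<lambda>y. k (x' - y) + (-1) * k (x - y)) = T (\<lambda>y. k (x' - y)) - T (\<lambda>y. k (x - y))"
      by (subst tempered_add_scaled[OF T]) (auto simp: schwartz_reflect k)
    ultimately show ?thesis by (simp add: mult.assoc)
  qed
  have "C * K * (1 + norm x) ^ N \<le> C * (K + B) * (1 + norm x) ^ N"
    and "C * B * (2 + norm x) ^ N * norm (x' - x) \<le> C * (K + B) * (2 + norm x) ^ N * norm (x' - x)" for x x' :: 'a
    using C0 K0 B0 by (intro mult_right_mono mult_left_mono; simp)+
  then show ?thesis using 1 2 C0 K0 B0
    by (intro exI[of _ "C * (K + B)"] exI[of _ N]) (meson add_nonneg_nonneg mult_nonneg_nonneg order_trans)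
qed

lemma tempered_translate_continuous:
  fixes k :: "'a::euclidean_space \<Rightarrow> complex"
  assumes T: "T \<in> tempered_distributions" and k: "k \<in> schwartz"
  shows "continuous_on UNIV (\<lambda>x. T (\<lambda>y. k (x - y)))"
proof -
  obtain A N where A0: "0 \<le> A" and A: "\<And>x x'. norm (x' - x) \<le> 1 \<Longrightarrow>
        norm (T (\<lambda>y. k (x' - y)) - T (\<lambda>y. k (x - y))) \<le> A * (2 + norm x) ^ N * norm (x' - x)"
    using tempered_translate_bound[OF T k] by blast
  have "((\<lambda>x'. T (\<lambda>y. k (x' - y))) \<longlongrightarrow> T (\<lambda>y. k (x - y))) (at x)" for x
  proof (rule LIM_zero_cancel, rule Lim_null_comparison)
    show "\<forall>\<^sub>F x' in at x. norm (T (\<lambda>y. k (x' - y)) - T (\<lambda>y. k (x - y))) \<le> A * (2 + norm x) ^ N * norm (x' - x)"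
      unfolding eventually_at by (rule exI[of _ 1]) (auto simp: dist_norm intro: A)
    show "((\<lambda>x'. A * (2 + norm x) ^ N * norm (x' - x)) \<longlongrightarrow> 0) (at x)"
      by (auto intro!: tendsto_eq_intros)
  qed
  then show ?thesis by (simp add: continuous_on_eq_continuous_at isCont_def)
qed

lemma rapid_restrict:
  fixes w :: "'a::euclidean_space \<Rightarrow> complex"
  assumes "rapid w" "E \<in> sets borel" shows "rapid (\<lambda>x. indicator E x * w x)"
  unfolding rapid_def
proof (intro conjI allI)
  show "(\<lambda>x. indicator E x * w x) \<in> borel_measurable borel" using assms by (auto simp: rapid_def)
  fix N
  obtain A where A: "\<And>y. (1 + norm y) ^ N * norm (w y) \<le> A" using assms unfolding rapid_def by meson
  have "0 \<le> (1 + norm (0::'a)) ^ N * norm (w 0)" by simp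
  then have "0 \<le> A" using A[of 0] by linarith
  then show "\<exists>A. \<forall>y. (1 + norm y) ^ N * norm (indicator E y * w y) \<le> A"
    using A by (intro exI[of _ A]) (auto simp: indicator_def)
qed

text \<open>T has no controlled value off the Schwartz space, so an averaged kernel must be shown to
  lie in it before T is applied.\<close>

lemma schwartz_correlation:
  assumes w: "rapid w" and k: "k \<in> schwartz"
  shows "(\<lambda>y. LINT x|lborel. w x * k (x - y)) \<in> schwartz"
  using conv_schwartz[OF w schwartz_reflect[OF k, of 0]] by (simp add: conv_def[abs_def])

text \<open>The difference of the two sides, with the integrals restricted to a set \<open>E\<close>, is additive in \<open>E\<close>
  and of order \<open>\<delta>\<close> times a finite measure of \<open>E\<close> if \<open>E\<close> has diameter \<open>\<delta>\<close>.\<close>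

lemma tempered_integral:
  fixes k w :: "'a::euclidean_space \<Rightarrow> complex"
  assumes T: "T \<in> tempered_distributions" and k: "k \<in> schwartz" and w: "rapid w"
  shows "T (\<lambda>y. LINT x|lborel. w x * k (x - y)) = (LINT x|lborel. w x * T (\<lambda>y. k (x - y)))"
proof -
  obtain C N where C0: "C \<ge> 0" and C: "\<And>f B. f \<in> schwartz \<Longrightarrow>
      (\<And>vs x. set vs \<subseteq> Basis \<Longrightarrow> length vs \<le> N \<Longrightarrow> (1 + norm x) ^ N * norm (iter_deriv vs f x) \<le> B) \<Longrightarrow>
      norm (T f) \<le> C * B" using tempered_boundE[OF T] by metis
  obtain A L where A: "\<And>x. norm (T (\<lambda>y. k (x - y))) \<le> A * (1 + norm x) ^ L"
    using tempered_translate_bound[OF T k] by blast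
  define G where "G = (\<lambda>x. T (\<lambda>y. k (x - y)))"
  have G[measurable]: "G \<in> borel_measurable borel"
    unfolding G_def by (intro borel_measurable_continuous_onI tempered_translate_continuous[OF T k])
  \<comment> \<open>Reflecting \<open>k\<close> turns the integral of \<open>w x * k (x - y)\<close>
    over \<open>x\<close> into \<open>conv w kr y\<close>, so the results on \<open>conv\<close>
    apply.\<close>
  define kr where "kr = (\<lambda>z. k (0 - z))"
  have kr: "kr \<in> schwartz" unfolding kr_def by (rule schwartz_reflect[OF k])
  obtain K where K0: "K \<ge> 0" and K: "\<And>vs x. set vs \<subseteq> Basis \<Longrightarrow> length vs \<le> N \<Longrightarrow> (1 + norm x) ^ N * norm (iter_deriv vs k x) \<le> K"
    using schwartz_boundE[OF k] by metis
  obtain B where B0: "0 \<le> B" and B: "\<And>vs z h. set vs \<subseteq> Basis \<Longrightarrow> length vs \<le> N \<Longrightarrow>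
      (1 + norm z) ^ N * norm (frechet_derivative (iter_deriv vs k) (at z) h) \<le> B * norm h"
    using schwartz_deriv_bound_finite[OF k, of N] by blast
  define v where "v = (\<lambda>E x. indicator E x * w x)"
  have v0: "v E x = 0" if "x \<notin> E" for E x using that by (simp add: v_def)
  have v: "rapid (v E)" if "E \<in> sets borel" for E unfolding v_def by (rule rapid_restrict[OF w that])
  note v_growth = rapid_poly_growth[OF v]
  have wint: "integrable lborel (\<lambda>y. (1 + norm y) ^ n * norm (v E y))" if "E \<in> sets borel" for n E
    by (rule rapid_weight_integrable[OF v[OF that]])
  have vint: "integrable lborel (\<lambda>y. norm (v E y))" "integrable lborel (v E)" if "E \<in> sets borel" for E
    using wint[OF that, of 0] v[OF that] by (auto simp: rapid_def integrable_norm_iff)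
  have vG: "integrable lborel (\<lambda>x. v E x * G x)" if "E \<in> sets borel" for E
  proof (rule Bochner_Integration.integrable_bound)
    show "integrable lborel (\<lambda>x. A * ((1 + norm x) ^ L * norm (v E x)))"
      by (rule integrable_mult_right[OF wint[OF that]])
    show "(\<lambda>x. v E x * G x) \<in> borel_measurable lborel" using v[OF that] by (auto simp: rapid_def)
    have "norm (v E x * G x) \<le> A * ((1 + norm x) ^ L * norm (v E x))" for x
      using mult_left_mono[OF A[of x], of "norm (v E x)"] by (simp add: G_def norm_mult mult_ac)
    then show "AE x in lborel. norm (v E x * G x) \<le> norm (A * ((1 + norm x) ^ L * norm (v E x)))"
      unfolding real_norm_def by (intro AE_I2 order_trans[OF _ abs_ge_self])
  qed
  define \<Delta> where "\<Delta> = (\<lambda>E. T (conv (v E) kr) - (LINT x|lborel. v E x * G x))"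
  have vE: "v (E \<union> F) x = v E x + v F x" if "E \<inter> F = {}" for E F x
    using that by (cases "x \<in> E"; cases "x \<in> F") (auto simp: v_def)
  have add: "\<Delta> (E \<union> F) = \<Delta> E + \<Delta> F" if EF: "E \<in> sets borel" "F \<in> sets borel" "E \<inter> F = {}" for E F
  proof -
    have "conv (v (E \<union> F)) kr = (\<lambda>y. conv (v E) kr y + 1 * conv (v F) kr y)"
      unfolding conv_def vE[OF EF(3)] distrib_right mult_1
      by (intro ext Bochner_Integration.integral_add conv_integrable v_growth EF kr)
    then have "T (conv (v (E \<union> F)) kr) = T (conv (v E) kr) + T (conv (v F) kr)"
      using tempered_add_scaled[OF T conv_schwartz[OF v[OF EF(1)] kr] conv_schwartz[OF v[OF EF(2)] kr], of 1] by simp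
    moreover have "(LINT x|lborel. v (E \<union> F) x * G x) = (LINT x|lborel. v E x * G x) + (LINT x|lborel. v F x * G x)"
      unfolding vE[OF EF(3)] distrib_right by (intro Bochner_Integration.integral_add vG EF)
    ultimately show ?thesis by (simp add: \<Delta>_def)
  qed
  \<comment> \<open>On \<open>E\<close> all translates are compared with the single function
    \<open>c * k (z - y)\<close>. Both terms of \<open>\<Delta> E\<close> are then near
    \<open>c * ?I * G z\<close>, each within \<open>C * ?J\<close>, hence the factor 2. The value
    \<open>c = 1\<close> serves a small set near \<open>z\<close>, and \<open>c = 0\<close> the
    tail.\<close>
  have bound: "norm (\<Delta> E) \<le> 2 * C * (LINT x|lborel. b x * norm (v E x))" (is "_ \<le> 2 * C * ?J")
    if E: "E \<in> sets borel" and int: "integrable lborel (\<lambda>x. b x * norm (v E x))"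
      and b: "\<And>x vs y. x \<in> E \<Longrightarrow> set vs \<subseteq> Basis \<Longrightarrow> length vs \<le> N \<Longrightarrow>
        (1 + norm y) ^ N * norm (iter_deriv vs k (x - y) - c * iter_deriv vs k (z - y)) \<le> b x"
    for E b c z
  proof -
    let ?I = "LINT y|lborel. v E y"
    have s: "conv (v E) kr \<in> schwartz" "\<And>z. (\<lambda>y. k (z - y)) \<in> schwartz"
      by (rule conv_schwartz[OF v[OF E] kr]) (rule schwartz_reflect[OF k])
    have "norm (T (\<lambda>y. conv (v E) kr y + (- (c * ?I)) * k (z - y))) \<le> C * ?J"
    proof (rule C[OF schwartz_add_scaled[OF s]])
      fix vs :: "'a list" and y assume vs: "set vs \<subseteq> Basis" "length vs \<le> N"
      let ?d = "\<lambda>x. iter_deriv vs k (x - y) - c * iter_deriv vs k (z - y)"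
      have krd: "iter_deriv vs kr (y - x) = (-1) ^ length vs * iter_deriv vs k (x - y)" for x
        using iter_deriv_reflect[OF schwartz_smooth[OF k] vs(1), of 0] by (simp add: kr_def scaleR_conv_of_real)
      have ints: "integrable lborel (\<lambda>x. v E x * iter_deriv vs kr (y - x))"
        by (rule conv_integrable[OF v_growth[OF E] iter_deriv_schwartz[OF kr vs(1)]])
      have split: "(-1) ^ length vs * (v E x * ?d x) =
          v E x * iter_deriv vs kr (y - x) - v E x * (c * ((-1) ^ length vs * iter_deriv vs k (z - y)))" for x
        unfolding krd by (simp add: algebra_simps)
      have "iter_deriv vs (\<lambda>y. conv (v E) kr y + (- (c * ?I)) * k (z - y)) y =
          conv (v E) (iter_deriv vs kr) y + (- (c * ?I)) * ((-1) ^ length vs * iter_deriv vs k (z - y))"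
        by (subst iter_deriv_add_scaled[OF schwartz_smooth[OF s(1)] schwartz_smooth[OF s(2)] vs(1)])
           (simp add: iter_deriv_conv[OF v_growth[OF E] kr vs(1)]
             iter_deriv_reflect[OF schwartz_smooth[OF k] vs(1)] scaleR_conv_of_real)
      also have "\<dots> = (LINT x|lborel. (-1) ^ length vs * (v E x * ?d x))"
        unfolding split conv_def using ints vint[OF E] by (subst Bochner_Integration.integral_diff) auto
      finally have "(1 + norm y) ^ N * norm (iter_deriv vs (\<lambda>y. conv (v E) kr y + (- (c * ?I)) * k (z - y)) y) =
         norm (LINT x|lborel. of_real ((1 + norm y) ^ N) * ((-1) ^ length vs * (v E x * ?d x)))"
        by (simp add: norm_mult norm_power del: of_real_power)
      also have "\<dots> \<le> ?J"
      proof (rule Bochner_Integration.integral_norm_bound_integral[OF _ int])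
        show "integrable lborel (\<lambda>x. of_real ((1 + norm y) ^ N) * ((-1) ^ length vs * (v E x * ?d x)))"
          unfolding split using ints vint[OF E]
          by (intro integrable_mult_right Bochner_Integration.integrable_diff integrable_mult_left)
        show "norm (of_real ((1 + norm y) ^ N) * ((-1) ^ length vs * (v E x * ?d x))) \<le> b x * norm (v E x)" for x
          using mult_right_mono[OF b[OF _ vs, of x y], of "norm (v E x)"]
          by (cases "x \<in> E") (simp_all add: v0 norm_mult norm_power mult_ac del: of_real_power)
      qed
      finally show "(1 + norm y) ^ N * norm (iter_deriv vs (\<lambda>y. conv (v E) kr y + (- (c * ?I)) * k (z - y)) y) \<le> ?J" .
    qed
    moreover have "T (\<lambda>y. conv (v E) kr y + (- (c * ?I)) * k (z - y)) = T (conv (v E) kr) - c * ?I * G z"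
      using tempered_add_scaled[OF T s(1) s(2), of "- (c * ?I)" z] by (simp add: G_def)
    ultimately have 1: "norm (T (conv (v E) kr) - c * ?I * G z) \<le> C * ?J" by simp
    have Gb: "norm (G x - c * G z) \<le> C * b x" if "x \<in> E" for x
    proof -
      have "norm (T (\<lambda>y. k (x - y) + (- c) * k (z - y))) \<le> C * b x"
      proof (rule C[OF schwartz_add_scaled[OF s(2) s(2)]])
        fix vs :: "'a list" and y assume vs: "set vs \<subseteq> Basis" "length vs \<le> N"
        have "iter_deriv vs (\<lambda>y. k (x - y) + (- c) * k (z - y)) y = (-1) ^ length vs * (iter_deriv vs k (x - y) - c * iter_deriv vs k (z - y))"
          by (subst iter_deriv_add_scaled[OF schwartz_smooth[OF s(2)] schwartz_smooth[OF s(2)] vs(1)])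
             (simp add: iter_deriv_reflect[OF schwartz_smooth[OF k] vs(1)] scaleR_conv_of_real algebra_simps)
        then show "(1 + norm y) ^ N * norm (iter_deriv vs (\<lambda>y. k (x - y) + (- c) * k (z - y)) y) \<le> b x"
          using b[OF that vs, of y] by (simp add: norm_mult norm_power)
      qed
      then show ?thesis using tempered_add_scaled[OF T s(2) s(2), of x "- c" z] by (simp add: G_def)
    qed
    have pt: "norm (v E x * (c * G z) - v E x * G x) \<le> C * (b x * norm (v E x))" for x
    proof (cases "x \<in> E")
      case True
      have "v E x * (c * G z) - v E x * G x = - (v E x * (G x - c * G z))" by (simp add: algebra_simps)
      then have "norm (v E x * (c * G z) - v E x * G x) = norm (v E x) * norm (G x - c * G z)"
        by (simp only: norm_minus_cancel norm_mult)
      also have "\<dots> \<le> norm (v E x) * (C * b x)" by (intro mult_left_mono Gb True) simp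
      finally show ?thesis by (simp add: mult_ac)
    qed (simp add: v0)
    have "c * ?I * G z - (LINT x|lborel. v E x * G x) = (LINT x|lborel. v E x * (c * G z) - v E x * G x)"
      using vint[OF E] vG[OF E] by (subst Bochner_Integration.integral_diff) (auto simp: mult_ac)
    also have "norm \<dots> \<le> (LINT x|lborel. C * (b x * norm (v E x)))"
      using vint[OF E] vG[OF E] int pt by (intro Bochner_Integration.integral_norm_bound_integral) auto
    finally have 2: "norm (c * ?I * G z - (LINT x|lborel. v E x * G x)) \<le> C * ?J" by simp
    show ?thesis
      unfolding \<Delta>_def
      using norm_triangle_ineq[of "T (conv (v E) kr) - c * ?I * G z" "c * ?I * G z - (LINT x|lborel. v E x * G x)"] 1 2 by simp
  qed
  \<comment> \<open>One ball is removed at a time, so the pieces are disjoint and their masses add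
    up to that of \<open>E\<close>. The estimate therefore does not depend on the number of
    balls.\<close>
  have cover: "norm (\<Delta> E) \<le> D * \<delta> * (LINT y|lborel. norm (v E y))"
    if "finite Z" "\<And>z. z \<in> Z \<Longrightarrow> norm z \<le> R" "E \<in> sets borel" "E \<subseteq> (\<Union>z\<in>Z. ball z \<delta>)"
      and \<delta>: "\<delta> \<le> 1" and D: "D = 2 * C * (B * (2 + R) ^ N)" for Z R E \<delta> D
    using that(1-4)
  proof (induction Z arbitrary: E rule: finite_induct)
    case empty
    then show ?case using bound[of "{}" "\<lambda>x. 0"] by (simp add: v0)
  next
    case (insert z Z)
    let ?F = "E \<inter> ball z \<delta>" and ?H = "E - ball z \<delta>"
    have m: "?F \<in> sets borel" "?H \<in> sets borel" "?F \<inter> ?H = {}" using insert by auto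
    have zR: "norm z \<le> R" using insert by auto
    have "norm (\<Delta> ?H) \<le> D * \<delta> * (LINT y|lborel. norm (v ?H y))"
      using insert by (intro insert.IH) auto
    moreover have "norm (\<Delta> ?F) \<le> 2 * C * (LINT x|lborel. B * (2 + R) ^ N * \<delta> * norm (v ?F x))"
    proof (rule bound[OF m(1), where c = 1 and z = z])
      show "integrable lborel (\<lambda>x. B * (2 + R) ^ N * \<delta> * norm (v ?F x))"
        by (rule integrable_mult_right[OF vint(1)[OF m(1)]])
      fix x y and vs :: "'a list" assume x: "x \<in> ?F" and vs: "set vs \<subseteq> Basis" "length vs \<le> N"
      then have n: "norm (x - z) \<le> \<delta>" by (simp add: dist_norm norm_minus_commute)
      have "(1 + norm y) ^ N * norm (iter_deriv vs k (x - y) - iter_deriv vs k (z - y)) \<le> B * (2 + norm z) ^ N * norm (x - z)"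
        using n \<delta> by (intro iter_deriv_translate_lipschitz[OF k B0 B vs]) auto
      also have "\<dots> \<le> B * (2 + R) ^ N * \<delta>"
        using n zR B0 order_trans[OF norm_ge_zero zR] by (intro mult_mono power_mono mult_nonneg_nonneg zero_le_power) auto
      finally show "(1 + norm y) ^ N * norm (iter_deriv vs k (x - y) - 1 * iter_deriv vs k (z - y)) \<le> B * (2 + R) ^ N * \<delta>"
        by simp
    qed
    then have "norm (\<Delta> ?F) \<le> D * \<delta> * (LINT y|lborel. norm (v ?F y))" by (simp add: D mult_ac)
    moreover have "\<Delta> E = \<Delta> ?F + \<Delta> ?H"
      using add[OF m] by (simp only: Int_Diff_Un)
    moreover have "norm (v E y) = norm (v ?F y) + norm (v ?H y)" for y by (simp add: v_def indicator_def)
    then have "(LINT y|lborel. norm (v E y)) = (LINT y|lborel. norm (v ?F y)) + (LINT y|lborel. norm (v ?H y))"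
      using vint m by simp
    ultimately show ?case
      using norm_triangle_ineq[of "\<Delta> ?F" "\<Delta> ?H"] by (simp only: distrib_left)
  qed
  have "norm (\<Delta> UNIV) \<le> e" if e: "0 < e" for e
  proof -
    define J where "J = (LINT y|lborel. K * ((1 + norm y) ^ (N + 1) * norm (v UNIV y)))"
    have J0: "0 \<le> J" unfolding J_def using K0 by (intro integral_nonneg_AE) auto
    \<comment> \<open>Chosen so that \<open>2 * C * J = R * (e / 2)\<close>. The spare weight in
      \<open>J\<close> bounds the tail by this divided by \<open>1 + R\<close>, which is less than
      \<open>e / 2\<close>.\<close>
    define R where "R = 2 * (2 * C * J) / e"
    have R0: "0 \<le> R" using e C0 J0 by (simp add: R_def)
    let ?S = "- cball (0::'a) R"
    have "norm (\<Delta> ?S) \<le> 2 * C * (LINT x|lborel. (K * (1 + norm x) ^ N) * norm (v ?S x))"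
    proof (rule bound[where c = 0])
      show "integrable lborel (\<lambda>x. (K * (1 + norm x) ^ N) * norm (v ?S x))"
        using integrable_mult_right[OF wint[of ?S N], of K] by (simp add: mult.assoc)
      show "(1 + norm y) ^ N * norm (iter_deriv vs k (x - y) - 0 * iter_deriv vs k (0 - y)) \<le> K * (1 + norm x) ^ N"
        if "set vs \<subseteq> Basis" "length vs \<le> N" for x y and vs :: "'a list"
        using iter_deriv_translate_bound[where k = "iter_deriv vs k", OF K[OF that, of "x - y"]] by simp
    qed simp
    also have "(LINT x|lborel. (K * (1 + norm x) ^ N) * norm (v ?S x)) \<le> (LINT y|lborel. (1 / (1 + R)) * (K * ((1 + norm y) ^ (N + 1) * norm (v UNIV y))))"
    proof (rule integral_mono)
      show "integrable lborel (\<lambda>x. (K * (1 + norm x) ^ N) * norm (v ?S x))"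
        using integrable_mult_right[OF wint[of ?S N], of K] by (simp add: mult.assoc)
      show "integrable lborel (\<lambda>y. (1 / (1 + R)) * (K * ((1 + norm y) ^ (N + 1) * norm (v UNIV y))))"
        by (intro integrable_mult_right wint) simp
      show "(K * (1 + norm y) ^ N) * norm (v ?S y) \<le> (1 / (1 + R)) * (K * ((1 + norm y) ^ (N + 1) * norm (v UNIV y)))" for y
      proof (cases "norm y \<le> R")
        case True
        then show ?thesis using R0 K0 by (simp add: v_def)
      next
        case False
        have "(1 + R) * (K * (1 + norm y) ^ N * norm (w y)) \<le> (1 + norm y) * (K * (1 + norm y) ^ N * norm (w y))"
          using False K0 by (intro mult_right_mono) auto
        then show ?thesis using False R0 by (simp add: v_def field_simps)
      qed
    qed
    then have "2 * C * (LINT x|lborel. (K * (1 + norm x) ^ N) * norm (v ?S x)) \<le> 2 * C * (1 / (1 + R) * J)"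
      using C0 by (intro mult_left_mono) (auto simp: J_def)
    also have "\<dots> = (2 * C * J) / (1 + R)" by simp
    also have "2 * C * J = R * (e / 2)" using e by (simp add: R_def)
    also have "R * (e / 2) / (1 + R) = (R / (1 + R)) * (e / 2)" by simp
    also have "\<dots> \<le> 1 * (e / 2)" using R0 e by (intro mult_right_mono) auto
    finally have tail: "norm (\<Delta> ?S) \<le> e / 2" by simp
    define D where "D = 2 * C * (B * (2 + R) ^ N)"
    define Q where "Q = D * (LINT y|lborel. norm (v (cball 0 R) y))"
    have Q0: "0 \<le> Q" using C0 B0 R0 by (auto simp: Q_def D_def intro!: mult_nonneg_nonneg integral_nonneg_AE)
    \<comment> \<open>Makes \<open>\<delta> * Q\<close> at most \<open>e / 2\<close>; the summand 1
      in \<open>1 + Q\<close> allows \<open>Q = 0\<close>.\<close>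
    define \<delta> where "\<delta> = min 1 (e / (2 * (1 + Q)))"
    have \<delta>: "0 < \<delta>" "\<delta> \<le> 1" using e Q0 by (auto simp: \<delta>_def)
    have "compact (cball (0::'a) R)" "\<And>z. z \<in> cball (0::'a) R \<Longrightarrow> open (ball z \<delta>)" "cball (0::'a) R \<subseteq> (\<Union>z\<in>cball 0 R. ball z \<delta>)"
      using \<delta> by auto
    then obtain Z where Z: "Z \<subseteq> cball (0::'a) R" "finite Z" "cball 0 R \<subseteq> (\<Union>z\<in>Z. ball z \<delta>)"
      by (rule compactE_image) blast
    have "norm (\<Delta> (cball 0 R)) \<le> D * \<delta> * (LINT y|lborel. norm (v (cball 0 R) y))"
      by (rule cover[OF Z(2) _ _ Z(3) \<delta>(2) D_def]) (use Z in auto)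
    also have "\<dots> = \<delta> * Q" by (simp add: Q_def)
    also have "\<dots> \<le> (e / (2 * (1 + Q))) * (1 + Q)" using \<delta> Q0 by (intro mult_mono) (auto simp: \<delta>_def)
    also have "\<dots> = e / 2"
    proof -
      have "(e / (2 * u)) * u = e / 2" if "0 < u" for u :: real using that by simp
      then show ?thesis using Q0 by (metis add_pos_nonneg zero_less_one)
    qed
    finally have "norm (\<Delta> (cball 0 R)) \<le> e / 2" .
    moreover have "\<Delta> UNIV = \<Delta> (cball 0 R) + \<Delta> ?S" using add[of "cball 0 R" ?S] by simp
    ultimately show ?thesis using tail norm_triangle_ineq[of "\<Delta> (cball 0 R)" "\<Delta> ?S"] by simp
  qed
  then have "norm (\<Delta> UNIV) \<le> 0" by (rule field_le_epsilon[where y = 0, simplified])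
  then show ?thesis by (simp add: \<Delta>_def v_def conv_def[abs_def] kr_def G_def)
qed

section \<open>Fourier inversion for test functions\<close>

text \<open>The oscillating factor has modulus 1, so the absolute integral factors. Every exchange
  of integrals in the Fourier calculus below has this shape.\<close>

lemma fubini_iexp:
  fixes f g :: "'a::euclidean_space \<Rightarrow> complex" and h :: "'a \<Rightarrow> 'a \<Rightarrow> real"
  assumes f: "integrable lborel f" and g: "integrable lborel g"
    and h[measurable]: "case_prod h \<in> borel_measurable (borel \<Otimes>\<^sub>M borel)"
  shows "(LINT x|lborel. LINT y|lborel. iexp (h x y) * (f x * g y)) = (LINT y|lborel. LINT x|lborel. iexp (h x y) * (f x * g y))"
proof (rule lborel_pair.Fubini_integral[symmetric], rule lborel_pair.Fubini_integrable)
  have [measurable]: "f \<in> borel_measurable borel" "g \<in> borel_measurable borel" using f g by auto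
  show "(\<lambda>(x, y). iexp (h x y) * (f x * g y)) \<in> borel_measurable (lborel \<Otimes>\<^sub>M lborel)"
    by measurable
  have "(LINT y|lborel. norm (iexp (h x y) * (f x * g y))) = norm (f x) * (LINT y|lborel. norm (g y))" for x
    by (simp add: norm_mult)
  then show "integrable lborel (\<lambda>x. LINT y|lborel. norm (case (x, y) of (x, y) \<Rightarrow> iexp (h x y) * (f x * g y)))"
    using f by simp
  show "AE x in lborel. integrable lborel (\<lambda>y. case (x, y) of (x, y) \<Rightarrow> iexp (h x y) * (f x * g y))"
  proof (rule AE_I2)
    fix x
    have "integrable lborel (\<lambda>y. iexp (h x y) * (f x * g y))"
    proof (rule Bochner_Integration.integrable_bound)
      show "integrable lborel (\<lambda>y. f x * g y)" using g by simp
    qed (auto simp: norm_mult)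
    then show "integrable lborel (\<lambda>y. case (x, y) of (x, y) \<Rightarrow> iexp (h x y) * (f x * g y))" by simp
  qed
qed

section \<open>Fourier transform of the Gaussian\<close>

lemma lborel_prod_basis:
  fixes f :: "'a::euclidean_space \<Rightarrow> real \<Rightarrow> complex"
  assumes f: "\<And>b. b \<in> Basis \<Longrightarrow> integrable lborel (f b)"
  shows "integrable lborel (\<lambda>x::'a. \<Prod>b\<in>Basis. f b (x \<bullet> b))"
    and "(LINT x|lborel. (\<Prod>b\<in>Basis. f b (x \<bullet> b))) = (\<Prod>b\<in>Basis. LINT x|lborel. f b x)"
proof -
  interpret product_sigma_finite "\<lambda>_::'a. lborel :: real measure" ..
  have m: "(\<lambda>x::'a. \<Prod>b\<in>Basis. f b (x \<bullet> b)) \<in> borel_measurable borel"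
  proof (rule borel_measurable_prod)
    fix b :: 'a assume "b \<in> Basis"
    then have [measurable]: "f b \<in> borel_measurable borel" using f by auto
    show "(\<lambda>x. f b (x \<bullet> b)) \<in> borel_measurable borel" by measurable
  qed
  have s: "(\<lambda>g. \<Sum>b\<in>Basis. g b *\<^sub>R b) \<in> (\<Pi>\<^sub>M b\<in>(Basis::'a set). (lborel :: real measure)) \<rightarrow>\<^sub>M (borel :: 'a measure)"
    by measurable
  have e: "(\<Prod>b\<in>Basis. f b ((\<Sum>b\<in>Basis. g b *\<^sub>R b) \<bullet> b)) = (\<Prod>b\<in>Basis. f b (g b))" for g
    by (intro prod.cong refl) simp
  show "integrable lborel (\<lambda>x::'a. \<Prod>b\<in>Basis. f b (x \<bullet> b))"
    by (subst lborel_eq, subst integrable_distr_eq[OF s m], unfold e) (intro product_integrable_prod finite_Basis f)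
  show "(LINT x|lborel. (\<Prod>b\<in>Basis. f b (x \<bullet> b))) = (\<Prod>b\<in>Basis. LINT x|lborel. f b x)"
    by (subst lborel_eq, subst integral_distr[OF s m], unfold e) (intro product_integral_prod finite_Basis f)
qed

text \<open>The characteristic function of the standard normal law, with the density written
  out.\<close>

lemma gauss_iexp_real:
  fixes s :: real
  shows "integrable lborel (\<lambda>x::real. complex_of_real (exp (- (x\<^sup>2) / 2)) * iexp (x * s))"
    and "(LINT x|lborel. complex_of_real (exp (- (x\<^sup>2) / 2)) * iexp (x * s)) = complex_of_real (sqrt (2 * pi) * exp (- (s\<^sup>2) / 2))"
proof -
  have "integrable lborel (\<lambda>x. sqrt (2 * pi) * std_normal_density x)"
    by (intro integrable_mult_right integrable_normal_density) simp
  then have i: "integrable lborel (\<lambda>x::real. exp (- (x\<^sup>2) / 2))"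
    by (simp add: std_normal_density_def)
  show "integrable lborel (\<lambda>x::real. complex_of_real (exp (- (x\<^sup>2) / 2)) * iexp (x * s))"
  proof (rule Bochner_Integration.integrable_bound[OF i])
    show "(\<lambda>x::real. complex_of_real (exp (- (x\<^sup>2) / 2)) * iexp (x * s)) \<in> borel_measurable lborel" by measurable
  qed (auto simp: norm_mult)
  have "complex_of_real (exp (- (s\<^sup>2) / 2)) = (LINT x|std_normal_distribution. iexp (s * x))"
    using char_std_normal_distribution by (simp add: char_def fun_eq_iff)
  also have "\<dots> = (LINT x|lborel. std_normal_density x *\<^sub>R iexp (s * x))"
    by (rule integral_density) auto
  also have "\<dots> = (LINT x|lborel. complex_of_real (1 / sqrt (2 * pi)) * (complex_of_real (exp (- (x\<^sup>2) / 2)) * iexp (x * s)))"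
    by (simp add: std_normal_density_def scaleR_conv_of_real mult_ac)
  also have "\<dots> = complex_of_real (1 / sqrt (2 * pi)) * (LINT x|lborel. (complex_of_real (exp (- (x\<^sup>2) / 2)) * iexp (x * s)))"
    by (rule integral_mult_right_zero)
  finally have *: "complex_of_real (exp (- (s\<^sup>2) / 2)) = \<dots>" .
  have "complex_of_real (sqrt (2 * pi) * exp (- (s\<^sup>2) / 2)) = complex_of_real (sqrt (2 * pi)) * (complex_of_real (1 / sqrt (2 * pi)) * (LINT x|lborel. (complex_of_real (exp (- (x\<^sup>2) / 2)) * iexp (x * s))))"
    unfolding *[symmetric] by simp
  also have "\<dots> = (LINT x|lborel. (complex_of_real (exp (- (x\<^sup>2) / 2)) * iexp (x * s)))"
    by (simp flip: mult.assoc of_real_mult)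
  finally show "(LINT x|lborel. complex_of_real (exp (- (x\<^sup>2) / 2)) * iexp (x * s)) = complex_of_real (sqrt (2 * pi) * exp (- (s\<^sup>2) / 2))" by simp
qed

abbreviation gauss :: "'a::euclidean_space \<Rightarrow> complex" where
  "gauss x \<equiv> complex_of_real (exp (- ((norm x)\<^sup>2) / 2))"

lemma norm_power2_sum: "(norm x)\<^sup>2 = (\<Sum>b\<in>Basis. (x \<bullet> b)\<^sup>2)"
  unfolding power2_norm_eq_inner by (subst euclidean_inner) (simp add: power2_eq_square)

lemma gauss_iexp_prod:
  "gauss x * iexp (x \<bullet> t) = (\<Prod>b\<in>Basis. complex_of_real (exp (- ((x \<bullet> b)\<^sup>2) / 2)) * iexp ((x \<bullet> b) * (t \<bullet> b)))"
proof -
  have "gauss x = complex_of_real (\<Prod>b\<in>Basis. exp (- ((x \<bullet> b)\<^sup>2) / 2))"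
    unfolding norm_power2_sum by (simp add: exp_sum[symmetric] sum_negf sum_divide_distrib)
  moreover have "iexp (x \<bullet> t) = (\<Prod>b\<in>Basis. iexp ((x \<bullet> b) * (t \<bullet> b)))"
    by (subst euclidean_inner) (simp add: exp_sum[symmetric] sum_distrib_left)
  ultimately show ?thesis by (simp add: prod.distrib)
qed

lemma gauss_iexp:
  fixes t :: "'a::euclidean_space"
  shows "integrable lborel (\<lambda>x. gauss x * iexp (x \<bullet> t))"
    and "(LINT x|lborel. gauss x * iexp (x \<bullet> t)) = complex_of_real ((2 * pi) powr (real DIM('a) / 2)) * gauss t"
proof -
  show "integrable lborel (\<lambda>x. gauss x * iexp (x \<bullet> t))"
    unfolding gauss_iexp_prod by (rule lborel_prod_basis) (rule gauss_iexp_real)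
  have "(LINT x|lborel. gauss x * iexp (x \<bullet> t)) = (\<Prod>b\<in>Basis. complex_of_real (sqrt (2 * pi) * exp (- ((t \<bullet> b)\<^sup>2) / 2)))"
    unfolding gauss_iexp_prod
    by (subst lborel_prod_basis) (rule gauss_iexp_real, simp only: gauss_iexp_real)
  also have "\<dots> = complex_of_real (sqrt (2 * pi) ^ DIM('a) * (\<Prod>b\<in>Basis. exp (- ((t \<bullet> b)\<^sup>2) / 2)))"
    by (simp add: prod.distrib)
  also have "(\<Prod>b\<in>Basis. exp (- ((t \<bullet> b)\<^sup>2) / 2)) = exp (- ((norm t)\<^sup>2) / 2)"
    unfolding norm_power2_sum by (simp add: exp_sum[symmetric] sum_negf sum_divide_distrib)
  also have "sqrt (2 * pi) ^ DIM('a) = (2 * pi) powr (real DIM('a) / 2)"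
  proof -
    have "sqrt (2 * pi) ^ DIM('a) = ((2 * pi) powr (1 / 2)) powr real DIM('a)"
      by (subst powr_realpow) (simp_all add: powr_half_sqrt)
    then show ?thesis by (simp add: powr_powr)
  qed
  finally show "(LINT x|lborel. gauss x * iexp (x \<bullet> t)) = complex_of_real ((2 * pi) powr (real DIM('a) / 2)) * gauss t"
    by simp
qed

lemma fourier_iexp: "fourier f \<xi> = fconst TYPE('a) * (LINT x|lborel. iexp (- (x \<bullet> \<xi>)) * f x)" for f :: "'a::euclidean_space \<Rightarrow> complex"
  by (simp add: fourier_def)

text \<open>The double integral does not converge absolutely, so the outer integrand is multiplied
  by a Gaussian of \<open>\<epsilon> *\<^sub>R w\<close>. Fubini then yields the Gaussian mean
  \<open>J \<epsilon>\<close> of \<eta> about \<xi> at scale \<epsilon>. Both sides are evaluated in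
  the limit \<epsilon> to 0.\<close>

lemma fourier_inversion:
  fixes \<eta> :: "'a::euclidean_space \<Rightarrow> complex"
  assumes \<eta>: "\<eta> \<in> bump R"
  shows "fourier (inv_fourier \<eta>) \<xi> = \<eta> \<xi>"
proof -
  define \<kappa> where "\<kappa> = inv_fourier \<eta>"
  have \<kappa>: "\<kappa> \<in> schwartz" unfolding \<kappa>_def by (rule inv_fourier_schwartz[OF \<eta>])
  note [measurable] = schwartz_measurable[OF \<kappa>] bump_measurable[OF \<eta>]
  let ?P = "complex_of_real ((2 * pi) powr (real DIM('a) / 2))"
  define I where "I = (\<lambda>\<epsilon>::real. LINT w|lborel. gauss (\<epsilon> *\<^sub>R w) * (iexp (- (w \<bullet> \<xi>)) * \<kappa> w))"
  have gint: "integrable lborel (gauss :: 'a \<Rightarrow> complex)" using gauss_iexp(1)[of 0] by simp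
  have "(I \<longlongrightarrow> (LINT w|lborel. iexp (- (w \<bullet> \<xi>)) * \<kappa> w)) (at 0)"
    unfolding I_def
  proof (rule tendsto_integral_dominated[where w = "\<lambda>w. norm (\<kappa> w)" and e = 1])
    show "integrable lborel (\<lambda>w. norm (\<kappa> w))" using schwartz_integrable[OF \<kappa>] by simp
    show "((\<lambda>t. gauss (t *\<^sub>R w) * (iexp (- (w \<bullet> \<xi>)) * \<kappa> w)) \<longlongrightarrow> iexp (- (w \<bullet> \<xi>)) * \<kappa> w) (at 0)" for w :: 'a
      by (auto intro!: tendsto_eq_intros)
    show "norm (gauss (t *\<^sub>R w) * (iexp (- (w \<bullet> \<xi>)) * \<kappa> w)) \<le> norm (\<kappa> w)" for t and w :: 'a
      by (simp add: norm_mult mult_left_le_one_le)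
  qed measurable
  moreover have "(I \<longlongrightarrow> fconst TYPE('a) * (?P * (?P * \<eta> \<xi>))) (at 0)"
  proof -
    define J where "J = (\<lambda>\<epsilon>::real. LINT v|lborel. \<eta> (\<xi> + \<epsilon> *\<^sub>R v) * gauss v)"
    obtain B where B: "\<And>x. norm (\<eta> x) \<le> B" using bump_bounded[OF \<eta>] by blast
    have "(J \<longlongrightarrow> (LINT v|lborel. \<eta> \<xi> * gauss (v::'a))) (at 0)" unfolding J_def
    proof (rule tendsto_integral_dominated[where e = 1 and w = "\<lambda>v. B * norm (gauss v)"])
      show "integrable lborel (\<lambda>v::'a. B * norm (gauss v))" using gint by (intro integrable_mult_right integrable_norm)
      show "norm (\<eta> (\<xi> + t *\<^sub>R v) * gauss v) \<le> B * norm (gauss v)" for t and v :: 'a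
        unfolding norm_mult by (intro mult_right_mono B) auto
      have "isCont \<eta> \<xi>"
        using smooth_continuous_on[OF bump_smooth[OF \<eta>], of UNIV] by (simp add: continuous_on_eq_continuous_at)
      moreover have "((\<lambda>t. \<xi> + t *\<^sub>R v) \<longlongrightarrow> \<xi>) (at 0)" for v by (auto intro!: tendsto_eq_intros)
      ultimately have "((\<lambda>t. \<eta> (\<xi> + t *\<^sub>R v)) \<longlongrightarrow> \<eta> \<xi>) (at 0)" for v
        by (rule isCont_tendsto_compose)
      then show "((\<lambda>t. \<eta> (\<xi> + t *\<^sub>R v) * gauss v) \<longlongrightarrow> \<eta> \<xi> * gauss v) (at 0)" for v :: 'a
        by (intro tendsto_mult tendsto_const)
    qed measurable
    also have "(LINT v|lborel. \<eta> \<xi> * gauss (v::'a)) = ?P * \<eta> \<xi>"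
      using gauss_iexp(2)[of "0::'a"] by simp
    finally have lim: "((\<lambda>\<epsilon>. fconst TYPE('a) * (?P * J \<epsilon>)) \<longlongrightarrow> fconst TYPE('a) * (?P * (?P * \<eta> \<xi>))) (at 0)"
      by (intro tendsto_mult tendsto_const)
    have "I \<epsilon> = fconst TYPE('a) * (?P * J \<epsilon>)" if \<epsilon>: "\<epsilon> \<noteq> 0" for \<epsilon>
    proof -
      let ?A = "\<lambda>w::'a. gauss (\<epsilon> *\<^sub>R w)"
      have Aint: "integrable lborel ?A" using integrable_lborel_affine[OF gint \<epsilon>, of 0] by simp
      have "I \<epsilon> = (LINT w|lborel. fconst TYPE('a) * (LINT \<zeta>|lborel. iexp (w \<bullet> (\<zeta> - \<xi>)) * (?A w * \<eta> \<zeta>)))"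
        unfolding I_def
      proof (rule Bochner_Integration.integral_cong[OF refl])
        fix w :: 'a
        have "gauss (\<epsilon> *\<^sub>R w) * (iexp (- (w \<bullet> \<xi>)) * \<kappa> w) = fconst TYPE('a) * ((gauss (\<epsilon> *\<^sub>R w) * iexp (- (w \<bullet> \<xi>))) * (LINT \<zeta>|lborel. iexp (w \<bullet> \<zeta>) * \<eta> \<zeta>))"
          by (simp add: \<kappa>_def inv_fourier_def mult_ac)
        also have "(gauss (\<epsilon> *\<^sub>R w) * iexp (- (w \<bullet> \<xi>))) * (LINT \<zeta>|lborel. iexp (w \<bullet> \<zeta>) * \<eta> \<zeta>) = (LINT \<zeta>|lborel. (gauss (\<epsilon> *\<^sub>R w) * iexp (- (w \<bullet> \<xi>))) * (iexp (w \<bullet> \<zeta>) * \<eta> \<zeta>))"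
          by (rule integral_mult_right_zero[symmetric])
        also have "\<dots> = (LINT \<zeta>|lborel. iexp (w \<bullet> (\<zeta> - \<xi>)) * (?A w * \<eta> \<zeta>))"
        proof (rule Bochner_Integration.integral_cong[OF refl])
          fix \<zeta> :: 'a
          have "iexp (w \<bullet> (\<zeta> - \<xi>)) = iexp (- (w \<bullet> \<xi>)) * iexp (w \<bullet> \<zeta>)"
            unfolding iexp_add[symmetric] by (simp add: inner_diff_right)
          then show "(gauss (\<epsilon> *\<^sub>R w) * iexp (- (w \<bullet> \<xi>))) * (iexp (w \<bullet> \<zeta>) * \<eta> \<zeta>) = iexp (w \<bullet> (\<zeta> - \<xi>)) * (?A w * \<eta> \<zeta>)"
            by (simp only: mult_ac)
        qed
        finally show "gauss (\<epsilon> *\<^sub>R w) * (iexp (- (w \<bullet> \<xi>)) * \<kappa> w) = fconst TYPE('a) * (LINT \<zeta>|lborel. iexp (w \<bullet> (\<zeta> - \<xi>)) * (?A w * \<eta> \<zeta>))" .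
      qed
      also have "\<dots> = fconst TYPE('a) * (LINT w|lborel. LINT \<zeta>|lborel. iexp (w \<bullet> (\<zeta> - \<xi>)) * (?A w * \<eta> \<zeta>))"
        by (rule integral_mult_right_zero)
      also have "(LINT w|lborel. LINT \<zeta>|lborel. iexp (w \<bullet> (\<zeta> - \<xi>)) * (?A w * \<eta> \<zeta>)) = (LINT \<zeta>|lborel. LINT w|lborel. iexp (w \<bullet> (\<zeta> - \<xi>)) * (?A w * \<eta> \<zeta>))"
        by (rule fubini_iexp[OF Aint bump_integrable[OF \<eta>]]) measurable
      also have "\<dots> = (LINT \<zeta>|lborel. \<eta> \<zeta> * (LINT w|lborel. ?A w * iexp (w \<bullet> (\<zeta> - \<xi>))))"
        by (subst integral_mult_right_zero[symmetric]) (simp add: mult_ac)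
      \<comment> \<open>The substitution \<zeta> = \<xi> + \<epsilon> v produces a Jacobian that the
        substitution u = \<epsilon> w in the inner integral uses up again.\<close>
      also have "\<dots> = \<bar>\<epsilon>\<bar> ^ DIM('a) *\<^sub>R (LINT v|lborel. \<eta> (\<xi> + \<epsilon> *\<^sub>R v) * (LINT w|lborel. ?A w * iexp (w \<bullet> (\<xi> + \<epsilon> *\<^sub>R v - \<xi>))))"
        by (rule integral_lborel_affine[OF _ \<epsilon>]) measurable
      also have "\<dots> = (LINT v|lborel. \<eta> (\<xi> + \<epsilon> *\<^sub>R v) * (\<bar>\<epsilon>\<bar> ^ DIM('a) *\<^sub>R (LINT w|lborel. ?A w * iexp (w \<bullet> (\<epsilon> *\<^sub>R v)))))"
        by (simp only: scaleR_conv_of_real add_diff_cancel_left' integral_mult_right_zero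
            mult.left_commute[of "\<eta> _" "complex_of_real (\<bar>\<epsilon>\<bar> ^ DIM('a))"])
      also have "\<dots> = (LINT v|lborel. \<eta> (\<xi> + \<epsilon> *\<^sub>R v) * (LINT u|lborel. gauss u * iexp (u \<bullet> v)))"
      proof (rule Bochner_Integration.integral_cong[OF refl])
        fix v :: 'a
        have "(LINT u|lborel. gauss u * iexp (u \<bullet> v)) = \<bar>\<epsilon>\<bar> ^ DIM('a) *\<^sub>R (LINT w|lborel. gauss (0 + \<epsilon> *\<^sub>R w) * iexp ((0 + \<epsilon> *\<^sub>R w) \<bullet> v))"
          by (rule integral_lborel_affine[OF _ \<epsilon>]) measurable
        then show "\<eta> (\<xi> + \<epsilon> *\<^sub>R v) * (\<bar>\<epsilon>\<bar> ^ DIM('a) *\<^sub>R (LINT w|lborel. ?A w * iexp (w \<bullet> (\<epsilon> *\<^sub>R v)))) = \<eta> (\<xi> + \<epsilon> *\<^sub>R v) * (LINT u|lborel. gauss u * iexp (u \<bullet> v))"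
          by simp
      qed
      also have "\<dots> = ?P * J \<epsilon>"
        unfolding gauss_iexp(2) J_def by (subst integral_mult_right_zero[symmetric]) (simp only: mult_ac)
      finally show ?thesis .
    qed
    then have "\<forall>\<^sub>F \<epsilon> in at 0. fconst TYPE('a) * (?P * J \<epsilon>) = I \<epsilon>"
      unfolding eventually_at by (intro exI[of _ 1]) auto
    then show ?thesis using lim Lim_transform_eventually by blast
  qed
  ultimately have "(LINT w|lborel. iexp (- (w \<bullet> \<xi>)) * \<kappa> w) = fconst TYPE('a) * (?P * (?P * \<eta> \<xi>))"
    using tendsto_unique[OF trivial_limit_at] by blast
  moreover have "fconst TYPE('a) * ?P = 1"
    by (simp flip: of_real_mult powr_add)
  ultimately show ?thesis
    unfolding fourier_iexp \<kappa>_def[symmetric] by (simp add: mult.assoc[symmetric])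
qed

text \<open>After Fubini the inner integral is the forward transform of
  \<open>inv_fourier \<eta>\<close>, which inversion turns back into \<eta>. The constant reflects
  the symmetric normalisation of the transform.\<close>

lemma inv_fourier_mult:
  fixes \<eta> \<theta> :: "'a::euclidean_space \<Rightarrow> complex"
  assumes \<eta>: "\<eta> \<in> bump R" and \<theta>: "\<theta> \<in> bump S"
  shows "inv_fourier (\<lambda>\<xi>. \<eta> \<xi> * \<theta> \<xi>) z = fconst TYPE('a) * conv (inv_fourier \<eta>) (inv_fourier \<theta>) z"
proof -
  let ?\<kappa> = "inv_fourier \<eta>"
  have \<kappa>: "?\<kappa> \<in> schwartz" by (rule inv_fourier_schwartz[OF \<eta>])
  have "conv ?\<kappa> (inv_fourier \<theta>) z = (LINT w|lborel. fconst TYPE('a) * (LINT \<xi>|lborel. iexp ((z - w) \<bullet> \<xi>) * (?\<kappa> w * \<theta> \<xi>)))"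
    unfolding conv_def inv_fourier_def[of \<theta>]
    by (rule Bochner_Integration.integral_cong[OF refl])
       (simp add: mult.left_commute[of _ "inv_fourier \<eta> _"] flip: integral_mult_right_zero)
  also have "\<dots> = fconst TYPE('a) * (LINT w|lborel. LINT \<xi>|lborel. iexp ((z - w) \<bullet> \<xi>) * (?\<kappa> w * \<theta> \<xi>))"
    by (rule integral_mult_right_zero)
  also have "(LINT w|lborel. LINT \<xi>|lborel. iexp ((z - w) \<bullet> \<xi>) * (?\<kappa> w * \<theta> \<xi>)) = (LINT \<xi>|lborel. LINT w|lborel. iexp ((z - w) \<bullet> \<xi>) * (?\<kappa> w * \<theta> \<xi>))"
    by (rule fubini_iexp[OF schwartz_integrable[OF \<kappa>] bump_integrable[OF \<theta>]]) measurable
  also have "\<dots> = (LINT \<xi>|lborel. iexp (z \<bullet> \<xi>) * \<theta> \<xi> * (LINT w|lborel. iexp (- (w \<bullet> \<xi>)) * ?\<kappa> w))"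
  proof (rule Bochner_Integration.integral_cong[OF refl])
    fix \<xi> :: 'a
    have "iexp ((z - w) \<bullet> \<xi>) * (?\<kappa> w * \<theta> \<xi>) = (iexp (z \<bullet> \<xi>) * \<theta> \<xi>) * (iexp (- (w \<bullet> \<xi>)) * ?\<kappa> w)" for w
    proof -
      have "iexp ((z - w) \<bullet> \<xi>) = iexp (z \<bullet> \<xi>) * iexp (- (w \<bullet> \<xi>))"
        unfolding iexp_add[symmetric] by (simp add: inner_diff_left)
      then show ?thesis by (simp only: mult_ac)
    qed
    then show "(LINT w|lborel. iexp ((z - w) \<bullet> \<xi>) * (?\<kappa> w * \<theta> \<xi>)) = iexp (z \<bullet> \<xi>) * \<theta> \<xi> * (LINT w|lborel. iexp (- (w \<bullet> \<xi>)) * ?\<kappa> w)"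
      by (simp only: integral_mult_right_zero)
  qed
  finally have "fconst TYPE('a) * conv ?\<kappa> (inv_fourier \<theta>) z = fconst TYPE('a) * (LINT \<xi>|lborel. fconst TYPE('a) * (iexp (z \<bullet> \<xi>) * \<theta> \<xi> * (LINT w|lborel. iexp (- (w \<bullet> \<xi>)) * ?\<kappa> w)))"
    by (simp only: integral_mult_right_zero)
  also have "\<dots> = fconst TYPE('a) * (LINT \<xi>|lborel. iexp (z \<bullet> \<xi>) * (\<eta> \<xi> * \<theta> \<xi>))"
  proof -
    have eq: "fconst TYPE('a) * (iexp (z \<bullet> \<xi>) * \<theta> \<xi> * (LINT w|lborel. iexp (- (w \<bullet> \<xi>)) * ?\<kappa> w)) = iexp (z \<bullet> \<xi>) * (\<eta> \<xi> * \<theta> \<xi>)" for \<xi> :: 'a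
    proof -
    have "\<eta> \<xi> = fconst TYPE('a) * (LINT w|lborel. iexp (- (w \<bullet> \<xi>)) * ?\<kappa> w)"
      using fourier_inversion[OF \<eta>, of \<xi>] by (simp only: fourier_iexp)
    then show ?thesis by (simp only: mult_ac)
    qed
    show ?thesis by (simp only: eq)
  qed
  finally show ?thesis by (simp only: inv_fourier_def)
qed

section \<open>Frequency-localised pieces of a tempered distribution\<close>

text \<open>The pointwise form of F^(-1)[\<eta> F T]: a multiple of the convolution of T with the
  kernel of \<eta>. \<open>band_representation\<close> shows the agreement.\<close>

definition band :: "('a::euclidean_space \<Rightarrow> complex) \<Rightarrow> (('a \<Rightarrow> complex) \<Rightarrow> complex) \<Rightarrow> 'a \<Rightarrow> complex" where
  "band \<eta> T x = fconst TYPE('a) * T (\<lambda>y. inv_fourier \<eta> (x - y))"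

lemma band_continuous:
  assumes "T \<in> tempered_distributions" "\<eta> \<in> bump R"
  shows "continuous_on UNIV (band \<eta> T)"
  unfolding band_def[abs_def]
  by (intro continuous_on_mult continuous_on_const tempered_translate_continuous[OF assms(1) inv_fourier_schwartz[OF assms(2)]])

lemma band_poly_growth:
  fixes \<eta> :: "'a::euclidean_space \<Rightarrow> complex"
  assumes "T \<in> tempered_distributions" "\<eta> \<in> bump R"
  shows "poly_growth (band \<eta> T)"
proof -
  obtain A N where A: "\<And>x. norm (T (\<lambda>y. inv_fourier \<eta> (x - y))) \<le> A * (1 + norm x) ^ N"
    using tempered_translate_bound[OF assms(1) inv_fourier_schwartz[OF assms(2)]] by blast
  have "norm (band \<eta> T x) \<le> (norm (fconst TYPE('a)) * A) * (1 + norm x) ^ N" for x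
    unfolding band_def norm_mult mult.assoc by (intro mult_left_mono A) auto
  then show ?thesis
    unfolding poly_growth_def using borel_measurable_continuous_onI[OF band_continuous[OF assms]] by blast
qed

text \<open>Here T is pulled through an integral of translates by \<open>tempered_integral\<close>.
  This is what turns one frequency-localised piece into a convolution of another, at the level of
  functions.\<close>

lemma band_mult:
  fixes \<eta> \<theta> :: "'a::euclidean_space \<Rightarrow> complex"
  assumes T: "T \<in> tempered_distributions" and \<eta>: "\<eta> \<in> bump R" and \<theta>: "\<theta> \<in> bump S"
  shows "band (\<lambda>\<xi>. \<eta> \<xi> * \<theta> \<xi>) T x = fconst TYPE('a) * conv (band \<theta> T) (inv_fourier \<eta>) x"
proof -
  let ?k = "inv_fourier \<theta>" and ?m = "inv_fourier \<eta>"
  have k: "?k \<in> schwartz" "?m \<in> schwartz" by (rule inv_fourier_schwartz[OF \<theta>], rule inv_fourier_schwartz[OF \<eta>])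
  note [measurable] = schwartz_measurable[OF k(1)] schwartz_measurable[OF k(2)]
  have r: "rapid (\<lambda>z. ?m (x - z))" by (intro schwartz_rapid schwartz_reflect k)
  have "inv_fourier (\<lambda>\<xi>. \<eta> \<xi> * \<theta> \<xi>) (x - y) = fconst TYPE('a) * (LINT z|lborel. ?m (x - z) * ?k (z - y))" for y
  proof -
    have "conv ?m ?k (x - y) = \<bar>-1\<bar> ^ DIM('a) *\<^sub>R (LINT z|lborel. ?m (x + (-1) *\<^sub>R z) * ?k (x - y - (x + (-1) *\<^sub>R z)))"
      unfolding conv_def by (rule integral_lborel_affine) auto
    then show ?thesis by (simp add: inv_fourier_mult[OF \<eta> \<theta>])
  qed
  then have "band (\<lambda>\<xi>. \<eta> \<xi> * \<theta> \<xi>) T x = fconst TYPE('a) * (fconst TYPE('a) * T (\<lambda>y. LINT z|lborel. ?m (x - z) * ?k (z - y)))"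
    using tempered_cmult[OF T schwartz_correlation[OF r k(1)], of "fconst TYPE('a)"] by (simp only: band_def)
  also have "\<dots> = fconst TYPE('a) * (fconst TYPE('a) * (LINT z|lborel. ?m (x - z) * T (\<lambda>y. ?k (z - y))))"
    by (simp only: tempered_integral[OF T k(1) r])
  also have "\<dots> = fconst TYPE('a) * (LINT z|lborel. fconst TYPE('a) * (?m (x - z) * T (\<lambda>y. ?k (z - y))))"
    by (simp only: integral_mult_right_zero)
  finally show ?thesis by (simp only: conv_def band_def mult_ac)
qed

text \<open>The left side is F^(-1)[\<eta> F T] at \<phi>, defined by duality. Fubini writes its
  argument as an average of translates of the kernel against \<phi>, and T moves inside.\<close>

lemma band_representation:
  fixes \<eta> \<phi> :: "'a::euclidean_space \<Rightarrow> complex"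
  assumes T: "T \<in> tempered_distributions" and \<eta>: "\<eta> \<in> bump R" and \<phi>: "\<phi> \<in> schwartz"
  shows "T (fourier (\<lambda>\<xi>. \<eta> \<xi> * inv_fourier \<phi> \<xi>)) = (LINT x|lborel. band \<eta> T x * \<phi> x)"
proof -
  let ?k = "inv_fourier \<eta>"
  have k: "?k \<in> schwartz" by (rule inv_fourier_schwartz[OF \<eta>])
  have "fourier (\<lambda>\<xi>. \<eta> \<xi> * inv_fourier \<phi> \<xi>) y = fconst TYPE('a) * (LINT x|lborel. \<phi> x * ?k (x - y))" for y
  proof -
    have "(LINT \<xi>|lborel. iexp (- (\<xi> \<bullet> y)) * (\<eta> \<xi> * inv_fourier \<phi> \<xi>)) = (LINT \<xi>|lborel. fconst TYPE('a) * (LINT x|lborel. iexp (\<xi> \<bullet> (x - y)) * (\<eta> \<xi> * \<phi> x)))"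
    proof (rule Bochner_Integration.integral_cong[OF refl])
      fix \<xi> :: 'a
      have "iexp (- (\<xi> \<bullet> y)) * (\<eta> \<xi> * inv_fourier \<phi> \<xi>) = fconst TYPE('a) * ((iexp (- (\<xi> \<bullet> y)) * \<eta> \<xi>) * (LINT x|lborel. iexp (\<xi> \<bullet> x) * \<phi> x))"
        unfolding inv_fourier_def by (simp only: mult_ac)
      also have "\<dots> = fconst TYPE('a) * (LINT x|lborel. (iexp (- (\<xi> \<bullet> y)) * \<eta> \<xi>) * (iexp (\<xi> \<bullet> x) * \<phi> x))"
        by (simp only: integral_mult_right_zero)
      also have "(\<lambda>x. (iexp (- (\<xi> \<bullet> y)) * \<eta> \<xi>) * (iexp (\<xi> \<bullet> x) * \<phi> x)) = (\<lambda>x. iexp (\<xi> \<bullet> (x - y)) * (\<eta> \<xi> * \<phi> x))"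
      proof
        fix x
        have "iexp (\<xi> \<bullet> (x - y)) = iexp (- (\<xi> \<bullet> y)) * iexp (\<xi> \<bullet> x)"
          unfolding iexp_add[symmetric] by (simp add: inner_diff_right)
        then show "(iexp (- (\<xi> \<bullet> y)) * \<eta> \<xi>) * (iexp (\<xi> \<bullet> x) * \<phi> x) = iexp (\<xi> \<bullet> (x - y)) * (\<eta> \<xi> * \<phi> x)"
          by (simp only: mult_ac)
      qed
      finally show "iexp (- (\<xi> \<bullet> y)) * (\<eta> \<xi> * inv_fourier \<phi> \<xi>) = fconst TYPE('a) * (LINT x|lborel. iexp (\<xi> \<bullet> (x - y)) * (\<eta> \<xi> * \<phi> x))" .
    qed
    also have "\<dots> = fconst TYPE('a) * (LINT \<xi>|lborel. LINT x|lborel. iexp (\<xi> \<bullet> (x - y)) * (\<eta> \<xi> * \<phi> x))"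
      by (rule integral_mult_right_zero)
    also have "(LINT \<xi>|lborel. LINT x|lborel. iexp (\<xi> \<bullet> (x - y)) * (\<eta> \<xi> * \<phi> x)) = (LINT x|lborel. LINT \<xi>|lborel. iexp (\<xi> \<bullet> (x - y)) * (\<eta> \<xi> * \<phi> x))"
      by (rule fubini_iexp[OF bump_integrable[OF \<eta>] schwartz_integrable[OF \<phi>]]) measurable
    also have "\<dots> = (LINT x|lborel. \<phi> x * (LINT \<xi>|lborel. iexp ((x - y) \<bullet> \<xi>) * \<eta> \<xi>))"
      by (simp only: inner_commute mult_ac flip: integral_mult_right_zero)
    finally have "fconst TYPE('a) * (LINT \<xi>|lborel. iexp (- (\<xi> \<bullet> y)) * (\<eta> \<xi> * inv_fourier \<phi> \<xi>)) =
       fconst TYPE('a) * (LINT x|lborel. fconst TYPE('a) * (\<phi> x * (LINT \<xi>|lborel. iexp ((x - y) \<bullet> \<xi>) * \<eta> \<xi>)))"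
      by (simp only: integral_mult_right_zero)
    then show ?thesis unfolding fourier_iexp inv_fourier_def[of \<eta>] by (simp only: mult_ac)
  qed
  then have "T (fourier (\<lambda>\<xi>. \<eta> \<xi> * inv_fourier \<phi> \<xi>)) = T (\<lambda>y. fconst TYPE('a) * (LINT x|lborel. \<phi> x * ?k (x - y)))"
    by presburger
  also have "\<dots> = fconst TYPE('a) * T (\<lambda>y. LINT x|lborel. \<phi> x * ?k (x - y))"
    by (rule tempered_cmult[OF T schwartz_correlation[OF schwartz_rapid[OF \<phi>] k]])
  also have "\<dots> = (LINT x|lborel. fconst TYPE('a) * (\<phi> x * T (\<lambda>y. ?k (x - y))))"
    by (simp only: tempered_integral[OF T k schwartz_rapid[OF \<phi>]] integral_mult_right_zero)
  finally show ?thesis unfolding band_def by (simp only: mult_ac)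
qed

lemma band_integrable:
  assumes "T \<in> tempered_distributions" "\<eta> \<in> bump R" "\<phi> \<in> schwartz"
  shows "integrable lborel (\<lambda>x. band \<eta> T x * \<phi> x)"
  using conv_integrable[OF band_poly_growth[OF assms(1,2)] schwartz_reflect[OF assms(3), of 0], of 0] by simp

text \<open>A multiplier \<theta> with \<theta> \<eta> = \<eta> reproduces the function as its own
  convolution with a Schwartz kernel, and convolution with such a kernel is smooth.\<close>

lemma band_smooth:
  assumes T: "T \<in> tempered_distributions" and \<eta>: "\<eta> \<in> bump R" and \<theta>: "\<theta> \<in> bump S"
    and "\<And>\<xi>. \<theta> \<xi> * \<eta> \<xi> = \<eta> \<xi>"
  shows "smooth (band \<eta> T)"
proof -
  have "band \<eta> T = (\<lambda>x. fconst TYPE('a) * conv (band \<eta> T) (inv_fourier \<theta>) x)"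
    using band_mult[OF T \<theta> \<eta>] by (simp add: assms(4) fun_eq_iff)
  then show ?thesis
    using smooth_cmult[OF conv_smooth[OF band_poly_growth[OF T \<eta>] inv_fourier_schwartz[OF \<theta>]]] by metis
qed

lemma band_add_scaled:
  assumes T: "T \<in> tempered_distributions" and \<eta>: "\<eta> \<in> bump R" and \<theta>: "\<theta> \<in> bump S"
  shows "band (\<lambda>\<xi>. \<eta> \<xi> + c * \<theta> \<xi>) T x = band \<eta> T x + c * band \<theta> T x"
  unfolding band_def inv_fourier_add_scaled[OF bump_integrable[OF \<eta>] bump_integrable[OF \<theta>]]
  using tempered_add_scaled[OF T schwartz_reflect[OF inv_fourier_schwartz[OF \<eta>]] schwartz_reflect[OF inv_fourier_schwartz[OF \<theta>]]]
  by (simp add: algebra_simps)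

section \<open>Dyadic cut-offs\<close>

locale cutoff =
  fixes \<phi>\<^sub>0 :: "'a::euclidean_space \<Rightarrow> real" and a b :: real
  assumes ab: "1 \<le> a" "a < b" "b \<le> 2"
    and test: "\<phi>\<^sub>0 \<in> test_functions"
    and nonneg: "\<And>x. 0 \<le> \<phi>\<^sub>0 x"
    and one: "\<And>x. norm x \<le> a \<Longrightarrow> \<phi>\<^sub>0 x = 1"
    and zero: "\<And>x. norm x \<ge> b \<Longrightarrow> \<phi>\<^sub>0 x = 0"
begin

lemma smooth_cutoff: "smooth (\<lambda>x. complex_of_real (\<phi>\<^sub>0 (r *\<^sub>R x + t)))"
  using smooth_affine[OF smooth_of_real, of \<phi>\<^sub>0] test by (simp add: test_functions_def)

lemma scaled_bump:
  assumes "0 < r" shows "(\<lambda>x. complex_of_real (\<phi>\<^sub>0 (r *\<^sub>R x + t))) \<in> bump ((2 + norm t) / r)"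
proof -
  have "\<phi>\<^sub>0 (r *\<^sub>R x + t) = 0" if "(2 + norm t) / r < norm x" for x
  proof (rule zero)
    have "2 + norm t < r * norm x" using that assms by (simp add: field_simps)
    also have "\<dots> = norm (r *\<^sub>R x + t - t)" using assms by simp
    also have "\<dots> \<le> norm (r *\<^sub>R x + t) + norm t" by (rule norm_triangle_ineq4)
    finally show "b \<le> norm (r *\<^sub>R x + t)" using ab by linarith
  qed
  then show ?thesis unfolding bump_def using smooth_cutoff by simp
qed

text \<open>The fundamental lemma of the calculus of variations, tested with dilated translates of
  the cut-off itself. It gives uniqueness in \<open>dist_function\<close>.\<close>

lemma schwartz_separating:
  fixes g :: "'a \<Rightarrow> complex"
  assumes cont: "continuous_on UNIV g"
    and int: "\<And>f. f \<in> schwartz \<Longrightarrow> integrable lborel (\<lambda>x. g x * f x)"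
    and eq: "\<And>f. f \<in> schwartz \<Longrightarrow> (LINT x|lborel. g x * f x) = 0"
  shows "g x0 = 0"
proof (rule ccontr)
  assume nz: "g x0 \<noteq> 0"
  define c where "c = g x0"
  have c: "0 < norm c" using nz by (simp add: c_def)
  have "isCont g x0" using cont by (simp add: continuous_on_eq_continuous_at)
  then obtain d where d: "0 < d" "\<And>x. dist x x0 < d \<Longrightarrow> dist (g x) c < norm c / 2"
    using c unfolding c_def continuous_at_eps_delta by (metis half_gt_zero)
  \<comment> \<open>At this scale \<open>b \<le> 2\<close> makes \<open>f\<close> vanish at distance
    at least \<open>d\<close> from \<open>x0\<close>, and \<open>1 \<le> a\<close> makes it 1 within
    \<open>d / 2\<close>.\<close>
  define r where "r = 2 / d"
  have r: "0 < r" using d by (simp add: r_def)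
  define f where "f = (\<lambda>x. \<phi>\<^sub>0 (r *\<^sub>R x + (- (r *\<^sub>R x0))))"
  have f: "(\<lambda>x. complex_of_real (f x)) \<in> schwartz"
    unfolding f_def by (rule bump_schwartz[OF scaled_bump[OF r]])
  have feq: "f x = \<phi>\<^sub>0 (r *\<^sub>R (x - x0))" for x by (simp add: f_def algebra_simps)
  have f0: "f x = 0" if "\<not> dist x x0 < d" for x
  proof -
    have "2 \<le> r * dist x x0" using that d by (simp add: r_def field_simps)
    then show ?thesis unfolding feq using r ab by (intro zero) (simp add: dist_norm)
  qed
  have f1: "f x = 1" if "dist x x0 < d / 2" for x
  proof -
    have "r * dist x x0 \<le> 1" using that d by (simp add: r_def field_simps)
    then show ?thesis unfolding feq using r ab by (intro one) (simp add: dist_norm)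
  qed
  \<comment> \<open>Multiplication by \<open>cnj c\<close> rotates \<open>g\<close> near
    \<open>x0\<close> towards the positive axis, so that no cancellation is possible where
    \<open>f\<close> is positive.\<close>
  have low: "(norm c)\<^sup>2 / 2 * indicator (ball x0 (d / 2)) x \<le> Re (cnj c * (g x * complex_of_real (f x)))" for x
  proof -
    have e: "Re (cnj c * (g x * complex_of_real (f x))) = Re (cnj c * g x) * f x"
      by (simp add: algebra_simps)
    show ?thesis
    proof (cases "dist x x0 < d")
      case True
      have "norm (cnj c * (g x - c)) \<le> norm c * (norm c / 2)"
        using d(2)[OF True] unfolding norm_mult by (intro mult_mono) (auto simp: dist_norm)
      then have "- Re (cnj c * (g x - c)) \<le> (norm c)\<^sup>2 / 2"
        using abs_Re_le_cmod[of "cnj c * (g x - c)"] by (simp add: power2_eq_square)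
      moreover have "Re (cnj c * g x) = Re (cnj c * (g x - c)) + (norm c)\<^sup>2"
      proof -
        have "cnj c * g x = cnj c * (g x - c) + c * cnj c" by (simp add: algebra_simps)
        then show ?thesis by (simp add: complex_norm_square[symmetric] flip: of_real_power)
      qed
      ultimately have "(norm c)\<^sup>2 / 2 \<le> Re (cnj c * g x)" by linarith
      then have "(norm c)\<^sup>2 / 2 * f x \<le> Re (cnj c * g x) * f x"
        using nonneg by (intro mult_right_mono) (auto simp: f_def)
      moreover have "(norm c)\<^sup>2 / 2 * indicator (ball x0 (d / 2)) x \<le> (norm c)\<^sup>2 / 2 * f x"
        using f1[of x] nonneg by (intro mult_left_mono) (auto simp: indicator_def dist_commute f_def)
      ultimately show ?thesis unfolding e by linarith
    next
      case False
      then show ?thesis using d unfolding e by (simp add: f0 indicator_def dist_commute)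
    qed
  qed
  have int1: "integrable lborel (\<lambda>x. (norm c)\<^sup>2 / 2 * indicator (ball x0 (d / 2)) x)"
    by (intro integrable_mult_right integrable_real_indicator) (use d in \<open>auto simp: emeasure_ball[OF less_imp_le]\<close>)
  have int2: "integrable lborel (\<lambda>x. cnj c * (g x * complex_of_real (f x)))"
    using int[OF f] by (rule integrable_mult_right)
  have "0 < (norm c)\<^sup>2 / 2 * measure lborel (ball x0 (d / 2))"
    using c d by (simp add: content_ball_pos)
  also have "\<dots> = (LINT x|lborel. (norm c)\<^sup>2 / 2 * indicator (ball x0 (d / 2)) x)" by simp
  also have "\<dots> \<le> (LINT x|lborel. Re (cnj c * (g x * complex_of_real (f x))))"
    by (intro integral_mono int1 integrable_Re[OF int2] low)
  also have "\<dots> = Re (LINT x|lborel. cnj c * (g x * complex_of_real (f x)))"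
    using int2 by (rule integral_Re)
  also have "\<dots> = 0" using eq[OF f] by simp
  finally show False by simp
qed

text \<open>Resolves the definite description in \<open>dist_function\<close>: existence comes from
  \<open>band_representation\<close>, with \<theta> supplying smoothness, and uniqueness from
  \<open>schwartz_separating\<close>.\<close>

lemma fourier_multiplier_band:
  fixes \<eta> :: "'a \<Rightarrow> real"
  assumes T: "T \<in> tempered_distributions" and \<eta>: "(\<lambda>x. complex_of_real (\<eta> x)) \<in> bump R"
    and \<theta>: "\<theta> \<in> bump S" "\<And>\<xi>. \<theta> \<xi> * complex_of_real (\<eta> \<xi>) = complex_of_real (\<eta> \<xi>)"
  shows "fourier_multiplier \<eta> T = band (\<lambda>x. complex_of_real (\<eta> x)) T"
  unfolding fourier_multiplier_def dist_function_def
proof (rule the_equality)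
  let ?g = "band (\<lambda>x. complex_of_real (\<eta> x)) T"
  let ?D = "dist_inv_fourier (dist_mult (\<lambda>x. complex_of_real (\<eta> x)) (dist_fourier T))"
  have D: "?D f = (LINT x|lborel. ?g x * f x)" if "f \<in> schwartz" for f
    using band_representation[OF T \<eta> that] by (simp add: dist_inv_fourier_def dist_mult_def dist_fourier_def)
  note int = band_integrable[OF T \<eta>]
  show "smooth ?g \<and> (\<forall>f\<in>schwartz. integrable lborel (\<lambda>x. ?g x * f x) \<and> ?D f = (LINT x|lborel. ?g x * f x))"
    using band_smooth[OF T \<eta> \<theta>] int D by blast
  fix g assume g: "smooth g \<and> (\<forall>f\<in>schwartz. integrable lborel (\<lambda>x. g x * f x) \<and> ?D f = (LINT x|lborel. g x * f x))"
  show "g = ?g"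
  proof
    fix x0
    have "g x0 - ?g x0 = 0"
    proof (rule schwartz_separating[where g = "\<lambda>x. g x - ?g x"])
      show "continuous_on UNIV (\<lambda>x. g x - ?g x)"
        using g by (intro continuous_on_diff smooth_continuous_on band_continuous[OF T \<eta>]) auto
      fix f :: "'a \<Rightarrow> complex" assume f: "f \<in> schwartz"
      then have i: "integrable lborel (\<lambda>x. g x * f x)" "(LINT x|lborel. g x * f x) = (LINT x|lborel. ?g x * f x)"
        using g D by auto
      show "integrable lborel (\<lambda>x. (g x - ?g x) * f x)"
        unfolding left_diff_distrib using i int[OF f] by (intro Bochner_Integration.integrable_diff)
      show "(LINT x|lborel. (g x - ?g x) * f x) = 0"
        unfolding left_diff_distrib using i int[OF f] by (subst Bochner_Integration.integral_diff) auto
    qed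
    then show "g x0 = ?g x0" by simp
  qed
qed

section \<open>The pieces S_j\<close>

definition cut :: "int \<Rightarrow> 'a \<Rightarrow> complex" where
  "cut j x = complex_of_real (\<phi>\<^sub>0 ((2 powi (- j)) *\<^sub>R x))"

lemma cut_bump: "cut j \<in> bump (2 * 2 powi j)"
  using scaled_bump[of "2 powi (- j)" 0] by (simp add: cut_def[abs_def] power_int_minus field_simps)

text \<open>Where \<open>cut i\<close> does not vanish, the point scaled by 2^(-i) has norm below 2.
  One more halving brings it into the ball of radius \<open>a \<ge> 1\<close>, on which the wider
  cut-off is 1.\<close>

lemma cut_mult: 
  assumes "i < j" shows "cut i \<xi> * cut j \<xi> = cut i \<xi>"
proof (cases "\<phi>\<^sub>0 ((2 powi (- i)) *\<^sub>R \<xi>) = 0")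
  case False
  then have "\<not> b \<le> norm ((2 powi (- i)) *\<^sub>R \<xi>)" using zero by blast
  then have n: "2 powi (- i) * norm \<xi> < 2" using ab by simp
  have "2 powi (- j) * norm \<xi> \<le> 2 powi (- i - 1) * norm \<xi>"
    using assms by (intro mult_right_mono power_int_increasing) auto
  also have "\<dots> = (2 powi (- i) * norm \<xi>) / 2" by (simp add: power_int_diff)
  also have "\<dots> \<le> a" using n ab by linarith
  finally have "\<phi>\<^sub>0 ((2 powi (- j)) *\<^sub>R \<xi>) = 1" by (intro one) simp
  then show ?thesis by (simp add: cut_def)
qed (simp add: cut_def)

definition low :: "int \<Rightarrow> (('a \<Rightarrow> complex) \<Rightarrow> complex) \<Rightarrow> 'a \<Rightarrow> complex" where
  "low j = band (cut j)"

abbreviation lowp :: "real \<Rightarrow> int \<Rightarrow> (('a \<Rightarrow> complex) \<Rightarrow> complex) \<Rightarrow> 'a \<Rightarrow> ennreal" where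
  "lowp p j T \<equiv> (\<lambda>x. ennreal (norm (low j T x) powr p))"

text \<open>The identity \<open>cut i * cut j = cut i\<close> is read in two ways: with
  \<open>cut i\<close> as kernel it averages a higher piece, and with \<open>cut j\<close> as
  kernel, in \<open>low_reproducing\<close>, it reproduces the lower piece from itself.\<close>

lemma low_conv:
  assumes T: "T \<in> tempered_distributions" and "i < j"
  shows "low i T x = fconst TYPE('a) * conv (low j T) (inv_fourier (cut i)) x"
  using band_mult[OF T cut_bump[of i] cut_bump[of j], of x] by (simp add: low_def cut_mult[OF assms(2)])

lemma low_reproducing:
  assumes T: "T \<in> tempered_distributions" and "i < j"
  shows "low i T x = fconst TYPE('a) * conv (low i T) (inv_fourier (cut j)) x"
  using band_mult[OF T cut_bump[of j] cut_bump[of i], of x]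
  by (simp add: low_def cut_mult[OF assms(2)] mult.commute[of "cut j _"])

lemma low_poly_growth: "T \<in> tempered_distributions \<Longrightarrow> poly_growth (low j T)"
  unfolding low_def by (rule band_poly_growth[OF _ cut_bump])

lemma low_measurable: "T \<in> tempered_distributions \<Longrightarrow> low j T \<in> borel_measurable borel"
  using low_poly_growth by (auto simp: poly_growth_def)

lemma inv_fourier_dilate:
  assumes "0 < r" and [measurable]: "\<theta> \<in> borel_measurable borel"
  shows "inv_fourier (\<lambda>\<xi>. \<theta> (r *\<^sub>R \<xi>)) x = complex_of_real ((1 / r) ^ DIM('a)) * inv_fourier \<theta> ((1 / r) *\<^sub>R (x::'a))"
proof -
  have "(LINT \<xi>|lborel. iexp (((1 / r) *\<^sub>R x) \<bullet> \<xi>) * \<theta> \<xi>) = \<bar>r\<bar> ^ DIM('a) *\<^sub>R (LINT \<xi>|lborel. iexp (((1 / r) *\<^sub>R x) \<bullet> (0 + r *\<^sub>R \<xi>)) * \<theta> (0 + r *\<^sub>R \<xi>))"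
    by (rule integral_lborel_affine) (use assms in \<open>measurable, auto\<close>)
  then have "(LINT \<xi>|lborel. iexp (((1 / r) *\<^sub>R x) \<bullet> \<xi>) * \<theta> \<xi>) = complex_of_real (r ^ DIM('a)) * (LINT \<xi>|lborel. iexp (x \<bullet> \<xi>) * \<theta> (r *\<^sub>R \<xi>))"
    using assms by (simp add: scaleR_conv_of_real)
  then have "complex_of_real ((1 / r) ^ DIM('a)) * (LINT \<xi>|lborel. iexp (((1 / r) *\<^sub>R x) \<bullet> \<xi>) * \<theta> \<xi>) = (LINT \<xi>|lborel. iexp (x \<bullet> \<xi>) * \<theta> (r *\<^sub>R \<xi>))"
    using assms by (simp add: power_divide)
  then show ?thesis unfolding inv_fourier_def by (simp add: mult.left_commute)
qed

lemma inv_fourier_cut: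
  "inv_fourier (cut j) x = complex_of_real ((2 powi j) ^ DIM('a)) * inv_fourier (cut 0) ((2 powi j) *\<^sub>R x)"
proof -
  have "cut j = (\<lambda>\<xi>. cut 0 ((2 powi (- j)) *\<^sub>R \<xi>))" by (auto simp: cut_def)
  moreover have "1 / 2 powi (- j) = (2::real) powi j" by (simp add: power_int_minus divide_inverse)
  ultimately show ?thesis
    using inv_fourier_dilate[of "2 powi (- j)" "cut 0" x] bump_measurable[OF cut_bump] by simp
qed

lemma multiplier_cutoff:
  assumes T: "T \<in> tempered_distributions"
  shows "fourier_multiplier \<phi>\<^sub>0 T = low 0 T"
proof -
  have e: "(\<lambda>x. complex_of_real (\<phi>\<^sub>0 x)) = cut 0" by (simp add: cut_def fun_eq_iff)
  show ?thesis unfolding low_def e[symmetric]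
  proof (rule fourier_multiplier_band[OF T])
    show "(\<lambda>x. complex_of_real (\<phi>\<^sub>0 x)) \<in> bump (2 * 2 powi 0)" unfolding e by (rule cut_bump)
    show "cut 1 \<in> bump (2 * 2 powi 1)" by (rule cut_bump)
    show "cut 1 \<xi> * complex_of_real (\<phi>\<^sub>0 \<xi>) = complex_of_real (\<phi>\<^sub>0 \<xi>)" for \<xi>
      using cut_mult[of 0 1 \<xi>] by (simp add: cut_def mult.commute)
  qed
qed

lemma multiplier_dilate:
  assumes T: "T \<in> tempered_distributions"
  shows "fourier_multiplier (dilate (2 ^ n) \<phi>\<^sub>0) T = low (- int n) T"
proof -
  have e: "(\<lambda>x. complex_of_real (dilate (2 ^ n) \<phi>\<^sub>0 x)) = cut (- int n)"
    by (simp add: cut_def dilate_def fun_eq_iff)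
  show ?thesis unfolding low_def e[symmetric]
  proof (rule fourier_multiplier_band[OF T])
    show "(\<lambda>x. complex_of_real (dilate (2 ^ n) \<phi>\<^sub>0 x)) \<in> bump (2 * 2 powi (- int n))" unfolding e by (rule cut_bump)
    show "cut 1 \<in> bump (2 * 2 powi 1)" by (rule cut_bump)
    show "cut 1 \<xi> * complex_of_real (dilate (2 ^ n) \<phi>\<^sub>0 \<xi>) = complex_of_real (dilate (2 ^ n) \<phi>\<^sub>0 \<xi>)" for \<xi>
      using cut_mult[of "- int n" 1 \<xi>] by (simp add: fun_cong[OF e] mult.commute)
  qed
qed

lemma multiplier_psi:
  assumes T: "T \<in> tempered_distributions"
  shows "fourier_multiplier (psi \<phi>\<^sub>0 k) T x = low k T x - low (k - 1) T x"
proof -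
  have s: "2 *\<^sub>R (2 powi (- k)) *\<^sub>R x = (2 powi (- (k - 1))) *\<^sub>R x" for x :: 'a
    by (simp add: power_int_add power_int_diff power_int_minus divide_inverse)
  have e: "(\<lambda>x. complex_of_real (psi \<phi>\<^sub>0 k x)) = (\<lambda>x. cut k x + (-1) * cut (k - 1) x)"
    unfolding psi_def Let_def s by (simp add: cut_def fun_eq_iff)
  have b: "cut (k - 1) \<in> bump (2 * 2 powi k)"
    by (rule bump_mono[OF cut_bump]) (simp add: power_int_diff)
  have "fourier_multiplier (psi \<phi>\<^sub>0 k) T = band (\<lambda>x. complex_of_real (psi \<phi>\<^sub>0 k x)) T"
  proof (rule fourier_multiplier_band[OF T])
    show "(\<lambda>x. complex_of_real (psi \<phi>\<^sub>0 k x)) \<in> bump (2 * 2 powi k)"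
      unfolding e by (rule bump_add_scaled[OF cut_bump b])
    show "cut (k + 1) \<in> bump (2 * 2 powi (k + 1))" by (rule cut_bump)
    show "cut (k + 1) \<xi> * complex_of_real (psi \<phi>\<^sub>0 k \<xi>) = complex_of_real (psi \<phi>\<^sub>0 k \<xi>)" for \<xi>
      using cut_mult[of k "k + 1" \<xi>] cut_mult[of "k - 1" "k + 1" \<xi>]
      by (auto simp: fun_cong[OF e] right_diff_distrib mult.commute)
  qed
  then show ?thesis
    unfolding e using band_add_scaled[OF T cut_bump[of k] b, of "-1" x] by (simp add: low_def)
qed

end

section \<open>Suprema of integrals over balls of a fixed radius\<close>

lemma nn_weight_finite:
  assumes "real DIM('a) + 2 \<le> r"
  shows "(\<integral>\<^sup>+z. ennreal ((1 + norm (z::'a::euclidean_space)) powr (- r)) \<partial>lborel) < \<infinity>"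
proof -
  have le: "(1 + norm z) powr (- r) \<le> norm (1 / (1 + norm z) ^ (DIM('a) + 2))" for z :: 'a
  proof -
    have p: "0 < 1 + norm z" by (simp add: add_pos_nonneg)
    have "(1 + norm z) powr (- r) \<le> (1 + norm z) powr (- real (DIM('a) + 2))"
      using assms by (intro powr_mono) auto
    also have "\<dots> = 1 / (1 + norm z) ^ (DIM('a) + 2)"
      unfolding powr_minus_divide powr_realpow[OF p] ..
    finally show ?thesis using p by simp
  qed
  have "(\<integral>\<^sup>+z. ennreal ((1 + norm (z::'a)) powr (- r)) \<partial>lborel) \<le> (\<integral>\<^sup>+z. ennreal (norm (1 / (1 + norm (z::'a)) ^ (DIM('a) + 2))) \<partial>lborel)"
    by (intro nn_integral_mono ennreal_leI le)
  also have "\<dots> < \<infinity>" using integrable_inverse_power by (simp add: integrable_iff_bounded)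
  finally show ?thesis .
qed

lemma nn_weight_scale:
  assumes t: "0 < t"
  shows "(\<integral>\<^sup>+z. ennreal ((1 + t * norm (z::'a::euclidean_space)) powr (- r)) \<partial>lborel) =
    ennreal (t powr (- real DIM('a))) * (\<integral>\<^sup>+z. ennreal ((1 + norm (z::'a)) powr (- r)) \<partial>lborel)"
proof -
  have "(\<integral>\<^sup>+z. ennreal ((1 + norm (z::'a)) powr (- r)) \<partial>lborel) = ennreal (\<bar>t\<bar> ^ DIM('a)) * (\<integral>\<^sup>+z. ennreal ((1 + norm (0 + t *\<^sub>R (z::'a))) powr (- r)) \<partial>lborel)"
    using t by (intro nn_integral_lborel_affine) auto
  then have "(\<integral>\<^sup>+z. ennreal ((1 + norm (z::'a)) powr (- r)) \<partial>lborel) = ennreal (t ^ DIM('a)) * (\<integral>\<^sup>+z. ennreal ((1 + t * norm (z::'a)) powr (- r)) \<partial>lborel)"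
    using t by simp
  then have "ennreal (t powr (- real DIM('a))) * (\<integral>\<^sup>+z. ennreal ((1 + norm (z::'a)) powr (- r)) \<partial>lborel) = (ennreal (t powr (- real DIM('a))) * ennreal (t ^ DIM('a))) * (\<integral>\<^sup>+z. ennreal ((1 + t * norm (z::'a)) powr (- r)) \<partial>lborel)"
    by (simp add: mult.assoc)
  also have "ennreal (t powr (- real DIM('a))) * ennreal (t ^ DIM('a)) = 1"
    using t by (simp add: powr_minus powr_realpow flip: ennreal_mult)
  finally show ?thesis by simp
qed

text \<open>The factor in the Morrey quasi-norm depends on the radius alone, so the centres can be
  taken into a supremum first. Unlike the integral over one ball, this supremum is translation
  invariant.\<close>

definition sup_ball :: "real \<Rightarrow> ('a::euclidean_space \<Rightarrow> ennreal) \<Rightarrow> ennreal" where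
  "sup_ball R A = (SUP c. \<integral>\<^sup>+x\<in>ball c R. A x \<partial>lborel)"

lemma ball_borel [measurable]: "ball (c::'a::metric_space) R \<in> sets borel"
  by simp

lemma sup_ball_upper: "(\<integral>\<^sup>+x\<in>ball c R. A x \<partial>lborel) \<le> sup_ball R A"
  unfolding sup_ball_def by (rule SUP_upper) simp

lemma sup_ball_mono: "(\<And>x. A x \<le> B x) \<Longrightarrow> sup_ball R A \<le> sup_ball R B"
  unfolding sup_ball_def by (intro SUP_mono' nn_integral_mono mult_right_mono) auto

lemma sup_ball_cmult:
  assumes [measurable]: "A \<in> borel_measurable borel"
  shows "sup_ball R (\<lambda>x. k * A x) \<le> k * sup_ball R A"
  unfolding sup_ball_def
proof (rule SUP_least)
  fix c
  have "(\<integral>\<^sup>+x\<in>ball c R. k * A x \<partial>lborel) = k * (\<integral>\<^sup>+x\<in>ball c R. A x \<partial>lborel)"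
    unfolding mult.assoc by (rule nn_integral_cmult) measurable
  also have "\<dots> \<le> k * (SUP c. \<integral>\<^sup>+x\<in>ball c R. A x \<partial>lborel)"
    by (intro mult_left_mono SUP_upper) auto
  finally show "(\<integral>\<^sup>+x\<in>ball c R. k * A x \<partial>lborel) \<le> k * (SUP c. \<integral>\<^sup>+x\<in>ball c R. A x \<partial>lborel)" .
qed

text \<open>Translation invariance of \<^const>\<open>sup_ball\<close> replaces the boundedness of the maximal operator on
  Morrey spaces.\<close>

lemma sup_ball_conv:
  fixes U A :: "'a::euclidean_space \<Rightarrow> ennreal"
  assumes [measurable]: "U \<in> borel_measurable borel" "A \<in> borel_measurable borel"
  shows "sup_ball R (\<lambda>x. \<integral>\<^sup>+y. U (x - y) * A y \<partial>lborel) \<le> (\<integral>\<^sup>+z. U z \<partial>lborel) * sup_ball R A"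
  unfolding sup_ball_def[of R "\<lambda>x. \<integral>\<^sup>+y. U (x - y) * A y \<partial>lborel"]
proof (rule SUP_least)
  fix c :: 'a
  have refl: "(\<integral>\<^sup>+y. U (x - y) * A y \<partial>lborel) = (\<integral>\<^sup>+z. U z * A (x - z) \<partial>lborel)" for x
    using nn_integral_lborel_affine[of "\<lambda>y. U (x - y) * A y" "-1" x] by simp
  have trans: "(\<integral>\<^sup>+x. A (x - z) * indicator (ball c R) x \<partial>lborel) = (\<integral>\<^sup>+y\<in>ball (c - z) R. A y \<partial>lborel)" for z
  proof -
    have "(\<integral>\<^sup>+x. A (x - z) * indicator (ball c R) x \<partial>lborel) = (\<integral>\<^sup>+y. A y * indicator (ball c R) (z + y) \<partial>lborel)"
    proof -
      have "(\<lambda>x. A (x - z) * indicator (ball c R) x) \<in> borel_measurable borel" by measurable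
      from nn_integral_lborel_affine[OF this, of 1 z] show ?thesis by simp
    qed
    also have "\<dots> = (\<integral>\<^sup>+y\<in>ball (c - z) R. A y \<partial>lborel)"
      by (intro nn_integral_cong arg_cong2[where f = "(*)"] refl) (auto simp: indicator_def dist_norm algebra_simps)
    finally show ?thesis .
  qed
  have "(\<integral>\<^sup>+x\<in>ball c R. (\<integral>\<^sup>+y. U (x - y) * A y \<partial>lborel) \<partial>lborel) = (\<integral>\<^sup>+x. (\<integral>\<^sup>+z. U z * A (x - z) * indicator (ball c R) x \<partial>lborel) \<partial>lborel)"
    unfolding refl by (intro nn_integral_cong nn_integral_multc[symmetric]) measurable
  also have "\<dots> = (\<integral>\<^sup>+z. (\<integral>\<^sup>+x. U z * A (x - z) * indicator (ball c R) x \<partial>lborel) \<partial>lborel)"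
    by (rule lborel_pair.Fubini'[symmetric]) measurable
  also have "\<dots> = (\<integral>\<^sup>+z. U z * (\<integral>\<^sup>+x. A (x - z) * indicator (ball c R) x \<partial>lborel) \<partial>lborel)"
    unfolding mult.assoc by (intro nn_integral_cong nn_integral_cmult) measurable
  also have "\<dots> \<le> (\<integral>\<^sup>+z. U z * sup_ball R A \<partial>lborel)"
    unfolding trans by (intro nn_integral_mono mult_left_mono sup_ball_upper) auto
  also have "\<dots> = (\<integral>\<^sup>+z. U z \<partial>lborel) * sup_ball R A"
    by (rule nn_integral_multc) measurable
  finally show "(\<integral>\<^sup>+x\<in>ball c R. (\<integral>\<^sup>+y. U (x - y) * A y \<partial>lborel) \<partial>lborel) \<le> (\<integral>\<^sup>+z. U z \<partial>lborel) * sup_ball R A" .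
qed

section \<open>Band-limited functions\<close>

lemma weight_mult_mono:
  fixes x y z :: "'a::real_normed_vector"
  assumes "0 \<le> r"
  shows "(1 + norm (y - z)) powr (- r) \<le> (1 + norm (x - y)) powr r * (1 + norm (x - z)) powr (- r)"
proof -
  have p: "0 < 1 + norm w" for w :: 'a by (simp add: add_pos_nonneg)
  have "1 + norm (x - z) \<le> (1 + norm (x - y)) * (1 + norm (y - z))"
    using one_plus_norm_le[of "x - z" "y - z"] by simp
  then have "(1 + norm (x - z)) powr r \<le> ((1 + norm (x - y)) * (1 + norm (y - z))) powr r"
    using assms by (intro powr_mono2) auto
  also have "\<dots> = (1 + norm (x - y)) powr r * (1 + norm (y - z)) powr r"
    by (rule powr_mult)
  moreover have "0 < (1 + norm (x - z)) powr r" "0 < (1 + norm (y - z)) powr r" using p by (metis less_irrefl powr_gt_zero)+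
  ultimately show ?thesis by (simp add: powr_minus field_simps)
qed

text \<open>An integral counterpart of Peetre's maximal function, raised to the power p. For large
  \<open>m\<close> it is a convolution of |g|^p with an integrable weight, which
  \<open>sup_ball_conv\<close> can handle.\<close>

abbreviation peetre :: "real \<Rightarrow> nat \<Rightarrow> ('a::euclidean_space \<Rightarrow> complex) \<Rightarrow> 'a \<Rightarrow> ennreal" where
  "peetre p m g x \<equiv> (\<integral>\<^sup>+z. ennreal (norm (g z) powr p * (1 + norm (x - z)) powr (- (p * real m))) \<partial>lborel)"

text \<open>The Peetre maximal function at \<open>x\<close> is the number \<open>S\<close> in the proof; it must be finite in order
  to divide by its power.\<close>

lemma subharmonic_step:
  fixes g \<kappa> :: "'a::euclidean_space \<Rightarrow> complex"
  assumes p: "0 < p" "p \<le> 1" and g: "poly_growth g" and \<kappa>: "\<kappa> \<in> schwartz"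
    and D: "0 < D" "\<And>z. (1 + norm z) ^ m * norm (\<kappa> z) \<le> D"
    and rep: "\<And>x. g x = conv g \<kappa> x"
    and S0: "\<And>y. norm (g y) \<le> S0 * (1 + norm (x - y)) ^ m"
  shows "ennreal (norm (g x) powr p) \<le> ennreal D *
    (peetre p m g x)"
    (is "_ \<le> _ * ?J")
proof (cases "?J = \<infinity>")
  case True
  then show ?thesis using D by (simp add: ennreal_mult_top)
next
  case False
  then obtain j where j: "0 \<le> j" "?J = ennreal j" by (cases ?J) auto
  have [measurable]: "g \<in> borel_measurable borel" using g by (simp add: poly_growth_def)
  have p1: "0 < 1 + norm w" for w :: 'a by (simp add: add_pos_nonneg)
  define S where "S = (SUP y. norm (g y) / (1 + norm (x - y)) ^ m)"
  have bdd: "bdd_above (range (\<lambda>y. norm (g y) / (1 + norm (x - y)) ^ m))"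
    using S0 p1 by (intro bdd_aboveI[of _ S0]) (auto simp: divide_le_eq)
  have Sle: "norm (g y) \<le> S * (1 + norm (x - y)) ^ m" for y
  proof -
    have "norm (g y) / (1 + norm (x - y)) ^ m \<le> S" unfolding S_def by (rule cSUP_upper[OF _ bdd]) simp
    then show ?thesis using p1 by (simp add: divide_le_eq)
  qed
  have gS: "norm (g x) \<le> S" using Sle[of x] by simp
  show ?thesis
  proof (cases "S = 0")
    case True
    then show ?thesis using gS by simp
  next
    case False
    then have Spos: "0 < S" using gS norm_ge_zero[of "g x"] by linarith
    \<comment> \<open>|g| is split into |g|^p and |g|^(1 - p), and only the second factor is
      estimated by \<open>S\<close> and the weight. The decay of \<kappa>, moved from
      \<open>y\<close> to \<open>x\<close>, leaves the exponent m (1 - p) - m = - p m.\<close>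
    have key: "norm (g y) \<le> (D * S powr (1 - p) * j) * (1 + norm (x - y)) ^ m" for y
    proof -
      let ?c = "D * S powr (1 - p) * (1 + norm (x - y)) ^ m"
      have pt: "norm (g z * \<kappa> (y - z)) \<le> ?c * (norm (g z) powr p * (1 + norm (x - z)) powr (- (p * real m)))" for z
      proof (cases "g z = 0")
        case False
        let ?u = "1 + norm (x - z)" and ?v = "1 + norm (x - y)" and ?w = "1 + norm (y - z)"
        have "norm (g z) = norm (g z) powr p * norm (g z) powr (1 - p)"
          using False by (simp flip: powr_add)
        also have "\<dots> \<le> norm (g z) powr p * (S * ?u ^ m) powr (1 - p)"
          using Sle p by (intro mult_left_mono powr_mono2) auto
        also have "(S * ?u ^ m) powr (1 - p) = S powr (1 - p) * ?u powr (real m * (1 - p))"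
          using p1 by (simp add: powr_mult powr_powr flip: powr_realpow)
        finally have 1: "norm (g z) \<le> norm (g z) powr p * (S powr (1 - p) * ?u powr (real m * (1 - p)))" .
        have "norm (\<kappa> (y - z)) \<le> D * ?w powr (- real m)"
          using D(2)[of "y - z"] p1[of "y - z"] by (simp add: powr_minus powr_realpow field_simps)
        also have "\<dots> \<le> D * (?v powr real m * ?u powr (- real m))"
          using D by (intro mult_left_mono weight_mult_mono) auto
        finally have 2: "norm (\<kappa> (y - z)) \<le> D * (?v powr real m * ?u powr (- real m))" .
        have "norm (g z * \<kappa> (y - z)) \<le> (norm (g z) powr p * (S powr (1 - p) * ?u powr (real m * (1 - p)))) * (D * (?v powr real m * ?u powr (- real m)))"
          unfolding norm_mult by (intro mult_mono 1 2) auto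
        also have "\<dots> = D * S powr (1 - p) * ?v powr real m * (norm (g z) powr p * (?u powr (real m * (1 - p)) * ?u powr (- real m)))"
          by (simp only: mult_ac)
        also have "?u powr (real m * (1 - p)) * ?u powr (- real m) = ?u powr (- (p * real m))"
          by (simp add: algebra_simps flip: powr_add)
        finally show ?thesis using powr_realpow[OF p1[of "x - y"], of m] by simp
      qed simp
      have "ennreal (norm (g y)) = ennreal (norm (LINT z|lborel. g z * \<kappa> (y - z)))"
        by (subst rep[of y]) (simp only: conv_def)
      also have "\<dots> \<le> (\<integral>\<^sup>+z. ennreal (norm (g z * \<kappa> (y - z))) \<partial>lborel)"
        by (rule integral_norm_bound_ennreal[OF conv_integrable[OF g \<kappa>]])
      also have "\<dots> \<le> (\<integral>\<^sup>+z. ennreal ?c * ennreal (norm (g z) powr p * (1 + norm (x - z)) powr (- (p * real m))) \<partial>lborel)"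
        using pt D by (intro nn_integral_mono) (auto simp flip: ennreal_mult'' intro!: ennreal_leI)
      also have "\<dots> = ennreal ?c * ?J"
        by (rule nn_integral_cmult) measurable
      also have "\<dots> = ennreal (?c * j)" using j D by (simp add: ennreal_mult)
      finally have "norm (g y) \<le> ?c * j"
        using j D by (simp add: ennreal_le_iff)
      then show ?thesis by (simp add: mult_ac)
    qed
    have "S \<le> D * S powr (1 - p) * j"
      unfolding S_def
    proof (rule cSUP_least)
      show "norm (g y) / (1 + norm (x - y)) ^ m \<le> D * (SUP y. norm (g y) / (1 + norm (x - y)) ^ m) powr (1 - p) * j" for y
        using key[of y] p1 by (simp add: divide_le_eq S_def)
    qed simp
    then have "S powr p * S powr (1 - p) \<le> (D * j) * S powr (1 - p)"
      using Spos by (simp add: mult_ac flip: powr_add)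
    then have "S powr p \<le> D * j" using Spos by simp
    moreover have "norm (g x) powr p \<le> S powr p" using gS p by (intro powr_mono2) auto
    ultimately have "norm (g x) powr p \<le> D * j" by linarith
    then show ?thesis using j D by (simp add: ennreal_leI flip: ennreal_mult)
  qed
qed

text \<open>The growth of \<open>g\<close> makes \<open>S\<close> finite only for a degree
  \<open>n\<close> that depends on \<open>g\<close>, and then \<open>D n\<close> does so too. Hence
  the step is used twice: with degree \<open>n\<close> to obtain growth of degree \<open>m\<close>,
  then with degree \<open>m\<close>, whose constant \<open>D m\<close> does not depend on
  \<open>g\<close>.\<close>

lemma subharmonic:
  fixes \<kappa> :: "'a::euclidean_space \<Rightarrow> complex"
  assumes p: "0 < p" "p \<le> 1" and \<kappa>: "\<kappa> \<in> schwartz"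
  shows "\<exists>C>0. \<forall>g. poly_growth g \<longrightarrow> (\<forall>x. g x = conv g \<kappa> x) \<longrightarrow>
    (\<forall>x. ennreal (norm (g x) powr p) \<le> ennreal C *
      (peetre p m g x))"
proof -
  have "\<exists>D>0. \<forall>z. (1 + norm z) ^ n * norm (\<kappa> z) \<le> D" for n
  proof -
    obtain B where "B \<ge> 0" "\<And>z. (1 + norm z) ^ n * norm (\<kappa> z) \<le> B"
      using schwartz_bound[OF \<kappa>, of "[]" n] by auto
    then show ?thesis by (intro exI[of _ "B + 1"]) (auto intro: add_increasing2)
  qed
  then obtain D where D: "\<And>n. 0 < D n" "\<And>n z. (1 + norm z) ^ n * norm (\<kappa> z) \<le> D n" by metis
  have "ennreal (norm (g x) powr p) \<le> ennreal (D m) *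
      (peetre p m g x)"
    if g: "poly_growth g" and rep: "\<And>x. g x = conv g \<kappa> x" for g x
  proof -
    define J where "J = (\<lambda>n x. peetre p n g x)"
    have [measurable]: "g \<in> borel_measurable borel" using g by (simp add: poly_growth_def)
    have p1: "0 < 1 + norm w" for w :: 'a by (simp add: add_pos_nonneg)
    obtain A M where A: "\<And>y. norm (g y) \<le> A * (1 + norm y) ^ M" using g by (auto simp: poly_growth_def)
    define n where "n = max m M"
    have large: "ennreal (norm (g y) powr p) \<le> ennreal (D n) * J n y" for y
      unfolding J_def
    proof (rule subharmonic_step[OF p g \<kappa> D(1) D(2) rep])
      fix z :: 'a
      have "(1 + norm z) ^ M \<le> (1 + norm z) ^ n" by (intro power_increasing) (auto simp: n_def)
      also have "\<dots> \<le> ((1 + norm y) * (1 + norm (y - z))) ^ n"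
        using one_plus_norm_diff_le[of y "y - z"] by (intro power_mono) auto
      finally have "\<bar>A\<bar> * (1 + norm z) ^ M \<le> \<bar>A\<bar> * ((1 + norm y) ^ n * (1 + norm (y - z)) ^ n)"
        unfolding power_mult_distrib by (intro mult_left_mono) auto
      moreover have "A * (1 + norm z) ^ M \<le> \<bar>A\<bar> * (1 + norm z) ^ M" by (intro mult_right_mono) auto
      ultimately show "norm (g z) \<le> (\<bar>A\<bar> * (1 + norm y) ^ n) * (1 + norm (y - z)) ^ n"
        using A[of z] by (simp add: mult.assoc)
    qed
    show ?thesis
    proof (cases "J m x = \<infinity>")
      case True
      then show ?thesis using D(1)[of m] by (simp add: J_def ennreal_mult_top)
    next
      case False
      then obtain j where j: "0 \<le> j" "J m x = ennreal j" by (cases "J m x") auto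
      \<comment> \<open>The mean about \<open>y\<close> is at most the mean about \<open>x\<close>
        times a power of \<open>1 + norm (x - y)\<close>. The factor in front may depend on
        \<open>g\<close> and \<open>x\<close>: the second use of the step takes only its
        finiteness.\<close>
      have "norm (g y) \<le> (D n * j) powr (1 / p) * (1 + norm (x - y)) ^ m" for y
      proof -
        have "J n y \<le> J m y" unfolding J_def
        proof (intro nn_integral_mono ennreal_leI mult_left_mono powr_mono)
          show "- (p * real n) \<le> - (p * real m)" using p by (simp add: n_def)
        qed auto
        also have "J m y \<le> (\<integral>\<^sup>+z. ennreal ((1 + norm (x - y)) powr (p * real m)) * ennreal (norm (g z) powr p * (1 + norm (x - z)) powr (- (p * real m))) \<partial>lborel)"
          unfolding J_def
        proof (rule nn_integral_mono)
          fix z :: 'a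
          have "norm (g z) powr p * (1 + norm (y - z)) powr (- (p * real m)) \<le> norm (g z) powr p * ((1 + norm (x - y)) powr (p * real m) * (1 + norm (x - z)) powr (- (p * real m)))"
            using p by (intro mult_left_mono weight_mult_mono) auto
          then show "ennreal (norm (g z) powr p * (1 + norm (y - z)) powr (- (p * real m))) \<le> ennreal ((1 + norm (x - y)) powr (p * real m)) * ennreal (norm (g z) powr p * (1 + norm (x - z)) powr (- (p * real m)))"
            by (simp add: mult_ac ennreal_leI flip: ennreal_mult)
        qed
        also have "\<dots> = ennreal ((1 + norm (x - y)) powr (p * real m)) * J m x"
          unfolding J_def by (rule nn_integral_cmult) measurable
        finally have "ennreal (D n) * J n y \<le> ennreal (D n) * (ennreal ((1 + norm (x - y)) powr (p * real m)) * ennreal j)"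
          unfolding j by (intro mult_left_mono) auto
        also have "\<dots> = ennreal (D n * j * (1 + norm (x - y)) powr (p * real m))"
          using D(1)[of n] j by (simp add: mult_ac flip: ennreal_mult)
        finally have "ennreal (norm (g y) powr p) \<le> \<dots>" using large[of y] by (rule order_trans[rotated])
        then have "norm (g y) powr p \<le> D n * j * (1 + norm (x - y)) powr (p * real m)"
          using D(1)[of n] j by (simp add: ennreal_le_iff)
        then have "(norm (g y) powr p) powr (1 / p) \<le> (D n * j * (1 + norm (x - y)) powr (p * real m)) powr (1 / p)"
          using p by (intro powr_mono2) auto
        then show ?thesis
          using p D(1)[of n] j p1[of "x - y"] by (simp add: powr_powr powr_mult powr_realpow)
      qed
      from subharmonic_step[OF p g \<kappa> D(1) D(2) rep this] show ?thesis .
    qed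
  qed
  then show ?thesis using D(1)[of m] by blast
qed

lemma scaled_weight_doubling:
  fixes t r r' :: real
  assumes "r' \<le> r + 1" "0 \<le> r" "0 < t" "t \<le> 1"
  shows "1 + t * r' \<le> 2 * (1 + t * r)"
proof -
  have "t * r' \<le> t * (r + 1)" using assms by (intro mult_left_mono) auto
  then have "t * r' \<le> t * r + t" by (simp add: distrib_left)
  then have "1 + t * r' \<le> 1 + (t * r + t)" by simp
  also have "\<dots> \<le> 1 + (t * r + 1)" using assms by simp
  also have "\<dots> \<le> 1 + (t * r + 1) + t * r" using assms by simp
  also have "\<dots> = 2 * (1 + t * r)" by simp
  finally show ?thesis .
qed

text \<open>The integrand is dominated by a function that varies slowly at unit scale, and the integral of
  such a function is bounded by its \<open>L\<^sub>p\<close> quasi-norm although \<open>p \<le> 1\<close>.\<close>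

lemma conv_bound_quasi:
  fixes g :: "'a::euclidean_space \<Rightarrow> complex" and J :: "'a \<Rightarrow> ennreal"
  assumes p: "0 < p" "p \<le> 1" and t: "0 < t" "t \<le> 1" and B: "0 < B" and C: "0 < C"
    and [measurable]: "g \<in> borel_measurable borel" "J \<in> borel_measurable borel"
    and J: "\<And>y. ennreal (norm (g y) powr p) \<le> ennreal C * J y"
    and Jd: "\<And>y y'. norm (y - y') < 1 \<Longrightarrow> J y \<le> ennreal \<beta> * J y'" and \<beta>: "0 < \<beta>"
    and W: "\<And>z. W z = B * (1 + t * norm z) powr (- L)" and L: "0 \<le> L"
  defines "V \<equiv> unit_ball_vol (real DIM('a))"
  shows "epowr (\<integral>\<^sup>+y. ennreal (W (x - y) * norm (g y)) \<partial>lborel) p \<le>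
    ennreal ((C * (2 powr (L * p) * \<beta>) / V) powr (1 - p) * C powr p) * (\<integral>\<^sup>+y. ennreal (W (x - y) powr p) * J y \<partial>lborel)"
    (is "epowr ?H p \<le> ennreal ?k * ?Q")
proof -
  have V: "0 < V" unfolding V_def by simp
  have w1: "0 < 1 + t * norm z" for z :: 'a using t by (simp add: add_pos_nonneg)
  have Wpos: "0 < W z" for z using B w1[of z] by (simp add: W)
  have [measurable]: "W \<in> borel_measurable borel" unfolding W[abs_def] by measurable
  have k: "0 < ?k" using C V \<beta> by simp
  show ?thesis
  proof (cases "?Q = \<infinity>")
    case True
    have "ennreal ?k \<noteq> 0" using k by (metis ennreal_eq_0_iff not_le)
    then show ?thesis using True ennreal_mult_top[of "ennreal ?k"] by (metis infinity_ennreal_def top_greatest)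
  next
    case False
    then obtain q where q: "0 \<le> q" "?Q = ennreal q" by (cases ?Q) auto
    let ?\<gamma> = "2 powr (L * p) * \<beta>"
    have \<gamma>: "0 < ?\<gamma>" using \<beta> by simp
    define E where "E = C * ?\<gamma> / V"
    have E: "0 < E" using C \<gamma> V by (simp add: E_def)
    \<comment> \<open>On the unit ball about \<open>y\<close>, of volume \<open>V\<close>, the
      weight and \<open>J\<close> change by bounded factors only. The value at \<open>y\<close> is
      thus controlled by an integral, which gives a uniform bound.\<close>
    have small: "(W (x - y) * norm (g y)) powr p \<le> E * q" for y
    proof -
      have loc: "ennreal (W (x - y) powr p) * J y \<le> ennreal ?\<gamma> * (ennreal (W (x - y') powr p) * J y')" if y': "y' \<in> ball y 1" for y'
      proof -
        have n: "norm (y - y') < 1" using y' by (simp add: dist_norm)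
        have "1 + t * norm (x - y') \<le> 2 * (1 + t * norm (x - y))"
          using norm_triangle_ineq[of "x - y" "y - y'"] n t by (intro scaled_weight_doubling) auto
        then have "(1 + t * norm (x - y')) powr L \<le> (2 * (1 + t * norm (x - y))) powr L"
          using L w1[of "x - y'"] by (intro powr_mono2) auto
        then have "(1 + t * norm (x - y)) powr (- L) \<le> 2 powr L * (1 + t * norm (x - y')) powr (- L)"
        proof -
          assume *: "(1 + t * norm (x - y')) powr L \<le> (2 * (1 + t * norm (x - y))) powr L"
          have "0 < (1 + t * norm (x - y')) powr L" "0 < (1 + t * norm (x - y)) powr L"
            using w1[of "x - y"] w1[of "x - y'"] by simp_all
          then show ?thesis using * unfolding powr_mult by (simp add: powr_minus field_simps)
        qed
        then have "W (x - y) \<le> 2 powr L * W (x - y')"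
          using B unfolding W by (simp add: mult.left_commute)
        then have "W (x - y) powr p \<le> (2 powr L * W (x - y')) powr p"
          using Wpos[of "x - y"] p by (intro powr_mono2) auto
        also have "\<dots> = 2 powr (L * p) * W (x - y') powr p"
          using Wpos[of "x - y'"] by (simp add: powr_mult powr_powr)
        finally have "ennreal (W (x - y) powr p) * J y \<le> ennreal (2 powr (L * p) * W (x - y') powr p) * (ennreal \<beta> * J y')"
          by (intro mult_mono ennreal_leI Jd n) auto
        then show ?thesis using \<beta> by (simp add: ennreal_mult mult_ac)
      qed
      have "ennreal (W (x - y) powr p) * J y * ennreal V = (\<integral>\<^sup>+y'. ennreal (W (x - y) powr p) * J y * indicator (ball y 1) y' \<partial>lborel)"
        by (subst nn_integral_cmult_indicator) (auto simp: V_def emeasure_ball)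
      also have "\<dots> \<le> (\<integral>\<^sup>+y'. ennreal ?\<gamma> * (ennreal (W (x - y') powr p) * J y') \<partial>lborel)"
        using loc by (intro nn_integral_mono) (auto simp: indicator_def)
      also have "\<dots> = ennreal ?\<gamma> * ?Q" by (rule nn_integral_cmult) measurable
      also have "\<dots> = ennreal (?\<gamma> * q)" using q \<gamma> by (simp add: ennreal_mult)
      finally have a: "ennreal (W (x - y) powr p) * J y * ennreal V \<le> ennreal (?\<gamma> * q)" .
      have "ennreal ((W (x - y) * norm (g y)) powr p * V) = ennreal (W (x - y) powr p) * ennreal (norm (g y) powr p) * ennreal V"
        using Wpos[of "x - y"] V by (simp add: powr_mult ennreal_mult)
      also have "\<dots> \<le> ennreal (W (x - y) powr p) * (ennreal C * J y) * ennreal V"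
        by (intro mult_right_mono mult_left_mono J) auto
      also have "\<dots> = ennreal C * (ennreal (W (x - y) powr p) * J y * ennreal V)"
        by (simp only: mult_ac)
      also have "\<dots> \<le> ennreal C * ennreal (?\<gamma> * q)" by (intro mult_left_mono a) auto
      also have "\<dots> = ennreal (C * (?\<gamma> * q))" using C \<gamma> q by (simp add: ennreal_mult)
      finally have "(W (x - y) * norm (g y)) powr p * V \<le> C * (?\<gamma> * q)"
        using C \<gamma> q by (simp add: ennreal_le_iff)
      then show ?thesis using V by (simp add: E_def field_simps)
    qed
    \<comment> \<open>With \<open>?a\<close> for the left side, \<open>?a\<close> is
      \<open>?a powr p\<close> times a positive power of \<open>?a powr p\<close>. The uniform bound
      \<open>small\<close> is applied to the second factor, so that p-th powers alone remain to be
      integrated.\<close>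
    have pt: "W (x - y) * norm (g y) \<le> (E * q) powr ((1 - p) / p) * (W (x - y) powr p * norm (g y) powr p)" for y
    proof (cases "g y = 0")
      case False
      let ?a = "W (x - y) * norm (g y)"
      have a: "0 < ?a" using False Wpos by simp
      have "?a = ?a powr p * (?a powr p) powr ((1 - p) / p)"
        using a p by (simp add: powr_powr flip: powr_add)
      also have "\<dots> \<le> ?a powr p * (E * q) powr ((1 - p) / p)"
        using small[of y] p by (intro mult_left_mono powr_mono2) auto
      finally show ?thesis using Wpos[of "x - y"] by (simp add: powr_mult mult_ac)
    qed simp
    have "?H \<le> (\<integral>\<^sup>+y. ennreal ((E * q) powr ((1 - p) / p) * C) * (ennreal (W (x - y) powr p) * J y) \<partial>lborel)"
    proof (rule nn_integral_mono)
      fix y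
      have "ennreal (W (x - y) * norm (g y)) \<le> ennreal ((E * q) powr ((1 - p) / p)) * (ennreal (W (x - y) powr p) * ennreal (norm (g y) powr p))"
        using pt[of y] by (simp add: ennreal_leI flip: ennreal_mult)
      also have "\<dots> \<le> ennreal ((E * q) powr ((1 - p) / p)) * (ennreal (W (x - y) powr p) * (ennreal C * J y))"
        by (intro mult_left_mono J) auto
      finally show "ennreal (W (x - y) * norm (g y)) \<le> ennreal ((E * q) powr ((1 - p) / p) * C) * (ennreal (W (x - y) powr p) * J y)"
        using C by (simp add: ennreal_mult mult_ac)
    qed
    also have "\<dots> = ennreal ((E * q) powr ((1 - p) / p) * C) * ?Q"
      by (rule nn_integral_cmult) measurable
    also have "\<dots> = ennreal ((E * q) powr ((1 - p) / p) * C * q)" using q C by (simp add: ennreal_mult)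
    finally have H: "?H \<le> ennreal ((E * q) powr ((1 - p) / p) * C * q)" .
    then obtain h where h: "0 \<le> h" "?H = ennreal h" by (cases ?H) (auto simp: top_unique)
    have "h \<le> (E * q) powr ((1 - p) / p) * C * q"
      using H h q C by (simp add: ennreal_le_iff)
    then have "h powr p \<le> ((E * q) powr ((1 - p) / p) * C * q) powr p" using h p by (intro powr_mono2) auto
    also have "\<dots> = E powr (1 - p) * C powr p * (q powr (1 - p) * q powr p)"
      using E C q p by (simp add: powr_mult powr_powr)
    also have "q powr (1 - p) * q powr p = q" using q by (cases "q = 0") (simp_all flip: powr_add)
    finally have "h powr p \<le> ?k * q" by (simp add: E_def)
    then show ?thesis using h q k by (simp add: epowr_def ennreal_leI flip: ennreal_mult)
  qed
qed

text \<open>In place of Jensen's inequality: for every l > 0 one has G \<le> l + l^(1 - p) G^p.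
  Integrating against \<open>W\<close> leaves \<open>l\<close> free, and the p-th root of the
  integral on the right is a good choice.\<close>

lemma conv_bound_convex:
  fixes G W :: "'a::euclidean_space \<Rightarrow> real"
  assumes p: "1 \<le> p" and [measurable]: "G \<in> borel_measurable borel" "W \<in> borel_measurable borel"
    and nn: "\<And>y. 0 \<le> G y" "\<And>z. 0 \<le> W z"
    and \<omega>: "(\<integral>\<^sup>+z. ennreal (W z) \<partial>lborel) \<le> ennreal \<omega>" "0 \<le> \<omega>"
  shows "epowr (\<integral>\<^sup>+y. ennreal (W (x - y) * G y) \<partial>lborel) p \<le>
    ennreal ((\<omega> + 1) powr p) * (\<integral>\<^sup>+y. ennreal (W (x - y) * G y powr p) \<partial>lborel)"
    (is "epowr ?H p \<le> ennreal ?k * ?Q")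
proof (cases "?Q = \<infinity>")
  case True
  then show ?thesis using \<omega> by (simp add: ennreal_mult_top)
next
  case False
  then obtain q where q: "0 \<le> q" "?Q = ennreal q" by (cases ?Q) auto
  have om: "(\<integral>\<^sup>+y. ennreal (W (x - y)) \<partial>lborel) \<le> ennreal \<omega>"
    using nn_integral_lborel_affine[of "\<lambda>y. ennreal (W y)" "-1" x] \<omega> by simp
  have bound: "?H \<le> ennreal (l * \<omega> + l powr (1 - p) * q)" if l: "0 < l" for l
  proof -
    have pt: "G y \<le> l + l powr (1 - p) * G y powr p" for y
    proof (cases "G y \<le> l")
      case False
      then have g: "0 < G y" using l by simp
      have "G y = G y powr (1 - p) * G y powr p" using g by (simp flip: powr_add)
      also have "\<dots> \<le> l powr (1 - p) * G y powr p"
        using False l p by (intro mult_right_mono powr_mono2') auto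
      finally show ?thesis using l by linarith
    qed (simp add: add_increasing2)
    have "?H \<le> (\<integral>\<^sup>+y. ennreal l * ennreal (W (x - y)) + ennreal (l powr (1 - p)) * ennreal (W (x - y) * G y powr p) \<partial>lborel)"
    proof (rule nn_integral_mono)
      fix y
      have "W (x - y) * G y \<le> W (x - y) * (l + l powr (1 - p) * G y powr p)"
        by (intro mult_left_mono pt nn)
      then show "ennreal (W (x - y) * G y) \<le> ennreal l * ennreal (W (x - y)) + ennreal (l powr (1 - p)) * ennreal (W (x - y) * G y powr p)"
        using l nn by (simp add: ennreal_leI distrib_left mult_ac flip: ennreal_mult ennreal_plus)
    qed
    also have "\<dots> = ennreal l * (\<integral>\<^sup>+y. ennreal (W (x - y)) \<partial>lborel) + ennreal (l powr (1 - p)) * ?Q"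
      by (simp add: nn_integral_add nn_integral_cmult)
    also have "\<dots> \<le> ennreal l * ennreal \<omega> + ennreal (l powr (1 - p)) * ennreal q"
      unfolding q by (intro add_mono mult_left_mono om) auto
    also have "\<dots> = ennreal (l * \<omega> + l powr (1 - p) * q)"
      using l \<omega> q by (simp flip: ennreal_mult ennreal_plus)
    finally show ?thesis .
  qed
  from bound[of 1] obtain h where h: "0 \<le> h" "?H = ennreal h" by (cases ?H) (auto simp: top_unique)
  have hb: "h \<le> l * \<omega> + l powr (1 - p) * q" if "0 < l" for l
  proof -
    have "ennreal h \<le> ennreal (l * \<omega> + l powr (1 - p) * q)" using bound[OF that] by (simp only: h(2))
    then show ?thesis using that \<omega> q by (subst (asm) ennreal_le_iff) auto
  qed
  have "h powr p \<le> (\<omega> + 1) powr p * q"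
  proof (cases "q = 0")
    case True
    \<comment> \<open>For \<open>q = 0\<close> the usual choice of \<open>l\<close> is not positive;
      instead \<open>l\<close> tends to 0.\<close>
    have "h \<le> 0 + e" if "0 < e" for e
    proof -
      have "h \<le> e / (\<omega> + 1) * \<omega>" using hb[of "e / (\<omega> + 1)"] that \<omega> True by simp
      also have "\<dots> \<le> e" using that \<omega> by (simp add: field_simps)
      finally show ?thesis by simp
    qed
    then have "h \<le> 0" by (rule field_le_epsilon)
    then have "h = 0" using h by simp
    then show ?thesis using q by simp
  next
    case False
    then have q0: "0 < q" using q by simp
    \<comment> \<open>With this \<open>l\<close> both terms become multiples of the p-th root of
      \<open>q\<close>.\<close>
    have "h \<le> q powr (1 / p) * \<omega> + (q powr (1 / p)) powr (1 - p) * q" using hb[of "q powr (1 / p)"] q0 by simp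
    also have "(q powr (1 / p)) powr (1 - p) * q = q powr (1 / p)"
    proof -
      have "(q powr (1 / p)) powr (1 - p) * q = q powr ((1 - p) / p) * q powr 1" using q0 by (simp add: powr_powr)
      also have "\<dots> = q powr ((1 - p) / p + 1)" by (simp only: powr_add)
      also have "(1 - p) / p + 1 = 1 / p" using p by (simp add: field_simps)
      finally show ?thesis .
    qed
    finally have "h \<le> (\<omega> + 1) * q powr (1 / p)" by (simp add: algebra_simps)
    then have "h powr p \<le> ((\<omega> + 1) * q powr (1 / p)) powr p" using h p by (intro powr_mono2) auto
    also have "\<dots> = (\<omega> + 1) powr p * q" using \<omega> q0 p by (simp add: powr_mult powr_powr)
    finally show ?thesis .
  qed
  then show ?thesis using h q \<omega> by (simp add: epowr_def ennreal_leI flip: ennreal_mult)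
qed

section \<open>Powers, sequence norms and Morrey norms\<close>

lemma epowr_ennreal: "0 \<le> x \<Longrightarrow> epowr (ennreal x) r = ennreal (x powr r)"
  by (simp add: epowr_def)

lemma epowr_mono: "x \<le> y \<Longrightarrow> 0 \<le> r \<Longrightarrow> epowr x r \<le> epowr y r"
  by (cases x; cases y) (auto simp: epowr_def top_unique intro!: ennreal_leI powr_mono2)

lemma epowr_epowr: "epowr (epowr x r) t = epowr x (r * t)"
  by (cases x) (auto simp: epowr_def powr_powr)

lemma epowr_inverse: "0 < r \<Longrightarrow> epowr (epowr x r) (1 / r) = x"
  unfolding epowr_epowr by (cases x) (auto simp: epowr_def)

lemma epowr_inverse': "0 < r \<Longrightarrow> epowr (epowr x (1 / r)) r = x"
  unfolding epowr_epowr by (cases x) (auto simp: epowr_def)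

lemma epowr_cmult: "0 < c \<Longrightarrow> epowr (ennreal c * x) r = ennreal (c powr r) * epowr x r"
  by (cases x) (auto simp: epowr_def ennreal_mult_top powr_mult ennreal_mult_eq_top_iff simp flip: ennreal_mult)

text \<open>Through the maximum, so that convex and concave powers are treated alike.\<close>

lemma epowr_add:
  assumes "0 < r"
  shows "epowr (x + y) r \<le> ennreal (2 powr r) * (epowr x r + epowr y r)"
proof -
  have "x + y \<le> max x y + max x y" by (intro add_mono) auto
  then have "epowr (x + y) r \<le> epowr (ennreal 2 * max x y) r"
    using assms by (intro epowr_mono) (auto simp: mult_2)
  also have "\<dots> = ennreal (2 powr r) * epowr (max x y) r"
    by (rule epowr_cmult) simp
  also have "epowr (max x y) r \<le> epowr x r + epowr y r"
    by (cases "x \<le> y") (auto simp: max_def)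
  finally show ?thesis by (simp add: mult_left_mono)
qed

lemma epowr_measurable [measurable]:
  assumes [measurable]: "f \<in> borel_measurable M"
  shows "(\<lambda>x. epowr (f x) r) \<in> borel_measurable M"
  unfolding epowr_def by measurable

section \<open>Sequence quasi-norms\<close>

lemma lq_norm_mono:
  assumes "I \<subseteq> J" "0 < q"
  shows "lq_norm q I c \<le> lq_norm q J c"
proof (cases "q = \<infinity>")
  case True
  then show ?thesis using assms by (simp add: lq_norm_def SUP_subset_mono)
next
  case False
  have "(\<Sum>\<^sub>\<infinity>k\<in>I. ennreal (\<bar>c k\<bar> powr enn2real q)) \<le> (\<Sum>\<^sub>\<infinity>k\<in>J. ennreal (\<bar>c k\<bar> powr enn2real q))"
    using assms by (intro infsum_mono_neutral nonneg_summable_on_complete) auto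
  then show ?thesis using False by (simp add: lq_norm_def epowr_mono)
qed

lemma enn2real_pos: "0 < q \<Longrightarrow> q \<noteq> \<infinity> \<Longrightarrow> 0 < enn2real q"
  by (simp add: enn2real_positive_iff top.not_eq_extremum)

lemma lq_norm_singleton: "0 < q \<Longrightarrow> lq_norm q {k} c = ennreal \<bar>c k\<bar>"
  using enn2real_pos[of q] by (auto simp: lq_norm_def epowr_ennreal powr_powr)

lemma lq_norm_member:
  assumes "k \<in> I" "0 < q"
  shows "ennreal \<bar>c k\<bar> \<le> lq_norm q I c"
  using lq_norm_mono[of "{k}" I q c] lq_norm_singleton[of q k c] assms by simp

lemma lq_norm_reindex:
  assumes "inj_on h I"
  shows "lq_norm q (h ` I) c = lq_norm q I (\<lambda>k. c (h k))"
  unfolding lq_norm_def using infsum_reindex[OF assms, of "\<lambda>k. ennreal (\<bar>c k\<bar> powr enn2real q)"]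
  by (simp add: image_image comp_def)

text \<open>On disjoint index sets the q-th powers add without loss; the constant comes from the
  root 1/q alone, by \<open>epowr_add\<close>.\<close>

definition qconst :: "ennreal \<Rightarrow> real" where
  "qconst q = (if q = \<infinity> then 1 else 2 powr (1 / enn2real q))"

lemma qconst_pos: "0 < qconst q"
  by (simp add: qconst_def)

lemma lq_norm_union:
  assumes "I \<inter> J = {}" "0 < q"
  shows "lq_norm q (I \<union> J) c \<le> ennreal (qconst q) * (lq_norm q I c + lq_norm q J c)"
proof (cases "q = \<infinity>")
  case True
  have "(SUP k\<in>I \<union> J. ennreal \<bar>c k\<bar>) \<le> (SUP k\<in>I. ennreal \<bar>c k\<bar>) + (SUP k\<in>J. ennreal \<bar>c k\<bar>)"
    by (rule SUP_least) (auto intro: add_increasing2 add_increasing SUP_upper)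
  then show ?thesis using True by (simp add: lq_norm_def qconst_def)
next
  case False
  let ?S = "\<lambda>I. \<Sum>\<^sub>\<infinity>k\<in>I. ennreal (\<bar>c k\<bar> powr enn2real q)"
  have "?S (I \<union> J) = ?S I + ?S J"
    using assms by (intro infsum_Un_disjoint nonneg_summable_on_complete) auto
  then show ?thesis
    using epowr_add[of "1 / enn2real q" "?S I" "?S J"] enn2real_pos[OF assms(2) False] False
    by (simp add: lq_norm_def qconst_def)
qed

text \<open>The sum in [0, \<infinity>] is the supremum of its finite partial sums, and a countable
  set has only countably many finite subsets.\<close>

lemma lq_norm_measurable:
  fixes c :: "'a \<Rightarrow> 'i \<Rightarrow> real"
  assumes I: "countable I" and [measurable]: "\<And>k. (\<lambda>x. c x k) \<in> borel_measurable M"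
  shows "(\<lambda>x. lq_norm q I (c x)) \<in> borel_measurable M"
proof (cases "q = \<infinity>")
  case True
  show ?thesis unfolding lq_norm_def using True I by (simp add: borel_measurable_SUP)
next
  case False
  have cnt: "countable {F. finite F \<and> F \<subseteq> I}"
    using countable_Collect_finite_subset[OF I] by (simp add: conj_commute)
  have "(\<lambda>x. SUP F\<in>{F. finite F \<and> F \<subseteq> I}. \<Sum>k\<in>F. ennreal (\<bar>c x k\<bar> powr enn2real q)) \<in> borel_measurable M"
    by (intro borel_measurable_SUP cnt) measurable
  then have [measurable]: "(\<lambda>x. \<Sum>\<^sub>\<infinity>k\<in>I. ennreal (\<bar>c x k\<bar> powr enn2real q)) \<in> borel_measurable M"
    by (subst nonneg_infsum_complete) auto
  show ?thesis unfolding lq_norm_def using False by simp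
qed

lemma sum_geometric_ints:
  fixes F :: "int set"
  assumes "finite F" "F \<subseteq> {..0}" "0 < e"
  shows "(\<Sum>k\<in>F. 2 powr (real_of_int k * e)) \<le> 1 / (1 - 2 powr (- e))"
proof -
  have r: "0 < (2::real) powr (- e)" "2 powr (- e) < (1::real)" using assms powr_less_mono[of "- e" 0 2] by auto
  have inj: "inj_on (\<lambda>k. nat (- k)) F"
  proof (rule inj_onI)
    fix x y assume "x \<in> F" "y \<in> F" "nat (- x) = nat (- y)"
    moreover from this have "x \<le> 0" "y \<le> 0" using assms(2) by auto
    ultimately show "x = y" by simp
  qed
  have "(\<Sum>k\<in>F. 2 powr (real_of_int k * e)) = (\<Sum>k\<in>F. (2 powr (- e)) ^ nat (- k))"
    using assms by (intro sum.cong refl) (auto simp: subset_iff powr_powr mult.commute simp flip: powr_realpow)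
  also have "\<dots> = (\<Sum>n\<in>(\<lambda>k. nat (- k)) ` F. (2 powr (- e)) ^ n)"
    using inj by (simp add: sum.reindex)
  also have "\<dots> \<le> (\<Sum>n. (2 powr (- e)) ^ n)"
    using r assms(1) by (intro sum_le_suminf summable_geometric) auto
  also have "\<dots> = 1 / (1 - 2 powr (- e))"
    using r by (intro suminf_geometric) auto
  finally show ?thesis .
qed

text \<open>The geometric weight turns the sequence norm into a supremum, which needs no triangle inequality.\<close>

lemma lq_norm_weighted_sup:
  assumes "0 < q" "0 < e"
  shows "\<exists>C>0. \<forall>I c. I \<subseteq> {..0::int} \<longrightarrow> lq_norm q I c \<le> ennreal C * (SUP k\<in>I. ennreal (2 powr (- (real_of_int k * e)) * \<bar>c k\<bar>))"
proof (cases "q = \<infinity>")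
  case True
  have "lq_norm q I c \<le> ennreal 1 * (SUP k\<in>I. ennreal (2 powr (- (real_of_int k * e)) * \<bar>c k\<bar>))" if "I \<subseteq> {..0}" for I c
    unfolding lq_norm_def using True
  proof (simp, intro SUP_mono)
    fix k assume k: "k \<in> I"
    then have "1 \<le> (2::real) powr (- (real_of_int k * e))"
      using that assms by (intro ge_one_powr_ge_zero) (auto simp: subset_iff mult_nonpos_nonneg)
    then have "1 * \<bar>c k\<bar> \<le> 2 powr (- (real_of_int k * e)) * \<bar>c k\<bar>" by (intro mult_right_mono) auto
    then show "\<exists>m\<in>I. ennreal \<bar>c k\<bar> \<le> ennreal (2 powr (- (real_of_int m * e)) * \<bar>c m\<bar>)"
      using k by (intro bexI[of _ k] ennreal_leI) auto
  qed
  then show ?thesis by (intro exI[of _ 1]) auto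
next
  case False
  define r where "r = enn2real q"
  have r: "0 < r" unfolding r_def by (rule enn2real_pos[OF assms(1) False])
  \<comment> \<open>The sum of the geometric series with ratio 2^(-e r), which bounds the q-th
    powers of the inverse weights.\<close>
  define G where "G = 1 / (1 - 2 powr (- (e * r)))"
  have G: "0 < G" using assms r powr_less_mono[of "- (e * r)" 0 2] by (simp add: G_def)
  have "lq_norm q I c \<le> ennreal (G powr (1 / r)) * (SUP k\<in>I. ennreal (2 powr (- (real_of_int k * e)) * \<bar>c k\<bar>))"
    (is "_ \<le> _ * ?M") if I: "I \<subseteq> {..0}" for I c
  proof -
    have "(\<Sum>\<^sub>\<infinity>k\<in>I. ennreal (\<bar>c k\<bar> powr r)) \<le> ennreal G * epowr ?M r"
    proof (subst nonneg_infsum_complete, simp, rule SUP_least, clarify)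
      fix F assume F: "finite F" "F \<subseteq> I"
      have "ennreal (\<bar>c k\<bar> powr r) \<le> ennreal (2 powr (real_of_int k * (e * r))) * epowr ?M r" if k: "k \<in> F" for k
      proof -
        have "ennreal (2 powr (- (real_of_int k * e)) * \<bar>c k\<bar>) \<le> ?M"
          using k F by (intro SUP_upper) auto
        then have "ennreal ((2 powr (- (real_of_int k * e)) * \<bar>c k\<bar>) powr r) \<le> epowr ?M r"
          using r epowr_mono[of "ennreal (2 powr (- (real_of_int k * e)) * \<bar>c k\<bar>)" ?M r] by (simp add: epowr_ennreal)
        then have "ennreal (2 powr (real_of_int k * (e * r))) * ennreal ((2 powr (- (real_of_int k * e)) * \<bar>c k\<bar>) powr r) \<le> ennreal (2 powr (real_of_int k * (e * r))) * epowr ?M r"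
          by (intro mult_left_mono) auto
        moreover have "2 powr (real_of_int k * (e * r)) * (2 powr (- (real_of_int k * e)) * \<bar>c k\<bar>) powr r = \<bar>c k\<bar> powr r"
          by (simp add: powr_mult powr_powr mult.assoc[symmetric] flip: powr_add)
        ultimately show ?thesis by (simp flip: ennreal_mult)
      qed
      then have "(\<Sum>k\<in>F. ennreal (\<bar>c k\<bar> powr r)) \<le> (\<Sum>k\<in>F. ennreal (2 powr (real_of_int k * (e * r))) * epowr ?M r)"
        by (rule sum_mono)
      also have "\<dots> = ennreal (\<Sum>k\<in>F. 2 powr (real_of_int k * (e * r))) * epowr ?M r"
      proof -
        have "(\<Sum>k\<in>F. ennreal (2 powr (real_of_int k * (e * r)))) = ennreal (\<Sum>k\<in>F. 2 powr (real_of_int k * (e * r)))"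
          by (rule sum_ennreal) simp
        then show ?thesis by (simp only: sum_distrib_right[symmetric])
      qed
      also have "\<dots> \<le> ennreal G * epowr ?M r"
        unfolding G_def using F I assms r by (intro mult_right_mono ennreal_leI sum_geometric_ints) auto
      finally show "(\<Sum>k\<in>F. ennreal (\<bar>c k\<bar> powr r)) \<le> ennreal G * epowr ?M r" .
    qed
    then have "epowr (\<Sum>\<^sub>\<infinity>k\<in>I. ennreal (\<bar>c k\<bar> powr r)) (1 / r) \<le> epowr (ennreal G * epowr ?M r) (1 / r)"
      using r by (intro epowr_mono) auto
    also have "\<dots> = ennreal (G powr (1 / r)) * ?M"
      using r G by (simp add: epowr_cmult epowr_inverse)
    finally show ?thesis using False by (simp add: lq_norm_def r_def)
  qed
  moreover have "0 < G powr (1 / r)" using G by simp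
  ultimately show ?thesis by blast
qed

section \<open>Morrey quasi-norms\<close>

lemma ball_volume_pos: "0 < R \<Longrightarrow> 0 < measure lborel (ball (y::'a::euclidean_space) R)"
  by (rule content_ball_pos)

lemma ball_volume_eq: "0 < R \<Longrightarrow> measure lborel (ball (y::'a::euclidean_space) R) = measure lborel (ball (c::'a) R)"
  by (simp add: content_ball)

text \<open>The volume of a ball does not depend on its centre. An inequality between suprema over
  centres, valid at every radius with the same \<open>A\<close>, therefore passes to the Morrey
  quasi-norms.\<close>

lemma morrey_norm_le:
  fixes G H :: "'a::euclidean_space \<Rightarrow> ennreal"
  assumes p: "0 < p" and A: "0 < A"
    and le: "\<And>R. 0 < R \<Longrightarrow> sup_ball R (\<lambda>x. epowr (H x) p) \<le> ennreal A * sup_ball R (\<lambda>x. epowr (G x) p)"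
  shows "morrey_norm u p H \<le> ennreal (A powr (1 / p)) * morrey_norm u p G"
  unfolding morrey_norm_def[of u p H]
proof (rule SUP_least, clarify)
  fix y :: 'a and R :: real assume R: "0 < R"
  let ?m = "morrey_norm u p G"
  \<comment> \<open>A positive real number, so it cancels in \<open>ennreal\<close> even when the
    quasi-norm is infinite.\<close>
  define c where "c = measure lborel (ball y R) powr (1 / u - 1 / p)"
  have c: "0 < c" unfolding c_def using ball_volume_pos[OF R, of y] by simp
  have "(\<integral>\<^sup>+x\<in>ball z R. epowr (G x) p \<partial>lborel) \<le> epowr (ennreal (1 / c) * ?m) p" for z
  proof -
    let ?I = "\<integral>\<^sup>+x\<in>ball z R. epowr (G x) p \<partial>lborel"
    have "ennreal (measure lborel (ball z R) powr (1 / u - 1 / p)) * epowr ?I (1 / p) \<le> ?m"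
      unfolding morrey_norm_def by (rule SUP_upper2[of "(z, R)"]) (use R in auto)
    then have "ennreal c * epowr ?I (1 / p) \<le> ?m"
      unfolding c_def ball_volume_eq[OF R, of y z] .
    then have "ennreal (1 / c) * (ennreal c * epowr ?I (1 / p)) \<le> ennreal (1 / c) * ?m"
      by (intro mult_left_mono) auto
    moreover have "ennreal (1 / c) * (ennreal c * epowr ?I (1 / p)) = epowr ?I (1 / p)"
      using c by (simp flip: mult.assoc ennreal_mult)
    ultimately have "epowr (epowr ?I (1 / p)) p \<le> epowr (ennreal (1 / c) * ?m) p"
      using p by (intro epowr_mono) auto
    then show ?thesis by (simp only: epowr_inverse'[OF p])
  qed
  then have "sup_ball R (\<lambda>x. epowr (G x) p) \<le> epowr (ennreal (1 / c) * ?m) p"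
    unfolding sup_ball_def by (rule SUP_least)
  then have "ennreal A * sup_ball R (\<lambda>x. epowr (G x) p) \<le> ennreal A * epowr (ennreal (1 / c) * ?m) p"
    by (intro mult_left_mono) auto
  then have "(\<integral>\<^sup>+x\<in>ball y R. epowr (H x) p \<partial>lborel) \<le> ennreal A * epowr (ennreal (1 / c) * ?m) p"
    using sup_ball_upper[of "\<lambda>x. epowr (H x) p" y R] le[OF R] by (meson order_trans)
  then have "epowr (\<integral>\<^sup>+x\<in>ball y R. epowr (H x) p \<partial>lborel) (1 / p) \<le> epowr (ennreal A * epowr (ennreal (1 / c) * ?m) p) (1 / p)"
    using p by (intro epowr_mono) auto
  also have "\<dots> = ennreal (A powr (1 / p)) * (ennreal (1 / c) * ?m)"
    using A p by (simp add: epowr_cmult[OF A] epowr_inverse)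
  finally have "ennreal c * epowr (\<integral>\<^sup>+x\<in>ball y R. epowr (H x) p \<partial>lborel) (1 / p) \<le> ennreal c * (ennreal (A powr (1 / p)) * (ennreal (1 / c) * ?m))"
    by (intro mult_left_mono) auto
  also have "\<dots> = (ennreal c * ennreal (1 / c)) * (ennreal (A powr (1 / p)) * ?m)"
    by (simp only: mult_ac)
  also have "ennreal c * ennreal (1 / c) = 1" using c by (simp flip: ennreal_mult)
  finally show "ennreal (measure lborel (ball y R) powr (1 / u - 1 / p)) * epowr (\<integral>\<^sup>+x\<in>ball y R. epowr (H x) p \<partial>lborel) (1 / p) \<le> ennreal (A powr (1 / p)) * ?m"
    by (simp add: c_def)
qed

lemma morrey_norm_mono:
  fixes G H :: "'a::euclidean_space \<Rightarrow> ennreal"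
  assumes "0 < p" "\<And>x. H x \<le> G x"
  shows "morrey_norm u p H \<le> morrey_norm u p G"
  using morrey_norm_le[OF assms(1), of 1 H G u] assms by (simp add: sup_ball_mono epowr_mono)

lemma morrey_norm_cmult:
  fixes G :: "'a::euclidean_space \<Rightarrow> ennreal"
  assumes "0 < p" "0 < k" and [measurable]: "G \<in> borel_measurable borel"
  shows "morrey_norm u p (\<lambda>x. ennreal k * G x) \<le> ennreal k * morrey_norm u p G"
proof -
  have "morrey_norm u p (\<lambda>x. ennreal k * G x) \<le> ennreal ((k powr p) powr (1 / p)) * morrey_norm u p G"
    using assms(1,2) by (intro morrey_norm_le) (simp_all add: epowr_cmult sup_ball_cmult)
  then show ?thesis using assms(1,2) by (simp add: powr_powr)
qed

text \<open>\<open>epowr_add\<close> is used twice: under the integral it gives 2^p, which becomes 2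
  after the root, and for the root itself it gives 2^(1/p).\<close>

lemma morrey_norm_add:
  fixes G H :: "'a::euclidean_space \<Rightarrow> ennreal"
  assumes p: "0 < p" and [measurable]: "G \<in> borel_measurable borel" "H \<in> borel_measurable borel"
  shows "morrey_norm u p (\<lambda>x. G x + H x) \<le> ennreal (2 * 2 powr (1 / p)) * (morrey_norm u p G + morrey_norm u p H)"
  unfolding morrey_norm_def[of u p "\<lambda>x. G x + H x"]
proof (rule SUP_least, clarify)
  fix y :: 'a and R :: real assume R: "0 < R"
  let ?I = "\<lambda>G. \<integral>\<^sup>+x\<in>ball y R. epowr (G x) p \<partial>lborel" and ?c = "ennreal (measure lborel (ball y R) powr (1 / u - 1 / p))"
  have "?I (\<lambda>x. G x + H x) \<le> (\<integral>\<^sup>+x. ennreal (2 powr p) * (epowr (G x) p * indicator (ball y R) x + epowr (H x) p * indicator (ball y R) x) \<partial>lborel)"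
    using epowr_add[OF p] by (intro nn_integral_mono) (auto simp: indicator_def)
  also have "\<dots> = ennreal (2 powr p) * (?I G + ?I H)"
    by (subst nn_integral_cmult, measurable, subst nn_integral_add, measurable)
  finally have "epowr (?I (\<lambda>x. G x + H x)) (1 / p) \<le> epowr (ennreal (2 powr p) * (?I G + ?I H)) (1 / p)"
    using p by (intro epowr_mono) auto
  also have "\<dots> = ennreal 2 * epowr (?I G + ?I H) (1 / p)"
    using p by (simp add: epowr_cmult powr_powr)
  also have "\<dots> \<le> ennreal 2 * (ennreal (2 powr (1 / p)) * (epowr (?I G) (1 / p) + epowr (?I H) (1 / p)))"
    using p by (intro mult_left_mono epowr_add) auto
  finally have "?c * epowr (?I (\<lambda>x. G x + H x)) (1 / p) \<le> ?c * (ennreal 2 * (ennreal (2 powr (1 / p)) * (epowr (?I G) (1 / p) + epowr (?I H) (1 / p))))"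
    by (intro mult_left_mono) auto
  also have "\<dots> = ennreal (2 * 2 powr (1 / p)) * (?c * epowr (?I G) (1 / p) + ?c * epowr (?I H) (1 / p))"
    by (subst ennreal_mult) (auto simp: distrib_left mult_ac)
  also have "\<dots> \<le> ennreal (2 * 2 powr (1 / p)) * (morrey_norm u p G + morrey_norm u p H)"
    unfolding morrey_norm_def using R
    by (intro mult_left_mono add_mono SUP_upper2[of "(y, R)"]) auto
  finally show "?c * epowr (?I (\<lambda>x. G x + H x)) (1 / p) \<le> ennreal (2 * 2 powr (1 / p)) * (morrey_norm u p G + morrey_norm u p H)" .
qed

section \<open>Low frequencies\<close>

context cutoff
begin

text \<open>By \<open>inv_fourier_cut\<close> all kernels are dilates of the kernel of order 0, so
  one Schwartz bound yields a \<open>B\<close> that does not depend on j.\<close>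

lemma kernel_bound: 
  "\<exists>B>0. \<forall>j z. norm (fconst TYPE('a) * inv_fourier (cut j) z) \<le> (B * (2 powi j) ^ DIM('a)) * (1 + 2 powi j * norm z) powr (- real L)"
proof -
  let ?\<kappa> = "\<lambda>z. fconst TYPE('a) * inv_fourier (cut 0) z"
  have \<kappa>: "?\<kappa> \<in> schwartz" by (intro schwartz_cmult inv_fourier_schwartz[OF cut_bump])
  obtain B where B: "B \<ge> 0" "\<And>z. (1 + norm z) ^ L * norm (?\<kappa> z) \<le> B"
    using schwartz_bound[OF \<kappa>, of "[]" L] by auto
  have "norm (fconst TYPE('a) * inv_fourier (cut j) z) \<le> ((B + 1) * (2 powi j) ^ DIM('a)) * (1 + 2 powi j * norm z) powr (- real L)" for j z
  proof -
    let ?t = "(2::real) powi j"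
    have p: "0 < 1 + ?t * norm z" by (simp add: add_pos_nonneg)
    have "(1 + ?t * norm z) ^ L * norm (?\<kappa> (?t *\<^sub>R z)) \<le> B + 1" using B(2)[of "?t *\<^sub>R z"] by (simp add: add_increasing2)
    then have "norm (?\<kappa> (?t *\<^sub>R z)) \<le> (B + 1) * (1 + ?t * norm z) powr (- real L)"
      using p by (simp add: powr_minus powr_realpow field_simps)
    then have "?t ^ DIM('a) * norm (?\<kappa> (?t *\<^sub>R z)) \<le> ?t ^ DIM('a) * ((B + 1) * (1 + ?t * norm z) powr (- real L))"
      by (intro mult_left_mono) auto
    moreover have "norm (fconst TYPE('a) * inv_fourier (cut j) z) = ?t ^ DIM('a) * norm (?\<kappa> (?t *\<^sub>R z))"
      unfolding inv_fourier_cut[of j z] norm_mult by (simp del: of_real_power add: power_abs)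
    ultimately show ?thesis by (simp only: mult_ac)
  qed
  then show ?thesis using B(1) by (intro exI[of _ "B + 1"]) auto
qed

lemma low_le_nn_integral:
  assumes T: "T \<in> tempered_distributions" and j: "j < 0"
    and W: "\<And>z. norm (fconst TYPE('a) * inv_fourier (cut j) z) \<le> W z"
  shows "ennreal (norm (low j T x)) \<le> (\<integral>\<^sup>+y. ennreal (W (x - y) * norm (low 0 T y)) \<partial>lborel)"
proof -
  let ?k = "\<lambda>z. fconst TYPE('a) * inv_fourier (cut j) z"
  have k: "?k \<in> schwartz" by (intro schwartz_cmult inv_fourier_schwartz[OF cut_bump])
  have "low j T x = (LINT y|lborel. fconst TYPE('a) * (low 0 T y * inv_fourier (cut j) (x - y)))"
    using low_conv[OF T j, of x] by (simp only: conv_def integral_mult_right_zero)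
  then have "low j T x = (LINT y|lborel. low 0 T y * ?k (x - y))"
    by (simp only: mult.left_commute)
  then have "ennreal (norm (low j T x)) \<le> (\<integral>\<^sup>+y. ennreal (norm (low 0 T y * ?k (x - y))) \<partial>lborel)"
    using integral_norm_bound_ennreal[OF conv_integrable[OF low_poly_growth[OF T, of 0] k, of x]] by simp
  also have "\<dots> \<le> (\<integral>\<^sup>+y. ennreal (W (x - y) * norm (low 0 T y)) \<partial>lborel)"
  proof (intro nn_integral_mono ennreal_leI)
    fix y show "norm (low 0 T y * ?k (x - y)) \<le> W (x - y) * norm (low 0 T y)"
      using mult_left_mono[OF W[of "x - y"], of "norm (low 0 T y)"] by (simp only: norm_mult mult_ac) simp
  qed
  finally show ?thesis .
qed

text \<open>Two convolutions are stacked: |S_j f|^p is bounded by \<open>W powr p\<close> convolved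
  with \<open>J\<close>, and \<open>J\<close> is |S_0 f|^p convolved with \<open>U\<close>. By
  \<open>sup_ball_conv\<close> each costs the integral of its kernel, and only that of
  \<open>W powr p\<close> depends on j.\<close>

lemma low_sup_ball_quasi:
  assumes p: "0 < p" "p \<le> 1"
  shows "\<exists>C>0. \<forall>T\<in>tempered_distributions. \<forall>j<0. \<forall>R.
    sup_ball R (lowp p j T) \<le>
    ennreal (C * (2 powi j) powr (- (p * sigma_p DIM('a) p))) * sup_ball R (lowp p 0 T)"
proof -
  let ?d = "real DIM('a)"
  \<comment> \<open>Makes \<open>p * real m\<close> at least d + 2, so that the weight with this
    decay is integrable. The same weight occurs in \<open>U\<close> and, dilated, in
    \<open>W powr p\<close>.\<close>
  define m where "m = nat \<lceil>(?d + 2) / p\<rceil>"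
  have m: "?d + 2 \<le> p * real m"
  proof -
    have "(?d + 2) / p \<le> real m" unfolding m_def by linarith
    then show ?thesis using p by (simp add: field_simps)
  qed
  \<comment> \<open>\<open>cut 1\<close> is 1 wherever \<open>cut 0\<close> does not vanish, so this
    kernel reproduces S_0 f as \<open>subharmonic\<close> demands.\<close>
  define \<kappa> where "\<kappa> = (\<lambda>z. fconst TYPE('a) * inv_fourier (cut 1) z)"
  have \<kappa>: "\<kappa> \<in> schwartz" unfolding \<kappa>_def by (intro schwartz_cmult inv_fourier_schwartz[OF cut_bump])
  obtain C1 where C1: "0 < C1" and sub: "\<And>g x. poly_growth g \<Longrightarrow> (\<And>x. g x = conv g \<kappa> x) \<Longrightarrow>
    ennreal (norm (g x) powr p) \<le> ennreal C1 * (peetre p m g x)"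
    using subharmonic[OF p \<kappa>, of m] by blast
  obtain B where B: "0 < B" and kb: "\<And>j z. norm (fconst TYPE('a) * inv_fourier (cut j) z) \<le> (B * (2 powi j) ^ DIM('a)) * (1 + 2 powi j * norm z) powr (- real m)"
    using kernel_bound by blast
  obtain \<Omega> where \<Omega>: "0 \<le> \<Omega>" "(\<integral>\<^sup>+z. ennreal ((1 + norm (z::'a)) powr (- (p * real m))) \<partial>lborel) = ennreal \<Omega>"
    using nn_weight_finite[OF m] by (cases "\<integral>\<^sup>+z. ennreal ((1 + norm (z::'a)) powr (- (p * real m))) \<partial>lborel") auto
  \<comment> \<open>Moving the centre by less than 1 changes the weight in \<open>J\<close> by at
    most this factor; it is the slow variation that \<open>conv_bound_quasi\<close> asks
    for.\<close>
  define \<beta> where "\<beta> = 2 powr (p * real m)"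
  define K where "K = (C1 * (2 powr (real m * p) * \<beta>) / unit_ball_vol ?d) powr (1 - p) * C1 powr p"
  have K: "0 \<le> K" by (simp add: K_def)
  define C where "C = K * (B powr p * \<Omega>) * \<Omega> + 1"
  have C: "0 < C" using K \<Omega> by (simp add: C_def add_nonneg_pos)
  have sig: "p * sigma_p DIM('a) p = ?d * (1 - p)"
    using p by (simp add: sigma_p_def max_def field_simps)
  have "sup_ball R (lowp p j T) \<le>
    ennreal (C * (2 powi j) powr (- (p * sigma_p DIM('a) p))) * sup_ball R (lowp p 0 T)"
    if T: "T \<in> tempered_distributions" and j: "j < 0" for T j R
  proof -
    let ?g = "low 0 T"
    note [measurable] = low_measurable[OF T]
    define t where "t = (2::real) powi j"
    have t: "0 < t" "t \<le> 1" using j power_int_increasing[of j 0 "2::real"] by (auto simp: t_def)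
    define W where "W = (\<lambda>z::'a. (B * t ^ DIM('a)) * (1 + t * norm z) powr (- real m))"
    have [measurable]: "W \<in> borel_measurable borel" unfolding W_def by measurable
    have kbW: "norm (fconst TYPE('a) * inv_fourier (cut j) z) \<le> W z" for z
      unfolding W_def t_def by (rule kb)
    define A where "A = (\<lambda>x. ennreal (norm (?g x) powr p))"
    have [measurable]: "A \<in> borel_measurable borel" unfolding A_def by measurable
    define U where "U = (\<lambda>z::'a. ennreal ((1 + norm z) powr (- (p * real m))))"
    have [measurable]: "U \<in> borel_measurable borel" unfolding U_def by measurable
    define J where "J = (\<lambda>x. \<integral>\<^sup>+z. U (x - z) * A z \<partial>lborel)"
    have [measurable]: "J \<in> borel_measurable borel" unfolding J_def by measurable
    have Jeq: "J x = (peetre p m ?g x)" for x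
      unfolding J_def U_def A_def by (simp add: ennreal_mult mult.commute)
    have "?g x = conv ?g \<kappa> x" for x
      using low_reproducing[OF T, of 0 1 x] by (simp only: \<kappa>_def conv_def mult.left_commute[of "low 0 T _"] integral_mult_right_zero)
    then have sub': "ennreal (norm (?g y) powr p) \<le> ennreal C1 * J y" for y
      unfolding Jeq by (intro sub low_poly_growth[OF T])
    have Jd: "J y \<le> ennreal \<beta> * J y'" if n: "norm (y - y') < 1" for y y'
    proof -
      have "J y \<le> (\<integral>\<^sup>+z. ennreal \<beta> * (U (y' - z) * A z) \<partial>lborel)"
        unfolding J_def
      proof (rule nn_integral_mono)
        fix z
        have "(1 + norm (y - z)) powr (- (p * real m)) \<le> (1 + norm (y' - y)) powr (p * real m) * (1 + norm (y' - z)) powr (- (p * real m))"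
          using p by (intro weight_mult_mono) auto
        also have "\<dots> \<le> \<beta> * (1 + norm (y' - z)) powr (- (p * real m))"
          unfolding \<beta>_def using n p by (intro mult_right_mono powr_mono2) (auto simp: norm_minus_commute)
        finally have "U (y - z) \<le> ennreal \<beta> * U (y' - z)"
          unfolding U_def by (simp add: \<beta>_def ennreal_leI flip: ennreal_mult)
        then show "U (y - z) * A z \<le> ennreal \<beta> * (U (y' - z) * A z)"
          by (simp add: mult_right_mono flip: mult.assoc)
      qed
      also have "\<dots> = ennreal \<beta> * J y'" unfolding J_def by (rule nn_integral_cmult) measurable
      finally show ?thesis .
    qed
    have pt: "ennreal (norm (low j T x) powr p) \<le> ennreal K * (\<integral>\<^sup>+y. ennreal (W (x - y) powr p) * J y \<partial>lborel)" for x
    proof -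
      have "ennreal (norm (low j T x) powr p) = epowr (ennreal (norm (low j T x))) p" by (simp add: epowr_ennreal)
      also have "\<dots> \<le> epowr (\<integral>\<^sup>+y. ennreal (W (x - y) * norm (?g y)) \<partial>lborel) p"
        using p by (intro epowr_mono low_le_nn_integral[OF T j kbW]) auto
      also have "\<dots> \<le> ennreal K * (\<integral>\<^sup>+y. ennreal (W (x - y) powr p) * J y \<partial>lborel)"
        unfolding K_def
        by (rule conv_bound_quasi[where B = "B * t ^ DIM('a)" and L = "real m" and W = W, OF p t _ C1 _ _ sub' Jd]) (use B t in \<open>auto simp: W_def \<beta>_def\<close>)
      finally show ?thesis .
    qed
    have "sup_ball R (lowp p j T) \<le> sup_ball R (\<lambda>x. ennreal K * (\<integral>\<^sup>+y. ennreal (W (x - y) powr p) * J y \<partial>lborel))"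
      by (rule sup_ball_mono) (rule pt)
    also have "\<dots> \<le> ennreal K * sup_ball R (\<lambda>x. \<integral>\<^sup>+y. ennreal (W (x - y) powr p) * J y \<partial>lborel)"
      by (rule sup_ball_cmult) measurable
    also have "\<dots> \<le> ennreal K * ((\<integral>\<^sup>+z. ennreal (W z powr p) \<partial>lborel) * sup_ball R J)"
      by (intro mult_left_mono sup_ball_conv) auto
    also have "sup_ball R J \<le> ennreal \<Omega> * sup_ball R A"
      unfolding J_def \<Omega>(2)[symmetric] U_def[symmetric] by (rule sup_ball_conv) measurable
    \<comment> \<open>The normalisation contributes t^(d p) and the dilation of the variable t^(-d).
      With t = 2^j the product is 2^(-j p \<sigma>): this is where \<sigma> enters.\<close>
    also have "(\<integral>\<^sup>+z. ennreal (W z powr p) \<partial>lborel) = ennreal (B powr p * \<Omega> * t powr (- (?d * (1 - p))))"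
    proof -
      have "W z powr p = B powr p * t powr (?d * p) * (1 + t * norm z) powr (- (p * real m))" for z
        using B t by (simp add: W_def powr_mult powr_powr mult.commute flip: powr_realpow)
      then have "(\<integral>\<^sup>+z. ennreal (W z powr p) \<partial>lborel) = (\<integral>\<^sup>+z. ennreal (B powr p * t powr (?d * p)) * ennreal ((1 + t * norm (z::'a)) powr (- (p * real m))) \<partial>lborel)"
        by (simp add: ennreal_mult)
      also have "\<dots> = ennreal (B powr p * t powr (?d * p)) * (ennreal (t powr (- ?d)) * ennreal \<Omega>)"
        by (subst nn_integral_cmult) (auto simp: nn_weight_scale[OF t(1)] \<Omega>)
      also have "\<dots> = ennreal (B powr p * (t powr (?d * p) * t powr (- ?d)) * \<Omega>)"
        using \<Omega> by (simp add: mult_ac flip: ennreal_mult)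
      also have "t powr (?d * p) * t powr (- ?d) = t powr (- (?d * (1 - p)))"
        by (simp add: algebra_simps flip: powr_add)
      finally show ?thesis by (simp add: mult_ac)
    qed
    finally have "sup_ball R (lowp p j T) \<le> ennreal K * (ennreal (B powr p * \<Omega> * t powr (- (?d * (1 - p)))) * (ennreal \<Omega> * sup_ball R A))"
      by (simp add: mult_left_mono)
    also have "\<dots> = ennreal (K * (B powr p * \<Omega>) * \<Omega> * t powr (- (?d * (1 - p)))) * sup_ball R A"
      using K \<Omega> by (simp add: ennreal_mult mult_ac)
    also have "\<dots> \<le> ennreal (C * t powr (- (?d * (1 - p)))) * sup_ball R A"
      by (intro mult_right_mono ennreal_leI) (auto simp: C_def)
    finally show ?thesis by (simp add: A_def t_def sig)
  qed
  then show ?thesis using C by blast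
qed

text \<open>Here the kernel enters with its first power, and the integral of \<open>W\<close> does
  not depend on j: t^d from the normalisation cancels t^(-d) from the dilation. Nothing is lost, in
  accordance with \<sigma> = 0.\<close>

lemma low_sup_ball_convex:
  assumes p: "1 \<le> p"
  shows "\<exists>C>0. \<forall>T\<in>tempered_distributions. \<forall>j<0. \<forall>R.
    sup_ball R (lowp p j T) \<le>
    ennreal (C * (2 powi j) powr (- (p * sigma_p DIM('a) p))) * sup_ball R (lowp p 0 T)"
proof -
  let ?d = "real DIM('a)"
  define m where "m = DIM('a) + 2"
  obtain B where B: "0 < B" and kb: "\<And>j z. norm (fconst TYPE('a) * inv_fourier (cut j) z) \<le> (B * (2 powi j) ^ DIM('a)) * (1 + 2 powi j * norm z) powr (- real m)"
    using kernel_bound by blast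
  have m: "?d + 2 \<le> real m" by (simp add: m_def)
  obtain \<Omega> where \<Omega>: "0 \<le> \<Omega>" "(\<integral>\<^sup>+z. ennreal ((1 + norm (z::'a)) powr (- real m)) \<partial>lborel) = ennreal \<Omega>"
    using nn_weight_finite[OF m] by (cases "\<integral>\<^sup>+z. ennreal ((1 + norm (z::'a)) powr (- real m)) \<partial>lborel") auto
  define C where "C = (B * \<Omega> + 1) powr p * (B * \<Omega>) + 1"
  have C: "0 < C" using B \<Omega> by (simp add: C_def add_nonneg_pos)
  have sig: "sigma_p DIM('a) p = 0"
    using p by (simp add: sigma_p_def max_def field_simps)
  have "sup_ball R (lowp p j T) \<le>
    ennreal (C * (2 powi j) powr (- (p * sigma_p DIM('a) p))) * sup_ball R (lowp p 0 T)"
    if T: "T \<in> tempered_distributions" and j: "j < 0" for T j R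
  proof -
    let ?g = "low 0 T"
    note [measurable] = low_measurable[OF T]
    define t where "t = (2::real) powi j"
    have t: "0 < t" by (simp add: t_def)
    define W where "W = (\<lambda>z::'a. (B * t ^ DIM('a)) * (1 + t * norm z) powr (- real m))"
    have [measurable]: "W \<in> borel_measurable borel" unfolding W_def by measurable
    have kbW: "norm (fconst TYPE('a) * inv_fourier (cut j) z) \<le> W z" for z
      unfolding W_def t_def by (rule kb)
    have W0: "0 \<le> W z" for z using B t by (simp add: W_def)
    define A where "A = (\<lambda>x. ennreal (norm (?g x) powr p))"
    have [measurable]: "A \<in> borel_measurable borel" unfolding A_def by measurable
    have Wint: "(\<integral>\<^sup>+z. ennreal (W z) \<partial>lborel) = ennreal (B * \<Omega>)"
    proof -
      have "(\<integral>\<^sup>+z. ennreal (W z) \<partial>lborel) = (\<integral>\<^sup>+z. ennreal (B * t ^ DIM('a)) * ennreal ((1 + t * norm (z::'a)) powr (- real m)) \<partial>lborel)"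
        using B t by (simp add: W_def ennreal_mult)
      also have "\<dots> = ennreal (B * t ^ DIM('a)) * (ennreal (t powr (- ?d)) * ennreal \<Omega>)"
        by (subst nn_integral_cmult) (auto simp: nn_weight_scale[OF t] \<Omega>)
      also have "\<dots> = ennreal (B * (t ^ DIM('a) * t powr (- ?d)) * \<Omega>)"
        using \<Omega> B t by (simp add: mult_ac flip: ennreal_mult)
      also have "t ^ DIM('a) * t powr (- ?d) = 1" using t by (simp add: powr_minus powr_realpow)
      finally show ?thesis by simp
    qed
    have pt: "ennreal (norm (low j T x) powr p) \<le> ennreal ((B * \<Omega> + 1) powr p) * (\<integral>\<^sup>+y. ennreal (W (x - y)) * A y \<partial>lborel)" for x
    proof -
      have "ennreal (norm (low j T x) powr p) = epowr (ennreal (norm (low j T x))) p" by (simp add: epowr_ennreal)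
      also have "\<dots> \<le> epowr (\<integral>\<^sup>+y. ennreal (W (x - y) * norm (?g y)) \<partial>lborel) p"
        using p by (intro epowr_mono low_le_nn_integral[OF T j kbW]) auto
      also have "\<dots> \<le> ennreal ((B * \<Omega> + 1) powr p) * (\<integral>\<^sup>+y. ennreal (W (x - y) * norm (?g y) powr p) \<partial>lborel)"
        by (rule conv_bound_convex[OF p]) (use B \<Omega> W0 Wint in auto)
      finally show ?thesis using W0 by (simp add: A_def ennreal_mult)
    qed
    have "sup_ball R (lowp p j T) \<le> sup_ball R (\<lambda>x. ennreal ((B * \<Omega> + 1) powr p) * (\<integral>\<^sup>+y. ennreal (W (x - y)) * A y \<partial>lborel))"
      by (rule sup_ball_mono) (rule pt)
    also have "\<dots> \<le> ennreal ((B * \<Omega> + 1) powr p) * sup_ball R (\<lambda>x. \<integral>\<^sup>+y. ennreal (W (x - y)) * A y \<partial>lborel)"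
      by (rule sup_ball_cmult) measurable
    also have "\<dots> \<le> ennreal ((B * \<Omega> + 1) powr p) * (ennreal (B * \<Omega>) * sup_ball R A)"
      unfolding Wint[symmetric] by (intro mult_left_mono sup_ball_conv) auto
    also have "\<dots> = ennreal ((B * \<Omega> + 1) powr p * (B * \<Omega>)) * sup_ball R A"
      using B \<Omega> by (simp add: ennreal_mult mult.assoc)
    also have "\<dots> \<le> ennreal C * sup_ball R A"
      by (intro mult_right_mono ennreal_leI) (auto simp: C_def)
    finally show ?thesis using t by (simp add: A_def sig t_def)
  qed
  then show ?thesis using C by blast
qed

lemma low_sup_ball:
  assumes p: "0 < p"
  shows "\<exists>C>0. \<forall>T\<in>tempered_distributions. \<forall>j\<le>0. \<forall>R.
    sup_ball R (lowp p j T) \<le>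
    ennreal (C * (2 powi j) powr (- (p * sigma_p DIM('a) p))) * sup_ball R (lowp p 0 T)"
proof -
  have "\<exists>C>0. \<forall>T\<in>tempered_distributions. \<forall>j<0. \<forall>R.
    sup_ball R (lowp p j T) \<le>
    ennreal (C * (2 powi j) powr (- (p * sigma_p DIM('a) p))) * sup_ball R (lowp p 0 T)"
    using low_sup_ball_quasi[OF p] low_sup_ball_convex[of p] by (cases "p \<le> 1") simp_all
  then obtain C where C: "0 < C" and le: "\<And>T j R. T \<in> tempered_distributions \<Longrightarrow> j < 0 \<Longrightarrow>
    sup_ball R (lowp p j T) \<le>
    ennreal (C * (2 powi j) powr (- (p * sigma_p DIM('a) p))) * sup_ball R (lowp p 0 T)"
    by blast
  have "sup_ball R (lowp p j T) \<le>
    ennreal ((C + 1) * (2 powi j) powr (- (p * sigma_p DIM('a) p))) * sup_ball R (lowp p 0 T)"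
    if T: "T \<in> tempered_distributions" and j: "j \<le> 0" for T j R
  proof (cases "j = 0")
    case True
    have "ennreal 1 * sup_ball R (lowp p 0 T) \<le> ennreal (C + 1) * sup_ball R (lowp p 0 T)"
      using C by (intro mult_right_mono ennreal_leI) auto
    then show ?thesis using True by simp
  next
    case False
    have "ennreal (C * (2 powi j) powr (- (p * sigma_p DIM('a) p))) \<le> ennreal ((C + 1) * (2 powi j) powr (- (p * sigma_p DIM('a) p)))"
      by (intro ennreal_leI mult_right_mono) auto
    then show ?thesis using le[OF T, of j R] j False by (meson le_less mult_right_mono order_trans zero_le)
  qed
  then show ?thesis using C by (intro exI[of _ "C + 1"]) auto
qed

end

section \<open>Equivalence of the quasi-norms\<close>

lemma sup_ball_add:
  assumes [measurable]: "A \<in> borel_measurable borel" "B \<in> borel_measurable borel"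
  shows "sup_ball R (\<lambda>x. A x + B x) \<le> sup_ball R A + sup_ball R B"
  unfolding sup_ball_def[of R "\<lambda>x. A x + B x"]
proof (rule SUP_least)
  fix c
  have "(\<integral>\<^sup>+x\<in>ball c R. A x + B x \<partial>lborel) = (\<integral>\<^sup>+x\<in>ball c R. A x \<partial>lborel) + (\<integral>\<^sup>+x\<in>ball c R. B x \<partial>lborel)"
    unfolding distrib_right by (rule nn_integral_add) measurable
  also have "\<dots> \<le> sup_ball R A + sup_ball R B" by (intro add_mono sup_ball_upper)
  finally show "(\<integral>\<^sup>+x\<in>ball c R. A x + B x \<partial>lborel) \<le> sup_ball R A + sup_ball R B" .
qed

lemma sup_ball_suminf:
  assumes [measurable]: "\<And>n. A n \<in> borel_measurable borel"
  shows "sup_ball R (\<lambda>x. \<Sum>n. A n x) \<le> (\<Sum>n. sup_ball R (A n))"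
  unfolding sup_ball_def[of R "\<lambda>x. \<Sum>n. A n x"]
proof (rule SUP_least)
  fix c
  have "(\<integral>\<^sup>+x\<in>ball c R. (\<Sum>n. A n x) \<partial>lborel) = (\<integral>\<^sup>+x. (\<Sum>n. A n x * indicator (ball c R) x) \<partial>lborel)"
    by simp
  also have "\<dots> = (\<Sum>n. \<integral>\<^sup>+x\<in>ball c R. A n x \<partial>lborel)"
    by (rule nn_integral_suminf) measurable
  also have "\<dots> \<le> (\<Sum>n. sup_ball R (A n))" by (intro suminf_le sup_ball_upper) auto
  finally show "(\<integral>\<^sup>+x\<in>ball c R. (\<Sum>n. A n x) \<partial>lborel) \<le> (\<Sum>n. sup_ball R (A n))" .
qed

lemma lq_norm_cong: "(\<And>k. k \<in> I \<Longrightarrow> c k = d k) \<Longrightarrow> lq_norm q I c = lq_norm q I d"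
  unfolding lq_norm_def by (auto intro!: arg_cong2[where f = epowr] infsum_cong)

text \<open>One half of \<open>equivalent_on\<close>. It is a preorder compatible with sums and
  positive factors, so every estimate can keep its own constant.\<close>

definition dominated_on :: "'f set \<Rightarrow> ('f \<Rightarrow> ennreal) \<Rightarrow> ('f \<Rightarrow> ennreal) \<Rightarrow> bool" where
  "dominated_on S A B \<longleftrightarrow> (\<exists>C::real. 0 < C \<and> (\<forall>f\<in>S. A f \<le> ennreal C * B f))"

lemma dominated_onI: "0 < C \<Longrightarrow> (\<And>f. f \<in> S \<Longrightarrow> A f \<le> ennreal C * B f) \<Longrightarrow> dominated_on S A B"
  by (auto simp: dominated_on_def)

lemma dominated_on_le: "(\<And>f. f \<in> S \<Longrightarrow> A f \<le> B f) \<Longrightarrow> dominated_on S A B"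
  by (rule dominated_onI[of 1]) auto

lemma dominated_on_trans:
  assumes "dominated_on S A B" "dominated_on S B D"
  shows "dominated_on S A D"
proof -
  obtain C C' where C: "0 < C" "\<And>f. f \<in> S \<Longrightarrow> A f \<le> ennreal C * B f"
    and C': "0 < C'" "\<And>f. f \<in> S \<Longrightarrow> B f \<le> ennreal C' * D f"
    using assms unfolding dominated_on_def by blast
  show ?thesis
  proof (rule dominated_onI[of "C * C'"])
    fix f assume f: "f \<in> S"
    have "ennreal C * B f \<le> ennreal C * (ennreal C' * D f)" by (intro mult_left_mono C' f) auto
    then show "A f \<le> ennreal (C * C') * D f"
      using C(2)[OF f] C C' by (simp add: ennreal_mult mult.assoc order_trans)
  qed (use C C' in simp)
qed

lemma dominated_on_add:
  assumes "dominated_on S A D" "dominated_on S B D"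
  shows "dominated_on S (\<lambda>f. A f + B f) D"
proof -
  obtain C C' where C: "0 < C" "\<And>f. f \<in> S \<Longrightarrow> A f \<le> ennreal C * D f"
    and C': "0 < C'" "\<And>f. f \<in> S \<Longrightarrow> B f \<le> ennreal C' * D f"
    using assms unfolding dominated_on_def by blast
  show ?thesis
  proof (rule dominated_onI[of "C + C'"])
    fix f assume f: "f \<in> S"
    have "A f + B f \<le> ennreal C * D f + ennreal C' * D f" by (intro add_mono C C' f)
    then show "A f + B f \<le> ennreal (C + C') * D f" using C C' by (simp add: distrib_right)
  qed (use C C' in simp)
qed

lemma dominated_on_cmult:
  assumes "dominated_on S A D" "0 < k" shows "dominated_on S (\<lambda>f. ennreal k * A f) D"
  by (rule dominated_on_trans[OF _ assms(1)], rule dominated_onI[OF assms(2)]) simp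

lemma equivalent_on_iff: "equivalent_on S A B \<longleftrightarrow> dominated_on S A B \<and> dominated_on S B A"
proof
  assume d: "dominated_on S A B \<and> dominated_on S B A"
  then obtain C C' where C: "0 < C" "\<And>f. f \<in> S \<Longrightarrow> A f \<le> ennreal C * B f"
    and C': "0 < C'" "\<And>f. f \<in> S \<Longrightarrow> B f \<le> ennreal C' * A f"
    unfolding dominated_on_def by blast
  have le: "ennreal C * x \<le> ennreal (max C C') * x" "ennreal C' * x \<le> ennreal (max C C') * x" for x
    by (intro mult_right_mono ennreal_leI; simp)+
  then show "equivalent_on S A B"
    unfolding equivalent_on_def
  proof (intro exI[of _ "max C C'"] conjI ballI)
    show "0 < max C C'" using C by simp
    show "A f \<le> ennreal (max C C') * B f" if "f \<in> S" for f
      using C(2)[OF that] le(1) by (rule order_trans)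
    show "B f \<le> ennreal (max C C') * A f" if "f \<in> S" for f
      using C'(2)[OF that] le(2) by (rule order_trans)
  qed
qed (auto simp: equivalent_on_def dominated_on_def)

lemma equivalent_on_via:
  assumes "dominated_on S A D" "dominated_on S D A" "dominated_on S B D" "dominated_on S D B"
  shows "equivalent_on S A B"
  unfolding equivalent_on_iff using assms dominated_on_trans by blast

lemma two_powi_powr: "((2::real) powi k) powr y = 2 powr (real_of_int k * y)"
  by (subst powr_real_of_int'[symmetric]) (auto simp: powr_powr)

context cutoff
begin

section \<open>Blocks of non-positive frequency\<close>

definition block :: "real \<Rightarrow> (('a \<Rightarrow> complex) \<Rightarrow> complex) \<Rightarrow> 'a \<Rightarrow> int \<Rightarrow> real" where
  "block s T x k = 2 powr (real_of_int k * s) * norm (low k T x - low (k - 1) T x)"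

lemma block_nonneg: "0 \<le> block s T x k"
  by (simp add: block_def)

lemma block_measurable:
  assumes "T \<in> tempered_distributions"
  shows "(\<lambda>x. block s T x k) \<in> borel_measurable borel"
proof -
  note [measurable] = low_measurable[OF assms]
  show ?thesis unfolding block_def by measurable
qed

text \<open>A block is a weighted difference of two neighbouring pieces. The weight 2^(k s) against
  the loss 2^(-k \<sigma>) leaves a factor that decays as k tends to minus infinity when s >
  \<sigma>.\<close>

lemma block_sup_ball:
  assumes p: "0 < p"
  shows "\<exists>E>0. \<forall>T\<in>tempered_distributions. \<forall>k\<le>0. \<forall>R.
    sup_ball R (\<lambda>x. ennreal (block s T x k powr p)) \<le>
    ennreal (E * 2 powr (real_of_int k * (p * (s - sigma_p DIM('a) p)))) * sup_ball R (lowp p 0 T)"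
proof -
  let ?\<sigma> = "sigma_p DIM('a) p"
  obtain C where C: "0 < C" and le: "\<And>T j R. T \<in> tempered_distributions \<Longrightarrow> j \<le> 0 \<Longrightarrow>
    sup_ball R (lowp p j T) \<le>
    ennreal (C * (2 powi j) powr (- (p * ?\<sigma>))) * sup_ball R (lowp p 0 T)"
    using low_sup_ball[OF p] by blast
  \<comment> \<open>2^p comes from \<open>epowr_add\<close>; the summand
    \<open>2 powr (p * ?\<sigma>)\<close> accounts for the piece of index k - 1, which loses one
    more factor.\<close>
  define E where "E = 2 powr p * C * (1 + 2 powr (p * ?\<sigma>))"
  have E: "0 < E" using C by (simp add: E_def add_pos_pos)
  have "sup_ball R (\<lambda>x. ennreal (block s T x k powr p)) \<le>
    ennreal (E * 2 powr (real_of_int k * (p * (s - ?\<sigma>)))) * sup_ball R (lowp p 0 T)"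
    (is "_ \<le> _ * ?G") if T: "T \<in> tempered_distributions" and k: "k \<le> 0" for T k R
  proof -
    note [measurable] = low_measurable[OF T]
    define c where "c = 2 powr (real_of_int k * s * p) * 2 powr p"
    have c: "0 < c" by (simp add: c_def)
    have "ennreal (block s T x k powr p) \<le> ennreal c * (ennreal (norm (low k T x) powr p) + ennreal (norm (low (k - 1) T x) powr p))" for x
    proof -
      have "ennreal (norm (low k T x - low (k - 1) T x) powr p) \<le> epowr (ennreal (norm (low k T x)) + ennreal (norm (low (k - 1) T x))) p"
        using p by (subst epowr_ennreal[symmetric]) (auto intro!: epowr_mono norm_triangle_ineq4 ennreal_leI simp flip: ennreal_plus)
      also have "\<dots> \<le> ennreal (2 powr p) * (ennreal (norm (low k T x) powr p) + ennreal (norm (low (k - 1) T x) powr p))"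
        using epowr_add[OF p, of "ennreal (norm (low k T x))" "ennreal (norm (low (k - 1) T x))"] by (simp add: epowr_ennreal)
      finally have "ennreal (2 powr (real_of_int k * s * p)) * ennreal (norm (low k T x - low (k - 1) T x) powr p) \<le>
          ennreal (2 powr (real_of_int k * s * p)) * (ennreal (2 powr p) * (ennreal (norm (low k T x) powr p) + ennreal (norm (low (k - 1) T x) powr p)))"
        by (intro mult_left_mono) auto
      then show ?thesis
        by (simp add: block_def c_def powr_mult powr_powr ennreal_mult mult.assoc)
    qed
    then have "sup_ball R (\<lambda>x. ennreal (block s T x k powr p)) \<le>
        sup_ball R (\<lambda>x. ennreal c * (ennreal (norm (low k T x) powr p) + ennreal (norm (low (k - 1) T x) powr p)))"
      by (rule sup_ball_mono)
    also have "\<dots> \<le> ennreal c * sup_ball R (\<lambda>x. ennreal (norm (low k T x) powr p) + ennreal (norm (low (k - 1) T x) powr p))"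
      by (rule sup_ball_cmult) measurable
    also have "\<dots> \<le> ennreal c * (sup_ball R (lowp p k T) + sup_ball R (lowp p (k - 1) T))"
      by (intro mult_left_mono sup_ball_add) auto
    also have "\<dots> \<le> ennreal c * (ennreal (C * (2 powi k) powr (- (p * ?\<sigma>))) * ?G + ennreal (C * (2 powi (k - 1)) powr (- (p * ?\<sigma>))) * ?G)"
      using k by (intro mult_left_mono add_mono le T) auto
    also have "\<dots> = ennreal (c * (C * (2 powi k) powr (- (p * ?\<sigma>)) + C * (2 powi (k - 1)) powr (- (p * ?\<sigma>)))) * ?G"
      using c C by (simp add: ennreal_mult distrib_right mult.assoc)
    also have "c * (C * (2 powi k) powr (- (p * ?\<sigma>)) + C * (2 powi (k - 1)) powr (- (p * ?\<sigma>))) = E * 2 powr (real_of_int k * (p * (s - ?\<sigma>)))"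
    proof -
      have 1: "((2::real) powi (k - 1)) powr (- (p * ?\<sigma>)) = 2 powr (real_of_int k * (- (p * ?\<sigma>))) * 2 powr (p * ?\<sigma>)"
        unfolding two_powi_powr by (simp add: algebra_simps flip: powr_add)
      have 2: "2 powr (real_of_int k * s * p) * 2 powr (real_of_int k * (- (p * ?\<sigma>))) = 2 powr (real_of_int k * (p * (s - ?\<sigma>)))"
        by (simp add: algebra_simps flip: powr_add)
      have "c * (C * (2 powi k) powr (- (p * ?\<sigma>)) + C * (2 powi (k - 1)) powr (- (p * ?\<sigma>))) =
         E * (2 powr (real_of_int k * s * p) * 2 powr (real_of_int k * (- (p * ?\<sigma>))))"
        unfolding 1 unfolding two_powi_powr c_def E_def by (simp add: distrib_left distrib_right mult_ac)
      then show ?thesis by (simp only: 2)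
    qed
    finally show ?thesis .
  qed
  then show ?thesis using E by blast
qed

text \<open>Summation takes place on the level of p-th powers integrated over balls, where countable
  subadditivity holds for every p. The alternative in the hypothesis is what makes the coefficients
  \<open>f n\<close> summable.\<close>

lemma low_blocks_dominated:
  assumes p: "0 < p" and q: "0 < q" and I: "I \<subseteq> {..0}" and cases: "finite I \<or> sigma_p DIM('a) p < s"
  shows "dominated_on tempered_distributions (\<lambda>T. morrey_norm u p (\<lambda>x. lq_norm q I (block s T x)))
     (\<lambda>T. morrey_norm u p (\<lambda>x. ennreal (norm (low 0 T x))))"
proof -
  let ?\<sigma> = "sigma_p DIM('a) p"
  \<comment> \<open>Half of the gap s - \<sigma> pays for replacing the sequence norm by a weighted
    supremum; the other half leaves a convergent geometric series. If there is no gap,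
    \<open>I\<close> is finite and any positive number will do.\<close>
  define e where "e = (if ?\<sigma> < s then (s - ?\<sigma>) / 2 else 1)"
  have e: "0 < e" by (simp add: e_def)
  obtain D where D: "0 < D" and Dle: "\<And>c. lq_norm q I c \<le> ennreal D * (SUP k\<in>I. ennreal (2 powr (- (real_of_int k * e)) * \<bar>c k\<bar>))"
    using lq_norm_weighted_sup[OF q e] I by blast
  obtain E where E: "0 < E" and Ele: "\<And>T k R. T \<in> tempered_distributions \<Longrightarrow> k \<le> 0 \<Longrightarrow>
    sup_ball R (\<lambda>x. ennreal (block s T x k powr p)) \<le>
    ennreal (E * 2 powr (real_of_int k * (p * (s - ?\<sigma>)))) * sup_ball R (lowp p 0 T)"
    using block_sup_ball[OF p] by blast
  define r where "r = 2 powr (p * (e - (s - ?\<sigma>)))"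
  \<comment> \<open>The coefficient in the bound for the block of index -n, with its weight 2^(n e
    p) included. The exponents combine to r^n, and r < 1 means e < s - \<sigma>.\<close>
  define f where "f = (\<lambda>n::nat. if - int n \<in> I then E * r ^ n else 0)"
  have r: "0 < r" by (simp add: r_def)
  have f0: "0 \<le> f n" for n using E r by (simp add: f_def)
  have "summable f"
  proof (cases "?\<sigma> < s")
    case True
    then have "p * (e - (s - ?\<sigma>)) < 0" using p by (simp add: e_def mult_pos_neg field_simps)
    then have "r < 1" using powr_less_mono[of "p * (e - (s - ?\<sigma>))" 0 2] by (simp add: r_def)
    then have "summable (\<lambda>n. E * r ^ n)" using r by (intro summable_mult summable_geometric) auto
    then show ?thesis by (rule summable_comparison_test'[of _ 0]) (use E r in \<open>auto simp: f_def\<close>)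
  next
    case False
    have "finite ((\<lambda>k. nat (- k)) ` I)" using cases False by simp
    then show ?thesis
    proof (rule summable_finite)
      fix n assume n: "n \<notin> (\<lambda>k. nat (- k)) ` I"
      have "- int n \<notin> I"
      proof
        assume "- int n \<in> I"
        then have "nat (- (- int n)) \<in> (\<lambda>k. nat (- k)) ` I" by (rule imageI)
        then show False using n by simp
      qed
      then show "f n = 0" by (simp add: f_def)
    qed
  qed
  define F where "F = suminf f"
  have F: "0 \<le> F" unfolding F_def by (rule suminf_nonneg[OF \<open>summable f\<close> f0])
  show ?thesis
  proof (rule dominated_onI[of "(D powr p * (F + 1)) powr (1 / p)"])
    show "0 < (D powr p * (F + 1)) powr (1 / p)" using D F by simp
    fix T :: "('a \<Rightarrow> complex) \<Rightarrow> complex" assume T: "T \<in> tempered_distributions"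
    note [measurable] = block_measurable[OF T, of s]
    show "morrey_norm u p (\<lambda>x. lq_norm q I (block s T x)) \<le> ennreal ((D powr p * (F + 1)) powr (1 / p)) * morrey_norm u p (\<lambda>x. ennreal (norm (low 0 T x)))"
    proof (rule morrey_norm_le[OF p])
      show "0 < D powr p * (F + 1)" using D F by simp
      fix R :: real
      let ?G = "sup_ball R (lowp p 0 T)"
      \<comment> \<open>The p-th powers of the weighted blocks. Each member of the supremum is at
        most the p-th root of their sum, so the p-th power of the supremum is at most the
        series.\<close>
      define t where "t = (\<lambda>n x. if - int n \<in> I then ennreal (2 powr (real n * e * p)) * ennreal (block s T x (- int n) powr p) else 0)"
      have [measurable]: "t n \<in> borel_measurable borel" for n unfolding t_def by (cases "- int n \<in> I") simp_all
      have pt: "epowr (lq_norm q I (block s T x)) p \<le> ennreal (D powr p) * (\<Sum>n. t n x)" for x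
      proof -
        let ?M = "SUP k\<in>I. ennreal (2 powr (- (real_of_int k * e)) * \<bar>block s T x k\<bar>)"
        have "?M \<le> epowr (\<Sum>n. t n x) (1 / p)"
        proof (rule SUP_least)
          fix k assume k: "k \<in> I"
          define n where "n = nat (- k)"
          have kn: "k = - int n" using k I by (auto simp: n_def)
          let ?v = "2 powr (- (real_of_int k * e)) * \<bar>block s T x k\<bar>"
          have "ennreal (?v powr p) = t n x"
            using k block_nonneg[of s T x k] unfolding kn by (simp add: t_def powr_mult powr_powr flip: ennreal_mult)
          also have "\<dots> \<le> (\<Sum>n. t n x)"
            using sum_le_suminf[of "\<lambda>n. t n x" "{n}"] by simp
          finally have "epowr (ennreal (?v powr p)) (1 / p) \<le> epowr (\<Sum>n. t n x) (1 / p)"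
            using p by (intro epowr_mono) auto
          then show "ennreal ?v \<le> epowr (\<Sum>n. t n x) (1 / p)"
            using epowr_inverse[OF p, of "ennreal ?v"] by (simp add: epowr_ennreal)
        qed
        then have M: "epowr ?M p \<le> (\<Sum>n. t n x)"
          using epowr_mono[of ?M "epowr (\<Sum>n. t n x) (1 / p)" p] p by (simp add: epowr_inverse')
        have "epowr (lq_norm q I (block s T x)) p \<le> epowr (ennreal D * ?M) p"
          using p by (intro epowr_mono Dle) auto
        also have "\<dots> = ennreal (D powr p) * epowr ?M p" by (rule epowr_cmult[OF D])
        also have "\<dots> \<le> ennreal (D powr p) * (\<Sum>n. t n x)" by (intro mult_left_mono M) auto
        finally show ?thesis .
      qed
      have tn: "sup_ball R (t n) \<le> ennreal (f n) * ?G" for n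
      proof (cases "- int n \<in> I")
        case True
        have "sup_ball R (t n) = sup_ball R (\<lambda>x. ennreal (2 powr (real n * e * p)) * ennreal (block s T x (- int n) powr p))"
          using True by (simp add: t_def)
        also have "\<dots> \<le> ennreal (2 powr (real n * e * p)) * sup_ball R (\<lambda>x. ennreal (block s T x (- int n) powr p))"
          by (rule sup_ball_cmult) measurable
        also have "\<dots> \<le> ennreal (2 powr (real n * e * p)) * (ennreal (E * 2 powr (real_of_int (- int n) * (p * (s - ?\<sigma>)))) * ?G)"
          by (intro mult_left_mono Ele T) auto
        also have "\<dots> = ennreal (2 powr (real n * e * p) * (E * 2 powr (real_of_int (- int n) * (p * (s - ?\<sigma>))))) * ?G"
          using E by (simp add: ennreal_mult mult.assoc)
        also have "2 powr (real n * e * p) * (E * 2 powr (real_of_int (- int n) * (p * (s - ?\<sigma>)))) = f n"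
          using True by (simp add: f_def r_def powr_powr algebra_simps flip: powr_realpow powr_add)
        finally show ?thesis .
      qed (simp add: t_def f_def sup_ball_def)
      have "sup_ball R (\<lambda>x. epowr (lq_norm q I (block s T x)) p) \<le> sup_ball R (\<lambda>x. ennreal (D powr p) * (\<Sum>n. t n x))"
        by (rule sup_ball_mono) (rule pt)
      also have "\<dots> \<le> ennreal (D powr p) * sup_ball R (\<lambda>x. \<Sum>n. t n x)"
        by (rule sup_ball_cmult) measurable
      also have "\<dots> \<le> ennreal (D powr p) * (\<Sum>n. sup_ball R (t n))"
        by (intro mult_left_mono sup_ball_suminf) auto
      also have "\<dots> \<le> ennreal (D powr p) * (\<Sum>n. ennreal (f n) * ?G)"
        by (intro mult_left_mono suminf_le tn) auto
      also have "(\<Sum>n. ennreal (f n) * ?G) = ennreal F * ?G"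
        unfolding F_def by (simp add: suminf_ennreal2[OF f0 \<open>summable f\<close>] ennreal_suminf_multc)
      also have "ennreal (D powr p) * (ennreal F * ?G) = ennreal (D powr p * F) * ?G"
        using F by (simp add: ennreal_mult mult.assoc)
      also have "\<dots> \<le> ennreal (D powr p * (F + 1)) * ?G"
        by (intro mult_right_mono ennreal_leI mult_left_mono) auto
      finally show "sup_ball R (\<lambda>x. epowr (lq_norm q I (block s T x)) p) \<le> ennreal (D powr p * (F + 1)) * sup_ball R (\<lambda>x. epowr (ennreal (norm (low 0 T x))) p)"
        by (simp add: epowr_ennreal)
    qed
  qed
qed

section \<open>Comparison of each expression with a reference\<close>

definition bottom :: "real \<Rightarrow> real \<Rightarrow> (('a \<Rightarrow> complex) \<Rightarrow> complex) \<Rightarrow> ennreal" where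
  "bottom u p T = morrey_norm u p (\<lambda>x. ennreal (norm (low 0 T x)))"

definition blocks :: "int set \<Rightarrow> real \<Rightarrow> real \<Rightarrow> real \<Rightarrow> ennreal \<Rightarrow> (('a \<Rightarrow> complex) \<Rightarrow> complex) \<Rightarrow> ennreal" where
  "blocks I s u p q T = morrey_norm u p (\<lambda>x. lq_norm q I (block s T x))"

text \<open>The expressions of the theorem share the frequencies k \<ge> 1 and differ only in their
  treatment of k \<le> 0. Comparing each with this one yields all equivalences by
  transitivity.\<close>

definition ref :: "real \<Rightarrow> real \<Rightarrow> real \<Rightarrow> ennreal \<Rightarrow> (('a \<Rightarrow> complex) \<Rightarrow> complex) \<Rightarrow> ennreal" where
  "ref s u p q T = bottom u p T + blocks {1..} s u p q T"

lemma lq_block_measurable: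
  assumes "T \<in> tempered_distributions"
  shows "(\<lambda>x. lq_norm q I (block s T x)) \<in> borel_measurable borel"
  by (intro lq_norm_measurable block_measurable[OF assms]) simp

lemma low_ennreal_measurable:
  assumes "T \<in> tempered_distributions"
  shows "(\<lambda>x. ennreal (norm (low j T x))) \<in> borel_measurable borel"
  using low_measurable[OF assms, of j] by measurable

lemma bottom_ref: "dominated_on tempered_distributions (bottom u p) (ref s u p q)"
  by (rule dominated_on_le) (simp add: ref_def)

lemma blocks_ref:
  assumes p: "0 < p" and q: "0 < q" and I: "I \<subseteq> {..0}" and cases: "finite I \<or> sigma_p DIM('a) p < s"
  shows "dominated_on tempered_distributions (blocks (I \<union> {1..}) s u p q) (ref s u p q)"
proof -
  have "dominated_on tempered_distributions (blocks (I \<union> {1..}) s u p q) (\<lambda>T. blocks I s u p q T + blocks {1..} s u p q T)"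
  proof (rule dominated_onI)
    show "0 < qconst q * (2 * 2 powr (1 / p))" using qconst_pos by simp
    fix T :: "('a \<Rightarrow> complex) \<Rightarrow> complex" assume T: "T \<in> tempered_distributions"
    note [measurable] = lq_block_measurable[OF T]
    have "blocks (I \<union> {1..}) s u p q T \<le> morrey_norm u p (\<lambda>x. ennreal (qconst q) * (lq_norm q I (block s T x) + lq_norm q {1..} (block s T x)))"
      unfolding blocks_def using p I q by (intro morrey_norm_mono lq_norm_union) auto
    also have "\<dots> \<le> ennreal (qconst q) * morrey_norm u p (\<lambda>x. lq_norm q I (block s T x) + lq_norm q {1..} (block s T x))"
      by (intro morrey_norm_cmult p qconst_pos) measurable
    also have "\<dots> \<le> ennreal (qconst q) * (ennreal (2 * 2 powr (1 / p)) * (blocks I s u p q T + blocks {1..} s u p q T))"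
      unfolding blocks_def by (intro mult_left_mono morrey_norm_add p) auto
    also have "\<dots> = ennreal (qconst q * (2 * 2 powr (1 / p))) * (blocks I s u p q T + blocks {1..} s u p q T)"
      using qconst_pos[of q] by (simp add: ennreal_mult mult.assoc)
    finally show "blocks (I \<union> {1..}) s u p q T \<le> ennreal (qconst q * (2 * 2 powr (1 / p))) * (blocks I s u p q T + blocks {1..} s u p q T)" .
  qed
  moreover have "dominated_on tempered_distributions (blocks I s u p q) (ref s u p q)"
    using dominated_on_trans[OF low_blocks_dominated[OF p q I cases] bottom_ref[unfolded bottom_def[abs_def]]]
    by (simp add: blocks_def[abs_def])
  moreover have "dominated_on tempered_distributions (blocks {1..} s u p q) (ref s u p q)"
    by (rule dominated_on_le) (simp add: ref_def)
  ultimately show ?thesis using dominated_on_add dominated_on_trans by blast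
qed

lemma blocks_mono: "I \<subseteq> J \<Longrightarrow> 0 < p \<Longrightarrow> 0 < q \<Longrightarrow> blocks I s u p q T \<le> blocks J s u p q T"
  unfolding blocks_def by (intro morrey_norm_mono lq_norm_mono)

lemma TLM_seminorm_blocks:
  assumes "T \<in> tempered_distributions"
  shows "TLM_seminorm \<phi>\<^sub>0 s u p q K T = blocks {k. - K \<le> ereal (real_of_int k)} s u p q T"
  by (simp add: TLM_seminorm_def blocks_def block_def multiplier_psi[OF assms] cong: lq_norm_cong)

text \<open>In \<open>TLM_norm\<close> the function S_0 f is the member of index 0 of the sequence,
  while \<open>ref\<close> keeps it outside the sequence norm. The index 0 is split off, and the
  remaining indices are carried from \<open>nat\<close> to \<open>int\<close>.\<close>

lemma TLM_norm_ref:
  assumes p: "0 < p" and q: "0 < q"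
  shows "dominated_on tempered_distributions (TLM_norm \<phi>\<^sub>0 s u p q) (ref s u p q)"
    and "dominated_on tempered_distributions (ref s u p q) (TLM_norm \<phi>\<^sub>0 s u p q)"
proof -
  let ?c = "\<lambda>T x (k::nat). 2 powr (real k * s) * norm (fourier_multiplier (phi \<phi>\<^sub>0 k) T x)"
  have zero: "?c T x 0 = norm (low 0 T x)" if "T \<in> tempered_distributions" for T x
    by (simp add: phi_def multiplier_cutoff[OF that])
  have img: "int ` {1..} = {1..}"
  proof
    show "{1..} \<subseteq> int ` {1..}"
    proof
      fix k :: int assume "k \<in> {1..}"
      then have "k = int (nat k)" "nat k \<in> {1..}" by auto
      then show "k \<in> int ` {1..}" by blast
    qed
  qed auto
  have high: "lq_norm q {1..} (?c T x) = lq_norm q {1..} (block s T x)" if "T \<in> tempered_distributions" for T x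
  proof -
    have "lq_norm q {1..} (?c T x) = lq_norm q {1..} (\<lambda>k::nat. block s T x (int k))"
      by (rule lq_norm_cong) (auto simp: phi_def block_def multiplier_psi[OF that])
    also have "\<dots> = lq_norm q (int ` {1..}) (block s T x)" by (rule lq_norm_reindex[symmetric]) simp
    finally show ?thesis by (simp only: img)
  qed
  have U: "(UNIV :: nat set) = {0} \<union> {1..}" by auto
  show "dominated_on tempered_distributions (TLM_norm \<phi>\<^sub>0 s u p q) (ref s u p q)"
  proof (rule dominated_onI)
    show "0 < qconst q * (2 * 2 powr (1 / p))" using qconst_pos by simp
    fix T :: "('a \<Rightarrow> complex) \<Rightarrow> complex" assume T: "T \<in> tempered_distributions"
    note [measurable] = lq_block_measurable[OF T] low_ennreal_measurable[OF T]
    have "TLM_norm \<phi>\<^sub>0 s u p q T \<le> morrey_norm u p (\<lambda>x. ennreal (qconst q) * (ennreal (norm (low 0 T x)) + lq_norm q {1..} (block s T x)))"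
      unfolding TLM_norm_def
    proof (rule morrey_norm_mono[OF p])
      fix x
      show "lq_norm q UNIV (?c T x) \<le> ennreal (qconst q) * (ennreal (norm (low 0 T x)) + lq_norm q {1..} (block s T x))"
        using lq_norm_union[OF _ q, of "{0::nat}" "{1..}" "?c T x"]
        unfolding U[symmetric] high[OF T] lq_norm_singleton[OF q] zero[OF T] by simp
    qed
    also have "\<dots> \<le> ennreal (qconst q) * morrey_norm u p (\<lambda>x. ennreal (norm (low 0 T x)) + lq_norm q {1..} (block s T x))"
      by (intro morrey_norm_cmult p qconst_pos) measurable
    also have "\<dots> \<le> ennreal (qconst q) * (ennreal (2 * 2 powr (1 / p)) * ref s u p q T)"
      unfolding ref_def bottom_def blocks_def
      by (intro mult_left_mono morrey_norm_add p low_ennreal_measurable lq_block_measurable T) simp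
    also have "\<dots> = ennreal (qconst q * (2 * 2 powr (1 / p))) * ref s u p q T"
      using qconst_pos[of q] by (simp add: ennreal_mult mult.assoc)
    finally show "TLM_norm \<phi>\<^sub>0 s u p q T \<le> ennreal (qconst q * (2 * 2 powr (1 / p))) * ref s u p q T" .
  qed
  have "dominated_on tempered_distributions (bottom u p) (TLM_norm \<phi>\<^sub>0 s u p q)"
  proof (rule dominated_on_le)
    fix T :: "('a \<Rightarrow> complex) \<Rightarrow> complex" assume T: "T \<in> tempered_distributions"
    show "bottom u p T \<le> TLM_norm \<phi>\<^sub>0 s u p q T"
      unfolding bottom_def TLM_norm_def
    proof (rule morrey_norm_mono[OF p])
      show "ennreal (norm (low 0 T x)) \<le> lq_norm q UNIV (?c T x)" for x
        using lq_norm_member[of "0::nat" UNIV q "?c T x"] q unfolding zero[OF T] by simp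
    qed
  qed
  moreover have "dominated_on tempered_distributions (blocks {1..} s u p q) (TLM_norm \<phi>\<^sub>0 s u p q)"
  proof (rule dominated_on_le)
    fix T :: "('a \<Rightarrow> complex) \<Rightarrow> complex" assume T: "T \<in> tempered_distributions"
    show "blocks {1..} s u p q T \<le> TLM_norm \<phi>\<^sub>0 s u p q T"
      unfolding blocks_def TLM_norm_def high[OF T, symmetric]
      by (intro morrey_norm_mono p lq_norm_mono q) auto
  qed
  ultimately show "dominated_on tempered_distributions (ref s u p q) (TLM_norm \<phi>\<^sub>0 s u p q)"
    unfolding ref_def[abs_def] by (rule dominated_on_add)
qed

lemma TLM_norm_club_ref:
  assumes p: "0 < p" and q: "0 < q" and K: "K \<noteq> \<infinity> \<or> sigma_p DIM('a) p < s"
  shows "dominated_on tempered_distributions (TLM_norm_club \<phi>\<^sub>0 s u p q K) (ref s u p q)"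
    and "dominated_on tempered_distributions (ref s u p q) (TLM_norm_club \<phi>\<^sub>0 s u p q K)"
proof -
  define I where "I = {k::int. - ereal_of_enat K \<le> ereal (real_of_int k)}"
  have Ieq: "I = (case K of enat n \<Rightarrow> {- int n..0} | \<infinity> \<Rightarrow> {..0}) \<union> {1..}"
    by (cases K) (auto simp: I_def)
  have club: "TLM_norm_club \<phi>\<^sub>0 s u p q K T = bottom u p T + blocks I s u p q T" if "T \<in> tempered_distributions" for T
    unfolding TLM_norm_club_def TLM_seminorm_blocks[OF that] multiplier_cutoff[OF that] bottom_def I_def ..
  have "dominated_on tempered_distributions (\<lambda>T. bottom u p T + blocks I s u p q T) (ref s u p q)"
    unfolding Ieq by (intro dominated_on_add bottom_ref blocks_ref p q) (use K in \<open>auto split: enat.splits\<close>)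
  then show "dominated_on tempered_distributions (TLM_norm_club \<phi>\<^sub>0 s u p q K) (ref s u p q)"
    by (rule dominated_on_trans[rotated]) (simp add: dominated_on_le club)
  have "ref s u p q T \<le> TLM_norm_club \<phi>\<^sub>0 s u p q K T" if T: "T \<in> tempered_distributions" for T
    unfolding ref_def club[OF T] using p q Ieq by (intro add_left_mono blocks_mono) auto
  then show "dominated_on tempered_distributions (ref s u p q) (TLM_norm_club \<phi>\<^sub>0 s u p q K)"
    by (rule dominated_on_le)
qed

text \<open>\<open>TLM_norm_K\<close> does not contain S_0 f; this recovers it from the lowest piece
  and the blocks of index -K to 0.\<close>

lemma low_telescope: "low 0 T x = low (- int K - 1) T x + (\<Sum>k\<in>{- int K..0}. low k T x - low (k - 1) T x)"
proof (induction K)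
  case (Suc K)
  have e: "- int (Suc K) = - int K - 1" by simp
  have "{- int K - 1..0} = insert (- int K - 1) {- int K..0}" by auto
  then show ?case unfolding e using Suc by simp
qed simp

lemma TLM_norm_K_ref:
  assumes p: "0 < p" and q: "0 < q"
  shows "dominated_on tempered_distributions (TLM_norm_K \<phi>\<^sub>0 s u p q K) (ref s u p q)"
    and "dominated_on tempered_distributions (ref s u p q) (TLM_norm_K \<phi>\<^sub>0 s u p q K)"
proof -
  define I where "I = {k::int. - ereal (real K) \<le> ereal (real_of_int k)}"
  have Ieq: "I = {- int K..0} \<union> {1..}" by (auto simp: I_def)
  define Z where "Z = (\<lambda>T. morrey_norm u p (\<lambda>x. ennreal (norm (low (- int K - 1) T x))))"
  define w where "w = 2 powr (- real K * s)"
  have w: "0 < w" by (simp add: w_def)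
  have TK: "TLM_norm_K \<phi>\<^sub>0 s u p q K T = ennreal w * Z T + blocks I s u p q T" if "T \<in> tempered_distributions" for T
  proof -
    \<comment> \<open>Dilation by 2^(K + 1) gives the piece of index -K - 1, just below the lowest
      block; no gap remains in \<open>low_telescope\<close>.\<close>
    have e: "- int (K + 1) = - int K - 1" by simp
    show ?thesis
      unfolding TLM_norm_K_def TLM_seminorm_blocks[OF that] multiplier_dilate[OF that] Z_def I_def w_def e ..
  qed
  have "dominated_on tempered_distributions Z (bottom u p)"
  proof -
    obtain C where C: "0 < C" and le': "\<And>T j R. T \<in> tempered_distributions \<Longrightarrow> j \<le> 0 \<Longrightarrow>
      sup_ball R (lowp p j T) \<le>
      ennreal (C * (2 powi j) powr (- (p * sigma_p DIM('a) p))) * sup_ball R (lowp p 0 T)"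
      using low_sup_ball[OF p] by blast
    have le: "sup_ball R (lowp p (- int K - 1) T) \<le>
      ennreal (C * (2 powi (- int K - 1)) powr (- (p * sigma_p DIM('a) p))) * sup_ball R (lowp p 0 T)"
      if "T \<in> tempered_distributions" for T R
      by (rule le'[OF that]) simp
    let ?A = "C * (2 powi (- int K - 1)) powr (- (p * sigma_p DIM('a) p))"
    show ?thesis unfolding Z_def bottom_def[abs_def]
      by (rule dominated_onI[of "?A powr (1 / p)"], use C in simp, rule morrey_norm_le[OF p]) (use C le in \<open>auto simp: epowr_ennreal\<close>)
  qed
  then have "dominated_on tempered_distributions (\<lambda>T. ennreal w * Z T + blocks I s u p q T) (ref s u p q)"
    unfolding Ieq by (intro dominated_on_add dominated_on_cmult w blocks_ref p q dominated_on_trans[OF _ bottom_ref]) auto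
  then show "dominated_on tempered_distributions (TLM_norm_K \<phi>\<^sub>0 s u p q K) (ref s u p q)"
    by (rule dominated_on_trans[rotated]) (simp add: dominated_on_le TK)
  \<comment> \<open>Sums the factors that remove the weights 2^(k s). Each of the K + 1 blocks is
    bounded by the whole sequence norm.\<close>
  define c where "c = (\<Sum>k\<in>{- int K..0}. 2 powr (- (real_of_int k * s)))"
  have c: "0 < c" unfolding c_def by (rule sum_pos) auto
  have "dominated_on tempered_distributions (bottom u p) (\<lambda>T. Z T + ennreal c * blocks I s u p q T)"
  proof (rule dominated_onI)
    show "0 < 2 * 2 powr (1 / p)" by simp
    fix T :: "('a \<Rightarrow> complex) \<Rightarrow> complex" assume T: "T \<in> tempered_distributions"
    note [measurable] = lq_block_measurable[OF T] low_ennreal_measurable[OF T]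
    have pt: "ennreal (norm (low 0 T x)) \<le> ennreal (norm (low (- int K - 1) T x)) + ennreal c * lq_norm q I (block s T x)" for x
    proof -
      have "norm (low 0 T x) \<le> norm (low (- int K - 1) T x) + (\<Sum>k\<in>{- int K..0}. norm (low k T x - low (k - 1) T x))"
        by (subst low_telescope[of T x K]) (intro order_trans[OF norm_triangle_ineq] add_left_mono norm_sum)
      also have "(\<Sum>k\<in>{- int K..0}. norm (low k T x - low (k - 1) T x)) = (\<Sum>k\<in>{- int K..0}. 2 powr (- (real_of_int k * s)) * block s T x k)"
        by (simp add: block_def mult.assoc[symmetric] flip: powr_add)
      finally have "ennreal (norm (low 0 T x)) \<le> ennreal (norm (low (- int K - 1) T x)) + ennreal (\<Sum>k\<in>{- int K..0}. 2 powr (- (real_of_int k * s)) * block s T x k)"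
        by (simp add: ennreal_leI block_nonneg sum_nonneg flip: ennreal_plus)
      also have "ennreal (\<Sum>k\<in>{- int K..0}. 2 powr (- (real_of_int k * s)) * block s T x k) = (\<Sum>k\<in>{- int K..0}. ennreal (2 powr (- (real_of_int k * s))) * ennreal (block s T x k))"
        by (subst sum_ennreal[symmetric]) (auto simp: block_nonneg ennreal_mult)
      also have "\<dots> \<le> (\<Sum>k\<in>{- int K..0}. ennreal (2 powr (- (real_of_int k * s))) * lq_norm q I (block s T x))"
      proof (intro sum_mono mult_left_mono)
        fix k assume "k \<in> {- int K..0}"
        then show "ennreal (block s T x k) \<le> lq_norm q I (block s T x)"
          using lq_norm_member[of k I q "block s T x"] q block_nonneg[of s T x k] by (simp add: Ieq)
      qed auto
      also have "\<dots> = (\<Sum>k\<in>{- int K..0}. ennreal (2 powr (- (real_of_int k * s)))) * lq_norm q I (block s T x)"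
        by (simp only: sum_distrib_right)
      also have "(\<Sum>k\<in>{- int K..0}. ennreal (2 powr (- (real_of_int k * s)))) = ennreal c"
        unfolding c_def by (rule sum_ennreal) simp
      finally show ?thesis by (simp add: add_left_mono)
    qed
    have "bottom u p T \<le> morrey_norm u p (\<lambda>x. ennreal (norm (low (- int K - 1) T x)) + ennreal c * lq_norm q I (block s T x))"
      unfolding bottom_def by (rule morrey_norm_mono[OF p]) (rule pt)
    also have "\<dots> \<le> ennreal (2 * 2 powr (1 / p)) * (Z T + morrey_norm u p (\<lambda>x. ennreal c * lq_norm q I (block s T x)))"
      unfolding Z_def by (intro morrey_norm_add p) measurable
    also have "\<dots> \<le> ennreal (2 * 2 powr (1 / p)) * (Z T + ennreal c * blocks I s u p q T)"
      unfolding blocks_def by (intro mult_left_mono add_left_mono morrey_norm_cmult p c) auto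
    finally show "bottom u p T \<le> ennreal (2 * 2 powr (1 / p)) * (Z T + ennreal c * blocks I s u p q T)" .
  qed
  moreover have b: "dominated_on tempered_distributions (blocks I s u p q) (TLM_norm_K \<phi>\<^sub>0 s u p q K)"
    by (rule dominated_on_le) (simp add: TK)
  moreover have "dominated_on tempered_distributions Z (TLM_norm_K \<phi>\<^sub>0 s u p q K)"
  proof (rule dominated_onI[of "1 / w"])
    fix T :: "('a \<Rightarrow> complex) \<Rightarrow> complex" assume T: "T \<in> tempered_distributions"
    have "Z T = ennreal (1 / w) * (ennreal w * Z T)" using w by (simp flip: mult.assoc ennreal_mult)
    also have "\<dots> \<le> ennreal (1 / w) * TLM_norm_K \<phi>\<^sub>0 s u p q K T"
      unfolding TK[OF T] by (intro mult_left_mono) auto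
    finally show "Z T \<le> ennreal (1 / w) * TLM_norm_K \<phi>\<^sub>0 s u p q K T" .
  qed (use w in simp)
  ultimately have "dominated_on tempered_distributions (bottom u p) (TLM_norm_K \<phi>\<^sub>0 s u p q K)"
    using dominated_on_trans[OF _ dominated_on_add[OF _ dominated_on_cmult[OF b c]]] by blast
  moreover have "dominated_on tempered_distributions (blocks {1..} s u p q) (TLM_norm_K \<phi>\<^sub>0 s u p q K)"
    by (rule dominated_on_trans[OF dominated_on_le b], rule blocks_mono) (use p q Ieq in auto)
  ultimately show "dominated_on tempered_distributions (ref s u p q) (TLM_norm_K \<phi>\<^sub>0 s u p q K)"
    unfolding ref_def[abs_def] by (rule dominated_on_add)
qed

end

theorem theorem4p3:
  fixes \<phi>\<^sub>0 :: "'a::euclidean_space \<Rightarrow> real"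
    and a b s u p :: real and q :: ennreal and K :: nat
  assumes "1 \<le> a" and "a < b" and "b \<le> 2"
    and "\<phi>\<^sub>0 \<in> test_functions"
    and "\<And>x. 0 \<le> \<phi>\<^sub>0 x"
    and "\<And>x. norm x \<le> a \<Longrightarrow> \<phi>\<^sub>0 x = 1"
    and "\<And>x. norm x \<ge> b \<Longrightarrow> \<phi>\<^sub>0 x = 0"
    and "0 < p" and "p \<le> u" and "0 < q"
  shows "equivalent_on tempered_distributions
           (TLM_norm \<phi>\<^sub>0 s u p q) (TLM_norm_club \<phi>\<^sub>0 s u p q (enat K)) \<and>
         equivalent_on tempered_distributions
           (TLM_norm \<phi>\<^sub>0 s u p q) (TLM_norm_K \<phi>\<^sub>0 s u p q K) \<and>
         equivalent_on tempered_distributions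
           (TLM_norm_club \<phi>\<^sub>0 s u p q (enat K)) (TLM_norm_K \<phi>\<^sub>0 s u p q K) \<and>
         (s > sigma_p DIM('a) p \<longrightarrow>
          equivalent_on tempered_distributions
            (TLM_norm_club \<phi>\<^sub>0 s u p q \<infinity>) (TLM_norm \<phi>\<^sub>0 s u p q))"
proof -
  interpret cutoff \<phi>\<^sub>0 a b by standard (use assms in auto)
  have p: "0 < p" and q: "0 < q" using assms by auto
  \<comment> \<open>A finite index meets the side condition outright; for the infinite one it is the
    hypothesis s > \<sigma>.\<close>
  have "enat K \<noteq> \<infinity> \<or> sigma_p DIM('a) p < s" by simp
  note K = TLM_norm_club_ref[OF p q this]
  show ?thesis
    by (intro conjI impI; rule equivalent_on_via[where D = "ref s u p q"];
        intro TLM_norm_ref TLM_norm_K_ref K p q TLM_norm_club_ref disjI2)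
qed

end
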